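(* For every permutation $w\in S_n$ and every partition $\lambda$, the Edelman-Greene coefficient $c^w_\lambda$ equals the number of leaves of the modified Lascoux-Sch\"utzenberger tree of $w$ whose labels are dominant permutations with Lehmer code equal to $\lambda$.
   Context: Permutations are in one-line notation; $\ell(u)$ is the number of inversions; $ut_{a,b}$ swaps the entries in positions $a$ and $b$. For $1\le k\le n$ let $I(u,k)=\{i<k : \ell(ut_{i,k})=\ell(u)+1\}$; let $1\times u=1(u_1+1)\cdots(u_n+1)$; define $\Phi(u,k)=\{ut_{i,k}: i\in I(u,k)\}$ if $I(u,k)\ne\emptyset$ and $\Phi(u,k)=\Phi(1\times u,k+1)$ otherwise. A permutation is dominant if it avoids the pattern $132$ (no $i<t<j$ with $u_i<u_j<u_t$). For a non-dominant $u$ let $p=\max\{t : \exists\, i<t<j,\ u_i<u_j<u_t\}$ and $q=\max\{j : j>p,\ u_j<u_p,\ \exists\, i<p,\ u_i<u_j\}$. The modified Lascoux-Sch\"utzenberger tree of $w$ is the rooted tree whose root is labeled $w$, in which a node labeled by a dominant permutation is a leaf, and a node labeled by a non-dominant $u$ has as children nodes labeled by the elements of $\Phi(ut_{p,q},p)$ (these lie in $S_n$); this process terminates. The Lehmer code of $u\in S_n$ is $(c_1,\ldots,c_n)$ with $c_i=|\{j>i: u_j<u_i\}|$; for dominant $u$ it is weakly decreasing and is identified with a partition. The Stanley symmetric function is $F_w(x)=\sum_{(a_1,\ldots,a_\ell)}\sum_{1\le b_1\le\cdots\le b_\ell,\ a_i<a_{i+1}\Rightarrow b_i<b_{i+1}}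 x_{b_1}\cdots x_{b_\ell}$, summed over reduced words $(a_1,\dots,a_\ell)$ of $w$ (i.e. $w=s_{a_1}\cdots s_{a_\ell}$ of minimal length, where $ws_i$ swaps $w_i,w_{i+1}$). The Edelman-Greene coefficients $c^w_\lambda$ are defined by $F_w(x)=\sum_\lambda c^w_\lambda s_\lambda(x)$, with $s_\lambda$ the Schur functions. *)

theory Defs
  imports
    "HOL-Combinatorics.Permutations"
    "HOL-Library.Multiset"
    "HOL-Library.FuncSet"
    "HOL-Library.More_List"
begin

section \<open>Permutations\<close>

text \<open>
  A permutation \<open>u \<in> S\<^sub>n\<close> is a function with \<open>u permutes {1..n}\<close>; its one-line notation is
  \<open>u 1, \<dots>, u n\<close>. As \<open>u\<close> fixes every number above \<open>n\<close>, positions above \<open>n\<close> take part neither in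
  an inversion nor in a pattern \<open>132\<close>, so the notions below need no explicit \<open>n\<close>. The position \<open>0\<close>
  has to be excluded by hand, because \<open>u 0 = 0\<close> could play the role of the \<open>1\<close> in a pattern \<open>132\<close>.
\<close>

definition ell :: "(nat \<Rightarrow> nat) \<Rightarrow> nat" where
  "ell u = card {(i, j). 1 \<le> i \<and> i < j \<and> u j < u i}"

definition swap_pos :: "(nat \<Rightarrow> nat) \<Rightarrow> nat \<Rightarrow> nat \<Rightarrow> nat \<Rightarrow> nat" where
  "swap_pos u a b = u \<circ> transpose a b"

definition one_times :: "(nat \<Rightarrow> nat) \<Rightarrow> nat \<Rightarrow> nat" where
  "one_times u i = (if i \<le> 1 then i else u (i - 1) + 1)"

definition I_set :: "(nat \<Rightarrow> nat) \<Rightarrow> nat \<Rightarrow> nat set" where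
  "I_set u k = {i. 1 \<le> i \<and> i < k \<and> ell (swap_pos u i k) = ell u + 1}"

text \<open>
  \<open>\<Phi>(u, k)\<close> is given by a recursion that passes from \<open>S\<^sub>n\<close> to \<open>S\<^sub>n\<^sub>+\<^sub>1\<close>. It is introduced as an
  inductive relation in order to avoid a termination proof for functions \<open>u\<close> that are not
  permutations; lemma \<open>Phi_rec\<close> gives the recursion equation.
\<close>

inductive Phi_rel :: "(nat \<Rightarrow> nat) \<Rightarrow> nat \<Rightarrow> (nat \<Rightarrow> nat) \<Rightarrow> bool" where
  swap: "i \<in> I_set u k \<Longrightarrow> Phi_rel u k (swap_pos u i k)"
| shift: "I_set u k = {} \<Longrightarrow> Phi_rel (one_times u) (k + 1) v \<Longrightarrow> Phi_rel u k v"

definition Phi :: "(nat \<Rightarrow> nat) \<Rightarrow> nat \<Rightarrow> (nat \<Rightarrow> nat) set" where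
  "Phi u k = {v. Phi_rel u k v}"

lemma Phi_rec:
  "Phi u k = (if I_set u k \<noteq> {} then {swap_pos u i k | i. i \<in> I_set u k}
              else Phi (one_times u) (k + 1))"
  unfolding Phi_def
  by (auto intro: Phi_rel.intros elim: Phi_rel.cases)

definition dominant :: "(nat \<Rightarrow> nat) \<Rightarrow> bool" where
  "dominant u \<longleftrightarrow> \<not> (\<exists>i t j. 1 \<le> i \<and> i < t \<and> t < j \<and> u i < u j \<and> u j < u t)"

definition lehmer_code :: "nat \<Rightarrow> (nat \<Rightarrow> nat) \<Rightarrow> nat list" where
  "lehmer_code n u = map (\<lambda>i. card {j. i < j \<and> j \<le> n \<and> u j < u i}) [1..<n + 1]"


section \<open>The modified Lascoux-Schuetzenberger tree\<close>

definition p_pos :: "(nat \<Rightarrow> nat) \<Rightarrow> nat" where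
  "p_pos u = Max {t. \<exists>i j. 1 \<le> i \<and> i < t \<and> t < j \<and> u i < u j \<and> u j < u t}"

definition q_pos :: "(nat \<Rightarrow> nat) \<Rightarrow> nat" where
  "q_pos u = Max {j. p_pos u < j \<and> u j < u (p_pos u) \<and> (\<exists>i. 1 \<le> i \<and> i < p_pos u \<and> u i < u j)}"

definition child_labels :: "(nat \<Rightarrow> nat) \<Rightarrow> (nat \<Rightarrow> nat) set" where
  "child_labels u =
     (if dominant u then {} else Phi (swap_pos u (p_pos u) (q_pos u)) (p_pos u))"

text \<open>
  The children of a node carry pairwise distinct labels, so a node is determined by the sequence of
  labels on the path from the root to it. Nodes are represented by these sequences, the label of a
  node being the last entry; different nodes with the same label remain different.
\<close>

inductive_set mLS_nodes :: "(nat \<Rightarrow> nat) \<Rightarrow> (nat \<Rightarrow> nat) list set" for w where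
  root: "[w] \<in> mLS_nodes w"
| child: "\<pi> \<in> mLS_nodes w \<Longrightarrow> v \<in> child_labels (last \<pi>) \<Longrightarrow> \<pi> @ [v] \<in> mLS_nodes w"

definition mLS_leaves :: "(nat \<Rightarrow> nat) \<Rightarrow> (nat \<Rightarrow> nat) list set" where
  "mLS_leaves w = {\<pi> \<in> mLS_nodes w. \<forall>v. \<pi> @ [v] \<notin> mLS_nodes w}"


section \<open>Stanley symmetric functions, Schur functions, Edelman-Greene coefficients\<close>

text \<open>
  A formal power series in \<open>x\<^sub>1, x\<^sub>2, \<dots>\<close> is given by its coefficients; the multiset \<open>m\<close> stands for
  the monomial that is the product of the \<open>x\<^sub>b\<close>, \<open>b \<in># m\<close>.
\<close>

type_synonym mv_series = "nat multiset \<Rightarrow> int"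

fun word_perm :: "nat list \<Rightarrow> nat \<Rightarrow> nat" where
  "word_perm [] = id"
| "word_perm (a # as) = transpose a (a + 1) \<circ> word_perm as"

definition words_of :: "nat \<Rightarrow> (nat \<Rightarrow> nat) \<Rightarrow> nat list set" where
  "words_of n w = {as. set as \<subseteq> {1..<n} \<and> word_perm as = w}"

definition reduced_words :: "nat \<Rightarrow> (nat \<Rightarrow> nat) \<Rightarrow> nat list set" where
  "reduced_words n w = {as \<in> words_of n w. \<forall>as' \<in> words_of n w. length as \<le> length as'}"

definition compatible :: "nat list \<Rightarrow> nat list \<Rightarrow> bool" where
  "compatible as bs \<longleftrightarrow>
     length bs = length as \<and> (\<forall>b \<in> set bs. 1 \<le> b) \<and> sorted bs \<and>
     (\<forall>i. Suc i < length as \<longrightarrow> as ! i < as ! Suc i \<longrightarrow> bs ! i < bs ! Suc i)"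

definition stanley :: "nat \<Rightarrow> (nat \<Rightarrow> nat) \<Rightarrow> mv_series" where
  "stanley n w m =
     int (card {(as, bs). as \<in> reduced_words n w \<and> compatible as bs \<and> mset bs = m})"

definition is_partition :: "nat list \<Rightarrow> bool" where
  "is_partition \<mu> \<longleftrightarrow> sorted_wrt (\<ge>) \<mu> \<and> (\<forall>x \<in> set \<mu>. 1 \<le> x)"

definition cells :: "nat list \<Rightarrow> (nat \<times> nat) set" where
  "cells \<mu> = {(r, c). r < length \<mu> \<and> c < \<mu> ! r}"

definition ssyt :: "nat list \<Rightarrow> (nat \<times> nat \<Rightarrow> nat) set" where
  "ssyt \<mu> = {T \<in> cells \<mu> \<rightarrow>\<^sub>E {1..}.
     (\<forall>r c c'. c < c' \<and> (r, c) \<in> cells \<mu> \<and> (r, c') \<in> cells \<mu> \<longrightarrow> T (r, c) \<le> T (r, c')) \<and>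
     (\<forall>r r' c. r < r' \<and> (r, c) \<in> cells \<mu> \<and> (r', c) \<in> cells \<mu> \<longrightarrow> T (r, c) < T (r', c))}"

definition schur :: "nat list \<Rightarrow> mv_series" where
  "schur \<mu> m = int (card {T \<in> ssyt \<mu>. image_mset T (mset_set (cells \<mu>)) = m})"

definition schur_expansion :: "mv_series \<Rightarrow> (nat list \<Rightarrow> int) \<Rightarrow> bool" where
  "schur_expansion f c \<longleftrightarrow>
     finite {\<mu>. c \<mu> \<noteq> 0} \<and> (\<forall>\<mu>. c \<mu> \<noteq> 0 \<longrightarrow> is_partition \<mu>) \<and>
     (\<forall>m. f m = (\<Sum>\<mu> | c \<mu> \<noteq> 0. c \<mu> * schur \<mu> m))"

text \<open>
  The definite description below denotes the coefficients only if the expansion exists and is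
  unique; any nontrivial statement about \<open>EG_coeff\<close> therefore includes both facts.
\<close>

definition EG_coeff :: "nat \<Rightarrow> (nat \<Rightarrow> nat) \<Rightarrow> nat list \<Rightarrow> int" where
  "EG_coeff n w = (THE c. schur_expansion (stanley n w) c)"

end

(*
  Left multiplication by s_a that lowers the length (D_a) and the signed Bruhat operator
  T_k w = sum of w t_kj over upper covers with j > k, minus the sum over those with j < k, satisfy
  D_a T_k - T_k D_a = [w k = a] - [w k = a + 1]. Stripping the letters of a compatible sequence one by
  one, these error terms telescope, so the Stanley function annihilates T_k w; this is the transition
  formula. At a non-dominant u the positions p, q are chosen so that u is the only upper cover of
  u t_pq to the right of p; hence F_u is the sum of F over the children of u. Children are
  lexicographically larger, so F_w is the sum of F over the leaves.

  A dominant u with code mu satisfies F_u = s_mu: for an inverse Grassmannian permutation of shape mu,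
  deleting the last letter of a reduced word corresponds to deleting a box with the largest entry from
  a tableau, so its Stanley function is s_mu. Such a permutation avoids 2143, and along the tree a
  2143-avoiding permutation has exactly one child, which avoids 2143 and whose code is the same up to
  a transposition; the path ends at the dominant permutation with code mu. Finally, the
  Schur functions are linearly independent by triangularity in the dominance order.
*)

theory Submission
  imports Defs
begin

section \<open>Length and reduced words\<close>

text \<open>The error terms telescope only up to boundary terms, which would appear when the value
  \<open>w k\<close> is 1 or \<open>n\<close>. The transition formula therefore assumes a smaller
  entry to the left of position \<open>k\<close> and a larger one to its right; removing a left
  descent keeps such pairs in order, so the assumption survives the whole induction. At a
  non-dominant \<open>u\<close> the pattern 132 provides the smaller entry and position
  \<open>q\<close> the larger one. The induction also carries a bound on the first letter, because
  compatibility compares neighbouring letters. The Stanley function of a dominant permutation is not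
  computed directly, since deleting a letter can destroy dominance: 312 becomes 132. Inverse
  Grassmannian permutations are closed under deleting the last letter. The price is that the one of
  a given shape lives in a larger symmetric group, so reduced words and Lehmer codes have to be
  stable under enlarging \<open>n\<close>, and a permutation has to be recovered from its
  code.\<close>

lemma inversions_finite:
  fixes u :: "nat \<Rightarrow> nat"
  assumes "u permutes {1..n}"
  shows "{(i, j). 1 \<le> i \<and> i < j \<and> u j < u i} \<subseteq> {1..n} \<times> {1..n}"
proof clarify
  fix i j :: nat
  assume h: "1 \<le> i" "i < j" "u j < u i"
  have "j \<le> n"
  proof (rule ccontr)
    assume "\<not> j \<le> n"
    then have "u j = j" using assms by (auto simp: permutes_def)
    moreover have "u i \<le> n \<or> u i = i"
      using assms permutes_in_image[OF assms, of i] by (auto simp: permutes_def)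
    ultimately show False using h \<open>\<not> j \<le> n\<close> by auto
  qed
  with h show "i \<in> {1..n} \<and> j \<in> {1..n}" by auto
qed

lemma finite_inversions:
  fixes u :: "nat \<Rightarrow> nat"
  assumes "u permutes {1..n}"
  shows "finite {(i, j). 1 \<le> i \<and> i < j \<and> u j < u i}"
  using finite_subset[OF inversions_finite[OF assms]] by blast

lemma swap_pos_apply:
  "swap_pos u i j x = (if x = i then u j else if x = j then u i else u x)"
  by (auto simp: swap_pos_def transpose_def)

lemma swap_pos_permutes:
  assumes "u permutes {1..n}" "i \<in> {1..n}" "j \<in> {1..n}"
  shows "swap_pos u i j permutes {1..n}"
  unfolding swap_pos_def using assms by (intro permutes_compose permutes_swap_id)

lemma swap_pos_swap_pos [simp]: "swap_pos (swap_pos u i j) i j = u"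
  by (auto simp: swap_pos_def fun_eq_iff)

text \<open>Only the pairs of positions whose order is reversed by the transposition change their status.\<close>

lemma ell_swap_pos:
  assumes "u permutes {1..n}" and "1 \<le> i" "i < j" "j \<le> n" and "u i < u j"
  shows "ell (swap_pos u i j) = ell u + 1 + 2 * card {l. i < l \<and> l < j \<and> u i < u l \<and> u l < u j}"
proof -
  define t where "t = transpose i j"
  define v where "v = swap_pos u i j"
  have v: "v permutes {1..n}"
    unfolding v_def using assms by (intro swap_pos_permutes) auto
  have va: "v x = u (t x)" for x by (simp add: v_def t_def swap_pos_def)
  have tt: "t (t x) = x" for x by (simp add: t_def)
  have t1: "1 \<le> t x" if "1 \<le> x" for x using that assms by (auto simp: t_def transpose_def)
  define Inv where "Inv = (\<lambda>u::nat\<Rightarrow>nat. {(x, y). 1 \<le> x \<and> x < y \<and> u y < u x})"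
  define P where "P = {(x, y). t x < t y}"
  have fin: "finite (Inv u)" "finite (Inv v)"
    using finite_inversions[OF assms(1)] finite_inversions[OF v] by (auto simp: Inv_def)
  have inju: "inj u" using assms(1) permutes_inj by blast
  have split: "ell w = card (Inv w \<inter> P) + card (Inv w - P)" if "finite (Inv w)" for w
    using card_Int_Diff[OF that, of P] by (simp add: ell_def Inv_def)
  define g where "g = (\<lambda>(x, y). (t x, t y))"
  have gg: "g (g z) = z" for z by (cases z) (simp add: g_def tt)
  have g1: "g z \<in> Inv v \<inter> P" if "z \<in> Inv u \<inter> P" for z
    using that t1 by (cases z) (simp add: g_def Inv_def P_def va tt)
  have g2: "g z \<in> Inv u \<inter> P" if "z \<in> Inv v \<inter> P" for z
    using that t1 by (cases z) (simp add: g_def Inv_def P_def va tt)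
  have "bij_betw g (Inv u \<inter> P) (Inv v \<inter> P)"
    using g1 g2 gg by (intro bij_betw_byWitness[where f' = g]) blast+
  then have P: "card (Inv v \<inter> P) = card (Inv u \<inter> P)"
    using bij_betw_same_card by metis
  \<comment> \<open>For positions \<open>l\<close> between \<open>i\<close> and \<open>j\<close>,
    \<open>A\<close> and \<open>B\<close> record the inversions of \<open>u\<close> that
    \<open>l\<close> forms with \<open>i\<close> and with \<open>j\<close>, while \<open>C\<close>
    and \<open>D\<close> do this for \<open>v\<close>. Each of the latter gains exactly
    \<open>M\<close>, whence the factor 2.\<close>
  define A B C D M where
    "A = {l. i < l \<and> l < j \<and> u l < u i}" and "B = {l. i < l \<and> l < j \<and> u j < u l}" and
    "C = {l. i < l \<and> l < j \<and> u l < u j}" and "D = {l. i < l \<and> l < j \<and> u i < u l}" and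
    "M = {l. i < l \<and> l < j \<and> u i < u l \<and> u l < u j}"
  have finI: "finite A" "finite B" "finite C" "finite D" "finite M"
    by (simp_all add: A_def B_def C_def D_def M_def)
  have Q: "t x < t y \<longleftrightarrow> \<not> (x = i \<and> y = j \<or> x = i \<and> i < y \<and> y < j \<or> y = j \<and> i < x \<and> x < j)"
    if "x < y" for x y
    using that \<open>i < j\<close> by (auto simp: t_def transpose_def)
  have Qu: "Inv u - P = (\<lambda>l. (i, l)) ` A \<union> (\<lambda>l. (l, j)) ` B"
    using assms(2,3,5) by (auto simp: Inv_def P_def A_def B_def Q image_iff)
  have Qv: "Inv v - P = insert (i, j) ((\<lambda>l. (i, l)) ` C \<union> (\<lambda>l. (l, j)) ` D)"
  proof (rule set_eqI)
    fix z :: "nat \<times> nat"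
    obtain x y where z: "z = (x, y)" by (cases z)
    have "z \<in> Inv v - P \<longleftrightarrow> 1 \<le> x \<and> x < y \<and> u (t y) < u (t x) \<and>
        (x = i \<and> y = j \<or> x = i \<and> i < y \<and> y < j \<or> y = j \<and> i < x \<and> x < j)"
      using Q[of x y] by (auto simp: z Inv_def P_def va)
    also have "\<dots> \<longleftrightarrow> z \<in> insert (i, j) ((\<lambda>l. (i, l)) ` C \<union> (\<lambda>l. (l, j)) ` D)"
      using assms(2,3,5) by (auto simp: z C_def D_def t_def image_iff)
    finally show "z \<in> Inv v - P \<longleftrightarrow> z \<in> insert (i, j) ((\<lambda>l. (i, l)) ` C \<union> (\<lambda>l. (l, j)) ` D)" .
  qed
  have cu: "card (Inv u - P) = card A + card B"
    unfolding Qu using finI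
    by (subst card_Un_disjoint) (auto simp: card_image inj_on_def A_def B_def)
  have "card ((\<lambda>l. (i, l)) ` C \<union> (\<lambda>l. (l, j)) ` D) = card C + card D"
    using finI by (subst card_Un_disjoint) (auto simp: card_image inj_on_def C_def D_def)
  then have cv: "card (Inv v - P) = 1 + card C + card D"
    unfolding Qv using finI by (subst card_insert_disjoint) (auto simp: C_def D_def)
  have neq: "u l \<noteq> u i" "u l \<noteq> u j" if "i < l" "l < j" for l
    using inju that by (metis injD less_irrefl)+
  have "C = A \<union> M"
    using assms(5) neq by (auto simp: A_def C_def M_def) (metis linorder_neqE_nat)
  then have C: "card C = card A + card M"
    using finI by (simp add: card_Un_disjoint A_def M_def disjoint_iff)
  have "D = B \<union> M"
    using assms(5) neq by (auto simp: B_def D_def M_def) (metis linorder_neqE_nat)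
  then have D: "card D = card B + card M"
    using finI by (simp add: card_Un_disjoint B_def M_def disjoint_iff)
  show ?thesis
    using split[OF fin(1)] split[OF fin(2)] P cu cv C D by (simp add: v_def M_def)
qed

text \<open>Covers of the Bruhat order expressed through entries alone: unlike a condition on
  \<open>ell\<close>, this form can be compared entry by entry before and after a left
  multiplication. The range of positions is imposed where it is used.\<close>

definition cov :: "(nat \<Rightarrow> nat) \<Rightarrow> nat \<Rightarrow> nat \<Rightarrow> bool" where
  "cov u i j \<longleftrightarrow> i < j \<and> u i < u j \<and> (\<forall>l. i < l \<longrightarrow> l < j \<longrightarrow> \<not> (u i < u l \<and> u l < u j))"

lemma ell_swap_pos_desc:
  assumes "u permutes {1..n}" and "1 \<le> i" "i < j" "j \<le> n" and "u j < u i"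
  shows "ell (swap_pos u i j) < ell u"
proof -
  have "swap_pos u i j permutes {1..n}" using assms by (intro swap_pos_permutes) auto
  from ell_swap_pos[OF this assms(2-4)] show ?thesis using assms by (simp add: swap_pos_apply)
qed

lemma cov_iff_ell:
  assumes "u permutes {1..n}" and "1 \<le> i" "i < j" "j \<le> n"
  shows "ell (swap_pos u i j) = ell u + 1 \<longleftrightarrow> cov u i j"
proof -
  have "u i \<noteq> u j" using assms permutes_inj[OF assms(1)] by (auto simp: inj_def)
  moreover have "finite {l. i < l \<and> l < j \<and> u i < u l \<and> u l < u j}"
    by (rule finite_subset[of _ "{i..j}"]) auto
  ultimately show ?thesis
    using ell_swap_pos[OF assms] ell_swap_pos_desc[OF assms] assms
    by (cases "u i < u j") (auto simp: cov_def)
qed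

lemma ell_id [simp]: "ell id = 0"
proof -
  have "{(i, j). 1 \<le> i \<and> i < j \<and> id j < id (i::nat)} = {}" by auto
  then show ?thesis by (simp only: ell_def card.empty)
qed

text \<open>Without a descent \<open>w\<close> increases strictly on \<open>{1..n}\<close>; counting
  from the left end gives \<open>x \<le> w x\<close>, counting from the right end the
  converse.\<close>

lemma descent_exists:
  assumes "w permutes {1..n}" and "w \<noteq> id"
  shows "\<exists>a. 1 \<le> a \<and> a < n \<and> w (Suc a) < w a"
proof (rule ccontr)
  assume asm: "\<not> ?thesis"
  have inj: "inj w" using permutes_inj[OF assms(1)] .
  have step: "w a < w (Suc a)" if "1 \<le> a" "a < n" for a
    using asm that inj by (metis injD linorder_neqE_nat n_not_Suc_n)
  have ge: "x \<le> w x" if "1 \<le> x" "x \<le> n" for x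
    using that
  proof (induction x rule: nat_induct_at_least[of 1])
    case base
    show ?case using base permutes_in_image[OF assms(1), of 1] by auto
  next
    case (Suc x)
    then show ?case using step[of x] by auto
  qed
  have le: "w (n - d) \<le> n - d" if "d < n" for d
    using that
  proof (induction d)
    case 0
    then show ?case using permutes_in_image[OF assms(1), of n] by auto
  next
    case (Suc d)
    have "w (n - Suc d) < w (Suc (n - Suc d))" using step[of "n - Suc d"] Suc by auto
    then show ?case using Suc by (simp add: Suc_diff_Suc)
  qed
  have "w x = x" for x
  proof (cases "x \<in> {1..n}")
    case True
    then show ?thesis using ge[of x] le[of "n - x"] by auto
  next
    case False
    then show ?thesis using assms(1) by (auto simp: permutes_def)
  qed
  with assms(2) show False by auto
qed

lemma ell_eq_0_iff:
  assumes "w permutes {1..n}"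
  shows "ell w = 0 \<longleftrightarrow> w = id"
proof
  assume "ell w = 0"
  then have "{(i, j). 1 \<le> i \<and> i < j \<and> w j < w i} = {}"
    using finite_inversions[OF assms] by (simp add: ell_def)
  then have "\<not> w (Suc a) < w a" if "1 \<le> a" for a using that by blast
  then show "w = id" using descent_exists[OF assms] by blast
qed simp

text \<open>Nothing lies between adjacent positions, so an ascent is always a cover. The second
  claim makes the truncated difference \<open>ell w - 1\<close> a genuine decrease.\<close>

lemma ell_swap_adjacent:
  assumes "w permutes {1..n}" and "1 \<le> a" "a < n"
  shows "ell (swap_pos w a (Suc a)) = (if w (Suc a) < w a then ell w - 1 else ell w + 1)"
    and "w (Suc a) < w a \<Longrightarrow> 0 < ell w"
proof -
  have up: "ell (swap_pos u a (Suc a)) = ell u + 1" if "u permutes {1..n}" "u a < u (Suc a)" for u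
    using cov_iff_ell[OF that(1), of a "Suc a"] that assms by (auto simp: cov_def)
  have v: "swap_pos w a (Suc a) permutes {1..n}"
    using assms by (intro swap_pos_permutes) auto
  have ne: "w a \<noteq> w (Suc a)" using permutes_inj[OF assms(1)] by (metis injD n_not_Suc_n)
  show "ell (swap_pos w a (Suc a)) = (if w (Suc a) < w a then ell w - 1 else ell w + 1)"
    "w (Suc a) < w a \<Longrightarrow> 0 < ell w"
    using up[OF assms(1)] up[OF v] ne by (auto simp: swap_pos_apply)
qed

section \<open>Reduced words and their first and last letters\<close>

lemma word_perm_append: "word_perm (as @ bs) = word_perm as \<circ> word_perm bs"
  by (induction as) (auto simp: o_assoc)

lemma word_perm_snoc: "word_perm (as @ [a]) = swap_pos (word_perm as) a (Suc a)"
  by (simp add: word_perm_append swap_pos_def)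

lemma word_perm_permutes:
  "set as \<subseteq> {1..<n} \<Longrightarrow> word_perm as permutes {1..n}"
proof (induction as)
  case Nil
  then show ?case using permutes_id by (simp only: word_perm.simps)
next
  case (Cons a as)
  then have "transpose a (a + 1) permutes {1..n}"
    by (intro permutes_swap_id) auto
  moreover have "word_perm as permutes {1..n}" using Cons by auto
  ultimately show ?case unfolding word_perm.simps using permutes_compose by blast
qed

lemma ell_le_length:
  "set as \<subseteq> {1..<n} \<Longrightarrow> ell (word_perm as) \<le> length as"
proof (induction as rule: rev_induct)
  case (snoc a as)
  have "word_perm as permutes {1..n}" using snoc by (intro word_perm_permutes) auto
  from ell_swap_adjacent(1)[OF this, of a] show ?case
    using snoc by (auto simp: word_perm_snoc split: if_splits)
qed simp

lemma exists_word_of_length_ell: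
  "w permutes {1..n} \<Longrightarrow> \<exists>as \<in> words_of n w. length as = ell w"
proof (induction "ell w" arbitrary: w)
  case 0
  then have "w = id" using ell_eq_0_iff by auto
  then show ?case using 0 by (auto simp: words_of_def intro!: exI[of _ "[]"])
next
  case (Suc l)
  then have "w \<noteq> id" by (metis ell_id nat.distinct(1))
  from descent_exists[OF Suc.prems this] obtain a
    where a: "1 \<le> a" "a < n" "w (Suc a) < w a" by blast
  let ?v = "swap_pos w a (Suc a)"
  have "?v permutes {1..n}" using a Suc.prems by (intro swap_pos_permutes) auto
  moreover have "ell ?v = l"
    using ell_swap_adjacent(1)[OF Suc.prems a(1,2)] a(3) Suc.hyps(2) by simp
  ultimately obtain as where as: "as \<in> words_of n ?v" "length as = l"
    using Suc.hyps(1) by metis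
  then have "as @ [a] \<in> words_of n w"
    using a by (auto simp: words_of_def word_perm_snoc)
  then show ?case using as Suc.hyps(2) by (metis length_append_singleton)
qed

lemma reduced_words_eq:
  assumes "w permutes {1..n}"
  shows "reduced_words n w = {as \<in> words_of n w. length as = ell w}"
proof -
  obtain as where as: "as \<in> words_of n w" "length as = ell w"
    using exists_word_of_length_ell[OF assms] by blast
  have "ell w \<le> length bs" if "bs \<in> words_of n w" for bs
    using that ell_le_length[of bs n] by (auto simp: words_of_def)
  then have "(\<forall>bs\<in>words_of n w. length cs \<le> length bs) \<longleftrightarrow> length cs = ell w" if "cs \<in> words_of n w" for cs
    using as that by (metis antisym)
  then show ?thesis unfolding reduced_words_def by blast
qed

text \<open>Removing the last letter swaps two positions; this form serves the comparison with
  tableaux. The counterpart for the first letter, \<open>reduced_words_Cons\<close>, swaps two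
  values and serves the transition formula.\<close>

lemma reduced_words_snoc:
  assumes "w permutes {1..n}"
  shows "as @ [a] \<in> reduced_words n w \<longleftrightarrow>
    1 \<le> a \<and> a < n \<and> w (Suc a) < w a \<and> as \<in> reduced_words n (swap_pos w a (Suc a))"
proof (cases "1 \<le> a \<and> a < n")
  case True
  let ?v = "swap_pos w a (Suc a)"
  have v: "?v permutes {1..n}" using True assms by (intro swap_pos_permutes) auto
  have "word_perm (as @ [a]) = w \<longleftrightarrow> word_perm as = ?v"
    by (metis swap_pos_swap_pos word_perm_snoc)
  then have "as @ [a] \<in> words_of n w \<longleftrightarrow> as \<in> words_of n ?v"
    using True by (auto simp: words_of_def)
  moreover have "ell ?v \<le> length as" if "as \<in> words_of n ?v"
    using that ell_le_length[of as n] by (auto simp: words_of_def)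
  ultimately show ?thesis
    using True ell_swap_adjacent[OF assms, of a]
    by (auto simp: reduced_words_eq[OF assms] reduced_words_eq[OF v])
next
  case False
  then show ?thesis by (auto simp: reduced_words_def words_of_def)
qed

text \<open>Left descent: in one-line notation the value \<open>a + 1\<close> stands to the left of
  the value \<open>a\<close>.\<close>

definition ldesc :: "nat \<Rightarrow> (nat \<Rightarrow> nat) \<Rightarrow> bool" where
  "ldesc a w \<longleftrightarrow> inv w (Suc a) < inv w a"

definition lmult :: "nat \<Rightarrow> (nat \<Rightarrow> nat) \<Rightarrow> nat \<Rightarrow> nat" where
  "lmult a w = transpose a (Suc a) \<circ> w"

lemma lmult_lmult [simp]: "lmult a (lmult a w) = w"
  by (auto simp: lmult_def fun_eq_iff)

lemma lmult_permutes:
  assumes "w permutes {1..n}" "1 \<le> a" "a < n"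
  shows "lmult a w permutes {1..n}"
  unfolding lmult_def using assms by (intro permutes_compose permutes_swap_id) auto

lemma lmult_eq_swap_pos:
  assumes "bij w"
  shows "lmult a w = swap_pos w (inv w a) (inv w (Suc a))"
proof
  fix x
  have "x = inv w y \<longleftrightarrow> w x = y" for y using assms by (metis bij_inv_eq_iff)
  moreover have "w (inv w y) = y" for y using assms by (simp add: bij_is_surj surj_f_inv_f)
  ultimately show "lmult a w x = swap_pos w (inv w a) (inv w (Suc a)) x"
    by (simp add: lmult_def swap_pos_apply transpose_def)
qed

lemma ell_lmult:
  assumes "w permutes {1..n}" and "1 \<le> a" "a < n"
  shows "ell (lmult a w) = (if ldesc a w then ell w - 1 else ell w + 1)"
    and "ldesc a w \<Longrightarrow> 0 < ell w"
proof -
  have up: "ell (lmult a u) = ell u + 1" if u: "u permutes {1..n}" "\<not> ldesc a u" for u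
  proof -
    have bij: "bij u" using permutes_bij[OF u(1)] .
    have uu: "u (inv u x) = x" for x using bij by (simp add: bij_is_surj surj_f_inv_f)
    have "inv u a \<noteq> inv u (Suc a)" by (metis uu n_not_Suc_n)
    then have lt: "inv u a < inv u (Suc a)" using u(2) by (simp add: ldesc_def)
    have "inv u a \<in> {1..n}" "inv u (Suc a) \<in> {1..n}"
      using permutes_in_image[OF permutes_inv[OF u(1)]] assms by auto
    \<comment> \<open>No value lies strictly between \<open>a\<close> and \<open>a + 1\<close>, so
      the positions of these two values form a cover whatever stands between them.\<close>
    then show ?thesis
      using cov_iff_ell[OF u(1), of "inv u a" "inv u (Suc a)"] lt
      by (auto simp: lmult_eq_swap_pos[OF bij] cov_def uu)
  qed
  have v: "lmult a w permutes {1..n}" using lmult_permutes[OF assms] .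
  have "inv (lmult a w) = inv w \<circ> transpose a (Suc a)"
    unfolding lmult_def using permutes_bij[OF assms(1)]
    by (subst o_inv_distrib) auto
  then have "ldesc a w \<Longrightarrow> \<not> ldesc a (lmult a w)"
    by (simp add: ldesc_def)
  with up[OF assms(1)] up[OF v]
  show "ell (lmult a w) = (if ldesc a w then ell w - 1 else ell w + 1)"
    "ldesc a w \<Longrightarrow> 0 < ell w"
    by auto
qed

lemma reduced_words_Cons:
  assumes "w permutes {1..n}"
  shows "a # as \<in> reduced_words n w \<longleftrightarrow>
    1 \<le> a \<and> a < n \<and> ldesc a w \<and> as \<in> reduced_words n (lmult a w)"
proof (cases "1 \<le> a \<and> a < n")
  case True
  have v: "lmult a w permutes {1..n}" using lmult_permutes[OF assms] True by auto
  have "word_perm (a # as) = w \<longleftrightarrow> word_perm as = lmult a w"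
    by (metis lmult_lmult lmult_def Suc_eq_plus1 word_perm.simps(2))
  then have "a # as \<in> words_of n w \<longleftrightarrow> as \<in> words_of n (lmult a w)"
    using True by (auto simp: words_of_def)
  moreover have "ell (lmult a w) \<le> length as" if "as \<in> words_of n (lmult a w)"
    using that ell_le_length[of as n] by (auto simp: words_of_def)
  ultimately show ?thesis
    using True ell_lmult[OF assms, of a]
    by (auto simp: reduced_words_eq[OF assms] reduced_words_eq[OF v])
next
  case False
  then show ?thesis by (auto simp: reduced_words_def words_of_def)
qed

lemma Nil_reduced_words:
  "w permutes {1..n} \<Longrightarrow> [] \<in> reduced_words n w \<longleftrightarrow> w = id"
  by (auto simp: reduced_words_def words_of_def)

lemma permutes_mono: "w permutes {1..n} \<Longrightarrow> n \<le> N \<Longrightarrow> w permutes {1..N::nat}"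
  using permutes_subset by fastforce

text \<open>A letter \<open>a \<ge> n\<close> cannot be a left descent, because the value
  \<open>a + 1\<close> is fixed. This makes Stanley functions independent of the ambient symmetric
  group.\<close>

lemma reduced_words_mono:
  assumes "w permutes {1..n}" and "n \<le> N"
  shows "reduced_words N w = reduced_words n w"
proof -
  have "as \<in> reduced_words N w \<longleftrightarrow> as \<in> reduced_words n w" for as
    using assms(1)
  proof (induction as arbitrary: w)
    case Nil
    then show ?case using permutes_mono[OF Nil assms(2)] by (simp add: Nil_reduced_words)
  next
    case (Cons a as)
    have "a < n" if "1 \<le> a" "ldesc a w"
    proof (rule ccontr)
      assume an: "\<not> a < n"
      have inv: "inv w permutes {1..n}" using permutes_inv[OF Cons.prems] .
      then have "inv w (Suc a) = Suc a" using an permutes_not_in[OF inv, of "Suc a"] by simp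
      moreover have "inv w a \<le> a"
        using an permutes_in_image[OF inv, of a] permutes_not_in[OF inv, of a]
        by (cases "a \<in> {1..n}") auto
      ultimately show False using that by (auto simp: ldesc_def)
    qed
    then show ?case
      using Cons.IH[of "lmult a w"] lmult_permutes[OF Cons.prems, of a] assms(2)
      by (auto simp: reduced_words_Cons[OF Cons.prems]
          reduced_words_Cons[OF permutes_mono[OF Cons.prems assms(2)]])
  qed
  then show ?thesis by blast
qed

lemma stanley_mono:
  assumes "w permutes {1..n}" and "n \<le> N"
  shows "stanley N w = stanley n w"
  unfolding stanley_def by (simp only: reduced_words_mono[OF assms])

section \<open>The transition formula\<close>

text \<open>The commutation of \<open>D_a\<close> with a single term of \<open>T_k\<close>, away
  from the pair of positions that carries \<open>a\<close> and \<open>a + 1\<close>. Only that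
  excluded pair produces the error terms.\<close>

lemma cov_lmult_iff:
  assumes bij: "bij w" and ij: "i < j" and not_swapped: "\<not> (w i = a \<and> w j = Suc a)" "\<not> (w i = Suc a \<and> w j = a)"
  shows "cov w i j \<and> ldesc a (swap_pos w i j) \<longleftrightarrow> ldesc a w \<and> cov (lmult a w) i j"
proof -
  define b c W where "b = inv w a" and "c = inv w (Suc a)" and "W = lmult a w"
  have b: "w l = a \<longleftrightarrow> l = b" and c: "w l = Suc a \<longleftrightarrow> l = c" for l
    using bij by (auto simp: b_def c_def bij_inv_eq_iff bij_is_inj bij_is_surj surj_f_inv_f)
  have wb: "w b = a" and wc: "w c = Suc a" using b c by blast+
  have bc: "b \<noteq> c" using wb wc by auto
  have Wb: "W b = Suc a" and Wc: "W c = a" by (simp_all add: W_def lmult_def wb wc)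
  have Wo: "W l = w l" "w l \<noteq> a" "w l \<noteq> Suc a" if "l \<noteq> b" "l \<noteq> c" for l
    using that b[of l] c[of l] by (simp_all add: W_def lmult_def transpose_def)
  have "inv (swap_pos w i j) = transpose i j \<circ> inv w"
    unfolding swap_pos_def using bij by (subst o_inv_distrib) auto
  then have d: "ldesc a (swap_pos w i j) \<longleftrightarrow> transpose i j c < transpose i j b"
    by (simp add: ldesc_def b_def c_def)
  have e: "ldesc a w \<longleftrightarrow> c < b" by (simp add: ldesc_def b_def c_def)
  have cov: "cov u i j \<longleftrightarrow> u i < u j \<and> (\<forall>l. i < l \<longrightarrow> l < j \<longrightarrow> \<not> (u i < u l \<and> u l < u j))" for u
    using ij by (simp add: cov_def)
  define P Q where "P \<longleftrightarrow> (\<forall>l. i < l \<longrightarrow> l < j \<longrightarrow> \<not> (w i < w l \<and> w l < w j))"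
    and "Q \<longleftrightarrow> (\<forall>l. i < l \<longrightarrow> l < j \<longrightarrow> \<not> (W i < W l \<and> W l < W j))"
  \<comment> \<open>If \<open>i\<close> and \<open>j\<close> both avoid \<open>b\<close> and
    \<open>c\<close>, exchanging the adjacent values changes no comparison. In the other cases the
    two descent conditions can differ only when the position of the partner value lies between
    \<open>i\<close> and \<open>j\<close>, and then one of the two covers fails.\<close>
  consider "i \<noteq> b" "i \<noteq> c" "j \<noteq> b" "j \<noteq> c" | "i = b" "j \<noteq> c" | "i = c" "j \<noteq> b"
    | "j = b" "i \<noteq> c" | "j = c" "i \<noteq> b"
    using not_swapped wb wc ij by blast
  then have "cov w i j \<and> transpose i j c < transpose i j b \<longleftrightarrow> c < b \<and> cov W i j"
  proof cases
    case 1
    then have t: "transpose i j c = c" "transpose i j b = b" by (auto simp: transpose_def)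
    have ne: "W i = w i" "w i \<noteq> a" "w i \<noteq> Suc a" "W j = w j" "w j \<noteq> a" "w j \<noteq> Suc a"
      using 1 Wo by auto
    have "W i < W l \<and> W l < W j \<longleftrightarrow> w i < w l \<and> w l < w j" for l
    proof (cases "l = b \<or> l = c")
      case True
      then show ?thesis using ne wb wc Wb Wc by auto
    next
      case False
      then show ?thesis using Wo[of l] ne by auto
    qed
    then show ?thesis unfolding t cov ne by blast
  next
    case 2
    have t: "transpose i j c = c" "transpose i j b = j"
      using 2 bc ij by (auto simp: transpose_def)
    have ne: "w j \<noteq> a" "w j \<noteq> Suc a" "W j = w j" "j \<noteq> b" "j \<noteq> c"
      using Wo[of j] 2 bc ij by auto
    have v: "w i = a" "W i = Suc a" using 2 wb wc Wb Wc by auto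
    have btw: "W i < W l \<and> W l < W j \<longleftrightarrow> w i < w l \<and> w l < w j \<and> l \<noteq> c" if "i < l" for l
    proof (cases "l = b \<or> l = c")
      case True
      then show ?thesis using 2 ne v wb wc Wb Wc that bc by (elim disjE) simp_all
    next
      case False
      then show ?thesis using Wo[of l] ne v by auto
    qed
    have lt: "W i < W j \<longleftrightarrow> w i < w j" using ne v by auto
    have x: "w i < w j \<Longrightarrow> w i < w c \<and> w c < w j"
      using ne v wb wc by auto
    \<comment> \<open>The swap moves the value \<open>a\<close> from \<open>i\<close> to
      \<open>j\<close>, so the descent conditions differ exactly for \<open>i < c < j\<close>; then
      \<open>w c = a + 1\<close> obstructs the cover in \<open>w\<close>.\<close>
    have tri: "c < j \<longleftrightarrow> c < b \<or> i < c \<and> c < j" "\<not> (c < b \<and> i < c)" using 2 bc ij ne(4,5) by auto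
    have "Q \<longleftrightarrow>
        (\<forall>l. i < l \<longrightarrow> l < j \<longrightarrow> \<not> (w i < w l \<and> w l < w j \<and> l \<noteq> c))"
      using btw by (simp add: Q_def)
    moreover have "(\<forall>l. i < l \<longrightarrow> l < j \<longrightarrow> \<not> (w i < w l \<and> w l < w j \<and> l \<noteq> c)) \<longleftrightarrow>
        P"
      if "\<not> (i < c \<and> c < j)" using that unfolding P_def by blast
    moreover have "\<not> P"
      if "i < c \<and> c < j" "w i < w j" using that x unfolding P_def by blast
    ultimately show ?thesis unfolding t cov lt P_def[symmetric] Q_def[symmetric] using tri by blast
  next
    case 3
    have t: "transpose i j c = j" "transpose i j b = b"
      using 3 bc ij by (auto simp: transpose_def)
    have ne: "w j \<noteq> a" "w j \<noteq> Suc a" "W j = w j" "j \<noteq> b" "j \<noteq> c"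
      using Wo[of j] 3 bc ij by auto
    have v: "w i = Suc a" "W i = a" using 3 wb wc Wb Wc by auto
    \<comment> \<open>Here \<open>W i\<close> drops to \<open>a\<close>, so the partner position
      \<open>b\<close> becomes an obstruction in \<open>W\<close> instead of in \<open>w\<close>.
      The cases for \<open>j\<close> mirror the two for \<open>i\<close>.\<close>
    have btw: "W i < W l \<and> W l < W j \<longleftrightarrow> l = b \<and> w i < w j \<or> w i < w l \<and> w l < w j" if "i < l" for l
    proof (cases "l = b \<or> l = c")
      case True
      then show ?thesis using 3 ne v wb wc Wb Wc that bc by (elim disjE) simp_all
    next
      case False
      then show ?thesis using Wo[of l] ne v by auto
    qed
    have lt: "W i < W j \<longleftrightarrow> w i < w j" using ne v by auto
    have x: "w i < w j \<Longrightarrow> \<not> w i < w b"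
      using ne v wb wc by auto
    have tri: "c < b \<longleftrightarrow> j < b \<or> i < b \<and> b < j" "\<not> (j < b \<and> b < j)" using 3 bc ij ne(4,5) by auto
    have "Q \<longleftrightarrow>
        (\<forall>l. i < l \<longrightarrow> l < j \<longrightarrow> \<not> (l = b \<and> w i < w j \<or> w i < w l \<and> w l < w j))"
      using btw by (simp add: Q_def)
    moreover have "(\<forall>l. i < l \<longrightarrow> l < j \<longrightarrow> \<not> (l = b \<and> w i < w j \<or> w i < w l \<and> w l < w j)) \<longleftrightarrow>
        P"
      if "\<not> (i < b \<and> b < j)" using that unfolding P_def by blast
    moreover have "\<not> (\<forall>l. i < l \<longrightarrow> l < j \<longrightarrow> \<not> (l = b \<and> w i < w j \<or> w i < w l \<and> w l < w j))"
      if "i < b \<and> b < j" "w i < w j" using that x unfolding P_def by blast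
    ultimately show ?thesis unfolding t cov lt P_def[symmetric] Q_def[symmetric] using tri by blast
  next
    case 4
    have t: "transpose i j c = c" "transpose i j b = i"
      using 4 bc ij by (auto simp: transpose_def)
    have ne: "w i \<noteq> a" "w i \<noteq> Suc a" "W i = w i" "i \<noteq> b" "i \<noteq> c"
      using Wo[of i] 4 bc ij by auto
    have v: "w j = a" "W j = Suc a" using 4 wb wc Wb Wc by auto
    have btw: "W i < W l \<and> W l < W j \<longleftrightarrow> l = c \<and> w i < w j \<or> w i < w l \<and> w l < w j" if "l < j" for l
    proof (cases "l = b \<or> l = c")
      case True
      then show ?thesis using 4 ne v wb wc Wb Wc that bc by (elim disjE) simp_all
    next
      case False
      then show ?thesis using Wo[of l] ne v by auto
    qed
    have lt: "W i < W j \<longleftrightarrow> w i < w j" using ne v by auto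
    have x: "w i < w j \<Longrightarrow> \<not> w c < w j"
      using ne v wb wc by auto
    have tri: "c < b \<longleftrightarrow> c < i \<or> i < c \<and> c < j" "\<not> (c < i \<and> i < c)" using 4 bc ij ne(4,5) by auto
    have "Q \<longleftrightarrow>
        (\<forall>l. i < l \<longrightarrow> l < j \<longrightarrow> \<not> (l = c \<and> w i < w j \<or> w i < w l \<and> w l < w j))"
      using btw by (simp add: Q_def)
    moreover have "(\<forall>l. i < l \<longrightarrow> l < j \<longrightarrow> \<not> (l = c \<and> w i < w j \<or> w i < w l \<and> w l < w j)) \<longleftrightarrow>
        P"
      if "\<not> (i < c \<and> c < j)" using that unfolding P_def by blast
    moreover have "\<not> (\<forall>l. i < l \<longrightarrow> l < j \<longrightarrow> \<not> (l = c \<and> w i < w j \<or> w i < w l \<and> w l < w j))"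
      if "i < c \<and> c < j" "w i < w j" using that x unfolding P_def by blast
    ultimately show ?thesis unfolding t cov lt P_def[symmetric] Q_def[symmetric] using tri by blast
  next
    case 5
    have t: "transpose i j c = i" "transpose i j b = b"
      using 5 bc ij by (auto simp: transpose_def)
    have ne: "w i \<noteq> a" "w i \<noteq> Suc a" "W i = w i" "i \<noteq> b" "i \<noteq> c"
      using Wo[of i] 5 bc ij by auto
    have v: "w j = Suc a" "W j = a" using 5 wb wc Wb Wc by auto
    have btw: "W i < W l \<and> W l < W j \<longleftrightarrow> w i < w l \<and> w l < w j \<and> l \<noteq> b" if "l < j" for l
    proof (cases "l = b \<or> l = c")
      case True
      then show ?thesis using 5 ne v wb wc Wb Wc that bc by (elim disjE) simp_all
    next
      case False
      then show ?thesis using Wo[of l] ne v by auto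
    qed
    have lt: "W i < W j \<longleftrightarrow> w i < w j" using ne v by auto
    have x: "w i < w j \<Longrightarrow> w i < w b \<and> w b < w j"
      using ne v wb wc by auto
    have tri: "i < b \<longleftrightarrow> c < b \<or> i < b \<and> b < j" "\<not> (c < b \<and> b < j)" using 5 bc ij ne(4,5) by auto
    have "Q \<longleftrightarrow>
        (\<forall>l. i < l \<longrightarrow> l < j \<longrightarrow> \<not> (w i < w l \<and> w l < w j \<and> l \<noteq> b))"
      using btw by (simp add: Q_def)
    moreover have "(\<forall>l. i < l \<longrightarrow> l < j \<longrightarrow> \<not> (w i < w l \<and> w l < w j \<and> l \<noteq> b)) \<longleftrightarrow>
        P"
      if "\<not> (i < b \<and> b < j)" using that unfolding P_def by blast
    moreover have "\<not> P"
      if "i < b \<and> b < j" "w i < w j" using that x unfolding P_def by blast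
    ultimately show ?thesis unfolding t cov lt P_def[symmetric] Q_def[symmetric] using tri by blast
  qed
  then show ?thesis by (simp add: d e W_def)
qed

text \<open>The operator \<open>T_k\<close> in dual form: \<open>\<phi>\<close>, extended linearly
  to formal sums of permutations, is evaluated at \<open>T_k w\<close>. This avoids a type of formal
  sums.\<close>

definition bruhat_sum :: "nat \<Rightarrow> nat \<Rightarrow> ((nat \<Rightarrow> nat) \<Rightarrow> int) \<Rightarrow> (nat \<Rightarrow> nat) \<Rightarrow> int" where
  "bruhat_sum n k \<phi> w = (\<Sum>j\<in>{1..n}.
     if cov w k j then \<phi> (swap_pos w k j) else if cov w j k then - \<phi> (swap_pos w j k) else 0)"

lemma lmult_swap_pos: "lmult a (swap_pos w i j) = swap_pos (lmult a w) i j"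
  by (simp add: lmult_def swap_pos_def o_assoc)

text \<open>
  This is the dual form of the action of divided differences in the second set of variables on the
  Monk--Chevalley rule for double Schubert polynomials.
\<close>

lemma bruhat_sum_ldesc:
  assumes w: "w permutes {1..n}" and a: "1 \<le> a" "a < n" and k: "k \<in> {1..n}"
  shows "bruhat_sum n k (\<lambda>v. if ldesc a v then \<phi> (lmult a v) else 0) w =
    (if ldesc a w then bruhat_sum n k \<phi> (lmult a w) else 0)
    + (if w k = a then \<phi> w else 0) - (if w k = Suc a then \<phi> w else 0)"
proof -
  have bij: "bij w" using permutes_bij[OF w] .
  define b c where "b = inv w a" and "c = inv w (Suc a)"
  have b: "w l = a \<longleftrightarrow> l = b" and c: "w l = Suc a \<longleftrightarrow> l = c" for l
    using bij by (auto simp: b_def c_def bij_inv_eq_iff bij_is_inj bij_is_surj surj_f_inv_f)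
  have wb: "w b = a" and wc: "w c = Suc a" using b c by blast+
  have bc: "b \<noteq> c" using wb wc by auto
  have bn: "b \<in> {1..n}" "c \<in> {1..n}"
    using permutes_in_image[OF w, of b] permutes_in_image[OF w, of c] wb wc a by auto
  \<comment> \<open>\<open>s\<close> is the position of the partner value if \<open>k\<close>
    carries \<open>a\<close> or \<open>a + 1\<close>; the default 0 lies outside the range of
    summation, so there is no error term otherwise.\<close>
  define s where "s = (if k = b then c else if k = c then b else 0)"
  define f where "f = (\<lambda>j. if cov w k j then if ldesc a (swap_pos w k j) then \<phi> (lmult a (swap_pos w k j)) else 0
     else if cov w j k then - (if ldesc a (swap_pos w j k) then \<phi> (lmult a (swap_pos w j k)) else 0) else 0)"
  define g where "g = (\<lambda>j. if ldesc a w then if cov (lmult a w) k j then \<phi> (swap_pos (lmult a w) k j)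
     else if cov (lmult a w) j k then - \<phi> (swap_pos (lmult a w) j k) else 0 else 0)"
  define h where "h = (\<lambda>j. if j = s then (if w k = a then \<phi> w else 0) - (if w k = Suc a then \<phi> w else 0) else 0)"
  have "f j = g j + h j" if j: "j \<in> {1..n}" for j
  proof (cases "j = s")
    case False
    have h: "h j = 0" using False by (simp add: h_def)
    consider "j = k" | "j < k" | "k < j" by linarith
    then show ?thesis
    proof cases
      case 1
      then show ?thesis unfolding h by (simp add: f_def g_def cov_def)
    next
      case 2
      have ns: "\<not> (w j = a \<and> w k = Suc a)" "\<not> (w j = Suc a \<and> w k = a)"
        using False b c bc by (auto simp: s_def split: if_splits)
      have "\<not> cov w k j" "\<not> cov (lmult a w) k j" using 2 by (auto simp: cov_def)
      then show ?thesis using cov_lmult_iff[OF bij 2 ns]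
        by (auto simp: h f_def g_def lmult_swap_pos)
    next
      case 3
      have ns: "\<not> (w k = a \<and> w j = Suc a)" "\<not> (w k = Suc a \<and> w j = a)"
        using False b c bc by (auto simp: s_def split: if_splits)
      have "\<not> cov w j k" "\<not> cov (lmult a w) j k" using 3 by (auto simp: cov_def)
      then show ?thesis using cov_lmult_iff[OF bij 3 ns]
        by (auto simp: h f_def g_def lmult_swap_pos)
    qed
  next
    case True
    \<comment> \<open>For the partner position, swapping positions is left multiplication by
      \<open>s_a\<close>. Depending on which of the two values comes first, either
      \<open>f j\<close> or \<open>g j\<close> is \<open>\<phi> w\<close> up to sign and the other
      vanishes; the difference is the same.\<close>
    then have kj: "k = b \<and> j = c \<or> k = c \<and> j = b" using j by (auto simp: s_def split: if_splits)
    have sw: "swap_pos w b c = lmult a w" "swap_pos w c b = lmult a w"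
      using lmult_eq_swap_pos[OF bij, of a] by (auto simp: b_def c_def swap_pos_def transpose_commute)
    then have sw': "swap_pos (lmult a w) b c = w" "swap_pos (lmult a w) c b = w"
      by (metis swap_pos_swap_pos)+
    have val: "lmult a w b = Suc a" "lmult a w c = a" by (simp_all add: lmult_def wb wc)
    have ld: "ldesc a w \<longleftrightarrow> c < b" by (simp add: ldesc_def b_def c_def)
    have "inv (lmult a w) = inv w \<circ> transpose a (Suc a)"
      unfolding lmult_def using bij by (subst o_inv_distrib) auto
    then have ld': "ldesc a (lmult a w) \<longleftrightarrow> b < c" by (simp add: ldesc_def b_def c_def)
    have cv: "cov w b c \<longleftrightarrow> b < c" "\<not> cov w c b" "cov (lmult a w) c b \<longleftrightarrow> c < b" "\<not> cov (lmult a w) b c"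
      by (auto simp: cov_def wb wc val)
    have hj: "h j = (if w k = a then \<phi> w else 0) - (if w k = Suc a then \<phi> w else 0)"
      using True by (simp add: h_def)
    from kj show ?thesis
    proof
      assume k: "k = b \<and> j = c"
      then show ?thesis using bc hj
        by (auto simp: f_def g_def cv sw sw' ld ld' wb)
    next
      assume k: "k = c \<and> j = b"
      then show ?thesis using bc hj
        by (auto simp: f_def g_def cv sw sw' ld ld' wc)
    qed
  qed
  then have "(\<Sum>j\<in>{1..n}. f j) = (\<Sum>j\<in>{1..n}. g j) + (\<Sum>j\<in>{1..n}. h j)"
    by (simp add: sum.distrib)
  moreover have "(\<Sum>j\<in>{1..n}. h j) =
      (if w k = a then \<phi> w else 0) - (if w k = Suc a then \<phi> w else 0)"
    using bn bc by (auto simp: h_def s_def b c)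
  ultimately show ?thesis
    by (simp add: bruhat_sum_def f_def g_def)
qed

section \<open>Telescoping along the letters of a compatible sequence\<close>

lemma bruhat_sum_add:
  "bruhat_sum n k (\<lambda>v. \<phi> v + \<psi> v) w = bruhat_sum n k \<phi> w + bruhat_sum n k \<psi> w"
  unfolding bruhat_sum_def sum.distrib[symmetric] by (rule sum.cong) auto

text \<open>The bound for the letter after \<open>Suc N\<close> with entry \<open>b\<close>. Under a
  repeated entry the letters may not increase, and a reduced word does not repeat a letter at once,
  so the bound is \<open>N\<close>; otherwise every letter up to \<open>n - 1\<close> is
  allowed.\<close>

definition next_bound :: "nat \<Rightarrow> nat \<Rightarrow> nat \<Rightarrow> nat list \<Rightarrow> nat" where
  "next_bound n N b bs = (if bs \<noteq> [] \<and> hd bs = b then N else n - 1)"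

text \<open>
  The value \<open>word_count n bs N w\<close> is the number of reduced words of \<open>w\<close> that are compatible with
  \<open>bs\<close> and whose first letter is at most \<open>N\<close>.
\<close>

fun word_count :: "nat \<Rightarrow> nat list \<Rightarrow> nat \<Rightarrow> (nat \<Rightarrow> nat) \<Rightarrow> int" where
  "word_count n [] N w = (if w = id then 1 else 0)"
| "word_count n (b # bs) 0 w = 0"
| "word_count n (b # bs) (Suc N) w = word_count n (b # bs) N w +
     (if ldesc (Suc N) w then word_count n bs (next_bound n N b bs) (lmult (Suc N) w) else 0)"

lemma ldesc_lmult:
  assumes "bij w" "ldesc a w"
  shows "\<not> ldesc a (lmult a w)"
proof -
  have "inv (lmult a w) = inv w \<circ> transpose a (Suc a)"
    unfolding lmult_def using assms(1) by (subst o_inv_distrib) auto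
  then show ?thesis using assms(2) by (simp add: ldesc_def)
qed

text \<open>Only the values \<open>a\<close> and \<open>a + 1\<close> change their order, and at a
  left descent they stand in the wrong order already. This carries the side conditions on
  \<open>w k\<close> through the induction.\<close>

lemma lmult_less:
  assumes "bij w" "ldesc a w" "i < k" "w i < w k"
  shows "lmult a w i < lmult a w k"
proof -
  have "\<not> (w i = a \<and> w k = Suc a)"
    using assms by (metis ldesc_def bij_inv_eq_iff less_asym)
  with assms(4) show ?thesis by (auto simp: lmult_def transpose_def)
qed

text \<open>The exact form of the partial telescoping sum: all error terms cancel except the one at
  \<open>w k = Suc N\<close>. The entries \<open>w i\<close> and \<open>w j\<close> keep
  \<open>w k\<close> away from 1, needed at the bound 0, and away from \<open>n\<close>, needed when
  a new entry resets the bound to \<open>n - 1\<close>.\<close>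

lemma bruhat_sum_word_count:
  assumes "w permutes {1..n}" and "1 \<le> i" "i < k" "w i < w k" and "k < j" "j \<le> n" "w k < w j" and "N < n"
  shows "bruhat_sum n k (word_count n bs N) w =
    (if bs \<noteq> [] \<and> w k = Suc N then - word_count n (tl bs) (next_bound n N (hd bs) (tl bs)) w else 0)"
  using assms
proof (induction n bs N w rule: word_count.induct)
  case (1 n N w)
  \<comment> \<open>An upper cover has an inversion, so the empty word contributes to no
    term.\<close>
  have "swap_pos w x y \<noteq> id" if "cov w x y" for x y
  proof
    assume "swap_pos w x y = id"
    then have "swap_pos w x y x < swap_pos w x y y" using that by (simp add: cov_def)
    then show False using that by (simp add: cov_def swap_pos_apply split: if_splits)
  qed
  then show ?case by (auto simp: bruhat_sum_def intro!: sum.neutral)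
next
  case (2 n b bs w)
  have "w i \<noteq> 0" using permutes_in_image[OF 2(1), of i] 2 by auto
  then show ?case using 2 by (auto simp: bruhat_sum_def intro!: sum.neutral)
next
  case (3 n b bs N w)
  let ?a = "Suc N" and ?M = "next_bound n N b bs"
  note w = 3(3) and ineqs = 3(4-9) and N = 3(10)
  have bij: "bij w" using permutes_bij[OF w] .
  have a: "1 \<le> ?a" "?a < n" and k: "k \<in> {1..n}" using ineqs N by auto
  have v: "lmult ?a w permutes {1..n}" using lmult_permutes[OF w a] .
  have M: "?M < n" using N by (auto simp: next_bound_def)
  have IH1: "bruhat_sum n k (word_count n (b # bs) N) w =
      (if w k = ?a then - word_count n bs ?M w else 0)"
    using 3(1)[OF w ineqs] N by simp
  have "word_count n (b # bs) ?a =
      (\<lambda>v. word_count n (b # bs) N v + (if ldesc ?a v then word_count n bs ?M (lmult ?a v) else 0))"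
    by (simp add: fun_eq_iff)
  then have "bruhat_sum n k (word_count n (b # bs) ?a) w =
      (if w k = ?a then - word_count n bs ?M w else 0) +
      ((if ldesc ?a w then bruhat_sum n k (word_count n bs ?M) (lmult ?a w) else 0) +
       (if w k = ?a then word_count n bs ?M w else 0) - (if w k = Suc ?a then word_count n bs ?M w else 0))"
    by (simp only: bruhat_sum_add IH1 bruhat_sum_ldesc[OF w a k])
  \<comment> \<open>The telescoping: the term left over from the smaller bound \<open>N\<close>
    cancels the new error term at \<open>w k = ?a\<close>.\<close>
  also have "\<dots> = (if ldesc ?a w then bruhat_sum n k (word_count n bs ?M) (lmult ?a w) else 0)
       - (if w k = Suc ?a then word_count n bs ?M w else 0)" by simp
  also have "(if ldesc ?a w then bruhat_sum n k (word_count n bs ?M) (lmult ?a w) else 0) =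
      (if ldesc ?a w \<and> bs \<noteq> [] \<and> hd bs = b \<and> w k = Suc ?a
       then - word_count n (tl bs) (next_bound n N b (tl bs)) (lmult ?a w) else 0)"
  proof (cases "ldesc ?a w")
    case True
    have ik: "lmult ?a w i < lmult ?a w k" and kj: "lmult ?a w k < lmult ?a w j"
      using lmult_less[OF bij True] ineqs by auto
    have "lmult ?a w j \<le> n" using permutes_in_image[OF v, of j] ineqs by auto
    then have nn: "lmult ?a w k \<noteq> n" using kj by auto
    have eqa: "lmult ?a w k = ?a \<longleftrightarrow> w k = Suc ?a" by (auto simp: lmult_def transpose_def)
    show ?thesis
      using 3(2)[OF True v ineqs(1,2) ik ineqs(4,5) kj M] True nn eqa N
      by (auto simp: next_bound_def)
  qed simp
  finally have *: "bruhat_sum n k (word_count n (b # bs) ?a) w = \<dots>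
      - (if w k = Suc ?a then word_count n bs ?M w else 0)" .
  \<comment> \<open>If the entry \<open>b\<close> is repeated, the target bound is \<open>?a\<close>
    instead of \<open>N\<close>, and the two remaining terms are the recursion equation of
    \<open>word_count\<close>. Otherwise both bounds equal \<open>n - 1\<close> and only the second
    term remains.\<close>
  show ?case
  proof (cases "bs \<noteq> [] \<and> hd bs = b")
    case True
    then obtain bs' where bs: "bs = b # bs'" by (cases bs) auto
    show ?thesis unfolding * by (simp add: bs next_bound_def)
  next
    case False
    then have M: "next_bound n K b bs = n - 1" for K by (auto simp: next_bound_def)
    show ?thesis unfolding * using False by (auto simp: M)
  qed
qed

lemma all_nat_cases: "(\<forall>i. P i) \<longleftrightarrow> P 0 \<and> (\<forall>i. P (Suc i))"
  by (metis not0_implies_Suc)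

lemma compatible_Cons:
  "compatible (a # as) (b # bs) \<longleftrightarrow>
     1 \<le> b \<and> (\<forall>c\<in>set bs. b \<le> c) \<and> compatible as bs \<and> (as \<noteq> [] \<longrightarrow> a < hd as \<longrightarrow> b < hd bs)"
proof -
  have "(\<forall>i. Suc i < length (a # as) \<longrightarrow> (a # as) ! i < (a # as) ! Suc i \<longrightarrow> (b # bs) ! i < (b # bs) ! Suc i) \<longleftrightarrow>
    (as \<noteq> [] \<longrightarrow> a < hd as \<longrightarrow> b < hd bs) \<and>
    (\<forall>i. Suc i < length as \<longrightarrow> as ! i < as ! Suc i \<longrightarrow> bs ! i < bs ! Suc i)"
    if len: "length bs = length as"
  proof (cases as)
    case Nil
    then show ?thesis using len by simp
  next
    case (Cons x xs)
    then obtain y ys where "bs = y # ys" using len by (cases bs) auto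
    then show ?thesis using Cons by (subst all_nat_cases) simp
  qed
  then show ?thesis by (auto simp: compatible_def)
qed

text \<open>The first letter is either at most \<open>N\<close> or equal to \<open>Suc N\<close>,
  which is the recursion of \<open>word_count\<close>. Finiteness is proved along, as
  \<open>card\<close> adds up only for finite sets.\<close>

lemma word_count_eq_card:
  assumes "w permutes {1..n}" and "N \<le> n - 1" and "sorted bs" and "\<forall>b\<in>set bs. 1 \<le> b"
  shows "word_count n bs N w =
    int (card {as \<in> reduced_words n w. compatible as bs \<and> (as \<noteq> [] \<longrightarrow> hd as \<le> N)})
    \<and> finite {as \<in> reduced_words n w. compatible as bs \<and> (as \<noteq> [] \<longrightarrow> hd as \<le> N)}"
  using assms
proof (induction n bs N w rule: word_count.induct)
  case (1 n N w)
  have "{as \<in> reduced_words n w. compatible as [] \<and> (as \<noteq> [] \<longrightarrow> hd as \<le> N)} =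
      (if w = id then {[]} else {})"
    using Nil_reduced_words[OF 1(1)] by (auto simp: compatible_def)
  then show ?case by simp
next
  case (2 n b bs w)
  have E: "{as \<in> reduced_words n w. compatible as (b # bs) \<and> (as \<noteq> [] \<longrightarrow> hd as \<le> 0)} = {}"
  proof -
    have False if "as \<in> reduced_words n w" "compatible as (b # bs)" "as \<noteq> [] \<longrightarrow> hd as \<le> 0" for as
    proof (cases as)
      case Nil
      then show False using that by (simp add: compatible_def)
    next
      case (Cons a as')
      then show False using that reduced_words_Cons[OF 2(1), of a as'] by simp
    qed
    then show ?thesis by blast
  qed
  show ?case unfolding E by simp
next
  case (3 n b bs N w)
  let ?a = "Suc N" and ?M = "next_bound n N b bs"
  let ?W = "\<lambda>bs N w. {as \<in> reduced_words n w. compatible as bs \<and> (as \<noteq> [] \<longrightarrow> hd as \<le> N)}"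
  note w = 3(3) and N = 3(4) and bs = 3(5,6)
  have a: "1 \<le> ?a" "?a < n" using N by auto
  have v: "lmult ?a w permutes {1..n}" using lmult_permutes[OF w a] .
  have M: "?M \<le> n - 1" using N by (auto simp: next_bound_def)
  have IH1: "word_count n (b # bs) N w = int (card (?W (b # bs) N w)) \<and> finite (?W (b # bs) N w)"
    using 3(1)[OF w _ bs] N by simp
  have nd: "\<not> ldesc ?a (lmult ?a w)" if "ldesc ?a w"
    using ldesc_lmult[OF permutes_bij[OF w] that] .
  have hdn: "hd as \<le> n - 1" if "as \<in> reduced_words n u" "u permutes {1..n}" "as \<noteq> []" for as u
    using that reduced_words_Cons[OF that(2), of "hd as" "tl as"] by auto
  have new: "?a # as \<in> ?W (b # bs) ?a w \<longleftrightarrow> ldesc ?a w \<and> as \<in> ?W bs ?M (lmult ?a w)" for as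
  proof (cases "ldesc ?a w \<and> as \<in> reduced_words n (lmult ?a w) \<and> compatible as bs")
    case False
    then show ?thesis using bs by (auto simp: reduced_words_Cons[OF w] compatible_Cons)
  next
    case True
    have "(?a < hd as \<longrightarrow> b < hd bs) \<longleftrightarrow> hd as \<le> ?M" if "as \<noteq> []"
    proof -
      have bne: "bs \<noteq> []" using True that by (auto simp: compatible_def)
      then have bb: "b \<le> hd bs" using bs by (cases bs) auto
      \<comment> \<open>After removing \<open>?a\<close>, it is no longer a left descent. Hence a
        next letter not exceeding \<open>?a\<close> is at most \<open>N\<close>, as
        \<open>next_bound\<close> demands.\<close>
      have "hd as \<noteq> ?a"
        using True nd that reduced_words_Cons[OF v, of "hd as" "tl as"] by auto
      moreover have "hd as \<le> n - 1" using hdn[OF _ v that] True by blast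
      ultimately show ?thesis using bb bne by (auto simp: next_bound_def)
    qed
    then show ?thesis using True a bs by (auto simp: reduced_words_Cons[OF w] compatible_Cons)
  qed
  have split: "?W (b # bs) ?a w = ?W (b # bs) N w \<union> (if ldesc ?a w then (#) ?a ` ?W bs ?M (lmult ?a w) else {})"
  proof (rule set_eqI)
    fix as
    show "as \<in> ?W (b # bs) ?a w \<longleftrightarrow>
      as \<in> ?W (b # bs) N w \<union> (if ldesc ?a w then (#) ?a ` ?W bs ?M (lmult ?a w) else {})"
    proof (cases "as \<noteq> [] \<and> hd as = ?a")
      case True
      then obtain as' where "as = ?a # as'" by (cases as) auto
      then show ?thesis using new[of as'] by auto
    next
      case False
      then show ?thesis by (auto simp: le_Suc_eq)
    qed
  qed
  have disj: "?W (b # bs) N w \<inter> (#) ?a ` X = {}" for X by auto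
  show ?case
  proof (cases "ldesc ?a w")
    case True
    have IH2: "word_count n bs ?M (lmult ?a w) = int (card (?W bs ?M (lmult ?a w))) \<and> finite (?W bs ?M (lmult ?a w))"
      using 3(2)[OF True v M] bs by simp
    have "card (?W (b # bs) ?a w) = card (?W (b # bs) N w) + card (?W bs ?M (lmult ?a w))"
      unfolding split using True IH1 IH2 disj by (subst card_Un_disjoint) (auto simp: card_image)
    moreover have "finite (?W (b # bs) ?a w)" unfolding split using True IH1 IH2 by simp
    ultimately show ?thesis using True IH1 IH2 by simp
  next
    case False
    then show ?thesis using IH1 unfolding split by simp
  qed
qed

text \<open>Compatible entry sequences are sorted, so the monomial determines the sequence and only
  the word varies.\<close>

lemma stanley_eq_card:
  "stanley n w m = int (card {as \<in> reduced_words n w. compatible as (sorted_list_of_multiset m)})"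
proof -
  define b where "b = sorted_list_of_multiset m"
  have m: "mset b = m" by (simp add: b_def)
  have uniq: "bs = b" if "compatible as bs" "mset bs = m" for as bs
    using that unfolding b_def
    by (metis compatible_def sorted_list_of_multiset_mset sort_key_id_if_sorted sorted_sort_id)
  have "{(as, bs). as \<in> reduced_words n w \<and> compatible as bs \<and> mset bs = m} =
      (\<lambda>as. (as, b)) ` {as \<in> reduced_words n w. compatible as b}"
  proof (intro equalityI subsetI)
    fix z assume "z \<in> {(as, bs). as \<in> reduced_words n w \<and> compatible as bs \<and> mset bs = m}"
    then obtain as bs where "z = (as, bs)" "as \<in> reduced_words n w" "compatible as bs" "mset bs = m"
      by blast
    then show "z \<in> (\<lambda>as. (as, b)) ` {as \<in> reduced_words n w. compatible as b}"
      using uniq[of as bs] by auto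
  qed (use m in auto)
  then show ?thesis by (simp add: stanley_def card_image inj_on_def b_def)
qed

lemma stanley_eq_word_count:
  assumes "w permutes {1..n}"
  shows "stanley n w m =
    (if \<forall>b\<in>#m. 1 \<le> b then word_count n (sorted_list_of_multiset m) (n - 1) w else 0)"
proof (cases "\<forall>b\<in>#m. 1 \<le> b")
  case True
  have "hd as \<le> n - 1" if "as \<in> reduced_words n w" "as \<noteq> []" for as
    using that reduced_words_Cons[OF assms, of "hd as" "tl as"] by auto
  then have "{as \<in> reduced_words n w. compatible as (sorted_list_of_multiset m)} =
      {as \<in> reduced_words n w. compatible as (sorted_list_of_multiset m) \<and> (as \<noteq> [] \<longrightarrow> hd as \<le> n - 1)}"
    by blast
  then show ?thesis
    using word_count_eq_card[OF assms, of "n - 1" "sorted_list_of_multiset m"] True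
    by (simp add: stanley_eq_card sorted_sorted_list_of_multiset)
next
  case False
  then have E: "{as \<in> reduced_words n w. compatible as (sorted_list_of_multiset m)} = {}"
    by (auto simp: compatible_def)
  show ?thesis unfolding stanley_eq_card E if_not_P[OF False] by simp
qed

text \<open>With the full bound \<open>n - 1\<close> the surviving error term would need
  \<open>w k = n\<close>, which the larger entry \<open>w j\<close> excludes; thus the signed sum
  vanishes.\<close>

lemma stanley_transition:
  assumes w: "w permutes {1..n}" and ineqs: "1 \<le> i" "i < k" "w i < w k" "k < j" "j \<le> n" "w k < w j"
  shows "(\<Sum>j | j \<in> {1..n} \<and> cov w k j. stanley n (swap_pos w k j) m) =
    (\<Sum>i | i \<in> {1..n} \<and> cov w i k. stanley n (swap_pos w i k) m)"
proof (cases "\<forall>b\<in>#m. 1 \<le> b")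
  case True
  let ?F = "word_count n (sorted_list_of_multiset m) (n - 1)"
  have st: "stanley n (swap_pos w x y) m = ?F (swap_pos w x y)" if "x \<in> {1..n}" "y \<in> {1..n}" for x y
    using stanley_eq_word_count[OF swap_pos_permutes[OF w that]] True by simp
  have k: "k \<in> {1..n}" using ineqs by auto
  have "w j \<le> n" using permutes_in_image[OF w, of j] ineqs by auto
  then have "bruhat_sum n k ?F w = 0"
    using bruhat_sum_word_count[OF w ineqs, of "n - 1"] ineqs by simp
  moreover have "bruhat_sum n k ?F w = (\<Sum>j\<in>{1..n}. (if cov w k j then ?F (swap_pos w k j) else 0)
      - (if cov w j k then ?F (swap_pos w j k) else 0))"
    unfolding bruhat_sum_def by (rule sum.cong) (auto simp: cov_def)
  ultimately have eq: "(\<Sum>j\<in>{1..n}. if cov w k j then ?F (swap_pos w k j) else 0) =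
      (\<Sum>j\<in>{1..n}. if cov w j k then ?F (swap_pos w j k) else 0)"
    by (simp add: sum_subtractf)
  have filt: "(\<Sum>j | j \<in> {1..n} \<and> P j. f j) = (\<Sum>j\<in>{1..n}. if P j then f j else 0)"
    for P and f :: "nat \<Rightarrow> int" by (rule sum.inter_filter) simp
  have "(\<Sum>j | j \<in> {1..n} \<and> cov w k j. ?F (swap_pos w k j)) =
      (\<Sum>j | j \<in> {1..n} \<and> cov w j k. ?F (swap_pos w j k))"
    unfolding filt by (rule eq)
  moreover have "(\<Sum>j | j \<in> {1..n} \<and> cov w k j. stanley n (swap_pos w k j) m) =
      (\<Sum>j | j \<in> {1..n} \<and> cov w k j. ?F (swap_pos w k j))"
    by (rule sum.cong) (use st k in auto)
  moreover have "(\<Sum>j | j \<in> {1..n} \<and> cov w j k. stanley n (swap_pos w j k) m) =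
      (\<Sum>j | j \<in> {1..n} \<and> cov w j k. ?F (swap_pos w j k))"
    by (rule sum.cong) (use st k in auto)
  ultimately show ?thesis by (simp only:)
next
  case False
  have st: "stanley n (swap_pos w x y) m = 0" if "x \<in> {1..n}" "y \<in> {1..n}" for x y
    unfolding stanley_eq_word_count[OF swap_pos_permutes[OF w that]] if_not_P[OF False] ..
  have k: "k \<in> {1..n}" using ineqs by auto
  have "(\<Sum>j | j \<in> {1..n} \<and> cov w k j. stanley n (swap_pos w k j) m) = 0"
    "(\<Sum>i | i \<in> {1..n} \<and> cov w i k. stanley n (swap_pos w i k) m) = 0"
    by (rule sum.neutral; use st k in auto)+
  then show ?thesis by (simp only:)
qed

section \<open>The tree\<close>

locale nondominant_perm =
  fixes n :: nat and u :: "nat \<Rightarrow> nat"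
  assumes perm: "u permutes {1..n}" and nondominant: "\<not> dominant u"
begin

abbreviation "p \<equiv> p_pos u"
abbreviation "q \<equiv> q_pos u"
abbreviation "v \<equiv> swap_pos u p q"

lemma inj_u: "u x = u y \<longleftrightarrow> x = y"
  using permutes_inj[OF perm] by (auto simp: inj_def)

lemma inversion_le: "1 \<le> i \<Longrightarrow> i < j \<Longrightarrow> u j < u i \<Longrightarrow> j \<le> n"
  using inversions_finite[OF perm] by fastforce

lemma finite_p: "finite {t. \<exists>i j. 1 \<le> i \<and> i < t \<and> t < j \<and> u i < u j \<and> u j < u t}"
proof (rule finite_subset)
  show "{t. \<exists>i j. 1 \<le> i \<and> i < t \<and> t < j \<and> u i < u j \<and> u j < u t} \<subseteq> {..n}"
  proof
    fix t assume "t \<in> {t. \<exists>i j. 1 \<le> i \<and> i < t \<and> t < j \<and> u i < u j \<and> u j < u t}"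
    then obtain i j where "1 \<le> i" "i < t" "t < j" "u j < u t" by blast
    then show "t \<in> {..n}" using inversion_le[of t j] by simp
  qed
qed simp

lemma p_max: "1 \<le> i \<Longrightarrow> i < t \<Longrightarrow> t < j \<Longrightarrow> u i < u j \<Longrightarrow> u j < u t \<Longrightarrow> t \<le> p"
  unfolding p_pos_def by (rule Max_ge[OF finite_p]) blast

lemma p_pattern: "\<exists>i j. 1 \<le> i \<and> i < p \<and> p < j \<and> u i < u j \<and> u j < u p"
proof -
  have "p \<in> {t. \<exists>i j. 1 \<le> i \<and> i < t \<and> t < j \<and> u i < u j \<and> u j < u t}"
    unfolding p_pos_def
    by (rule Max_in[OF finite_p]) (use nondominant in \<open>auto simp: dominant_def\<close>)
  then show ?thesis by blast
qed

lemma finite_q: "finite {j. p < j \<and> u j < u p \<and> (\<exists>i. 1 \<le> i \<and> i < p \<and> u i < u j)}"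
proof (rule finite_subset)
  show "{j. p < j \<and> u j < u p \<and> (\<exists>i. 1 \<le> i \<and> i < p \<and> u i < u j)} \<subseteq> {..n}"
  proof
    fix j assume "j \<in> {j. p < j \<and> u j < u p \<and> (\<exists>i. 1 \<le> i \<and> i < p \<and> u i < u j)}"
    then obtain i where "p < j" "u j < u p" "1 \<le> i" "i < p" by blast
    then show "j \<in> {..n}" using inversion_le[of p j] by simp
  qed
qed simp

lemma q_max: "p < j \<Longrightarrow> u j < u p \<Longrightarrow> 1 \<le> i \<Longrightarrow> i < p \<Longrightarrow> u i < u j \<Longrightarrow> j \<le> q"
  unfolding q_pos_def by (rule Max_ge[OF finite_q]) blast

lemma q_pattern: "p < q \<and> u q < u p \<and> (\<exists>i. 1 \<le> i \<and> i < p \<and> u i < u q)"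
proof -
  have "q \<in> {j. p < j \<and> u j < u p \<and> (\<exists>i. 1 \<le> i \<and> i < p \<and> u i < u j)}"
    unfolding q_pos_def by (rule Max_in[OF finite_q]) (use p_pattern in blast)
  then show ?thesis by blast
qed

lemma pq: "1 < p" "p < q" "q \<le> n" "u q < u p"
  using q_pattern inversion_le[of p q] by auto

text \<open>A larger entry at \<open>l\<close> would be the top of a pattern 132 ending at
  \<open>q\<close>, against the maximality of \<open>p\<close>.\<close>

lemma between_p_q:
  assumes "p < l" "l < q"
  shows "u l < u q"
proof -
  obtain i where "1 \<le> i" "i < p" "u i < u q" using q_pattern by blast
  then have "\<not> u q < u l" using p_max[of i l q] assms by auto
  moreover have "u l \<noteq> u q" using inj_u assms by simp
  ultimately show ?thesis by simp
qed

text \<open>Otherwise \<open>l\<close> would be a candidate for \<open>q\<close> further to the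
  right.\<close>

lemma after_q:
  assumes "q < l" "u l < u p" "1 \<le> i" "i < p"
  shows "u l < u i"
proof -
  have "\<not> u i < u l" using q_max[of l i] assms pq by auto
  moreover have "u l \<noteq> u i" using inj_u assms pq by simp
  ultimately show ?thesis by simp
qed

lemma v_permutes: "v permutes {1..n}"
  using pq by (intro swap_pos_permutes[OF perm]) auto

lemma v_apply: "v p = u q" "v q = u p" "x \<noteq> p \<Longrightarrow> x \<noteq> q \<Longrightarrow> v x = u x"
  using pq(2) by (simp_all add: swap_pos_apply)

text \<open>Entries between \<open>p\<close> and \<open>q\<close> are too small. An entry after
  \<open>q\<close> that exceeds \<open>u q\<close> also exceeds \<open>u p\<close> by
  \<open>after_q\<close>, so that \<open>v q\<close> obstructs the cover.\<close>

lemma cov_v_right: "cov v p j \<longleftrightarrow> j = q"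
proof
  assume c: "cov v p j"
  then have j: "p < j" "u q < v j" unfolding cov_def v_apply by blast+
  obtain i where i: "1 \<le> i" "i < p" "u i < u q" using q_pattern by blast
  show "j = q"
  proof (rule ccontr)
    assume "j \<noteq> q"
    then have vj: "v j = u j" using j(1) by (intro v_apply(3)) auto
    with j have ujq: "u q < u j" by simp
    then have "q < j" using between_p_q[of j] j \<open>j \<noteq> q\<close> by (meson less_asym linorder_neqE_nat)
    then have "\<not> u j < u p" using after_q[of j i] i ujq by auto
    moreover have "u j \<noteq> u p" using inj_u j by auto
    ultimately have "u p < u j" by simp
    then have "v p < v q \<and> v q < v j" using pq vj unfolding v_apply by simp
    with c \<open>q < j\<close> pq(2) show False unfolding cov_def by blast
  qed
next
  assume "j = q"
  have "\<not> (v p < v l \<and> v l < v q)" if "p < l" "l < q" for l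
    using between_p_q[OF that] that by (simp add: swap_pos_apply)
  then show "cov v p j"
    using pq \<open>j = q\<close> by (auto simp: cov_def swap_pos_apply)
qed

lemma I_set_v: "I_set v p = {i. 1 \<le> i \<and> i < p \<and> cov v i p}"
  using cov_iff_ell[OF v_permutes, of _ p] pq by (auto simp: I_set_def)

text \<open>The nearest position to the left of \<open>p\<close> with an entry below
  \<open>u q\<close> gives a cover. Hence \<open>Phi\<close> is read off at once, without shifting
  to \<open>one_times\<close>, and all labels stay in the same symmetric group.\<close>

lemma I_set_v_ne: "I_set v p \<noteq> {}"
proof -
  define A where "A = {i. 1 \<le> i \<and> i < p \<and> u i < u q}"
  have fin: "finite A" by (simp add: A_def)
  define M where "M = Max A"
  have "A \<noteq> {}" using q_pattern by (auto simp: A_def)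
  then have "M \<in> A" using fin Max_in M_def by blast
  then have M: "1 \<le> M" "M < p" "u M < u q" by (simp_all add: A_def)
  have "\<not> u l < u q" if "M < l" "l < p" for l
  proof
    assume "u l < u q"
    then have "l \<in> A" using that M by (simp add: A_def)
    then show False using Max_ge[OF fin, of l] that by (simp add: M_def)
  qed
  moreover have "v l = u l" if "l < p" for l using that pq(2) by (intro v_apply(3)) auto
  ultimately have "cov v M p"
    using M by (simp add: cov_def v_apply(1))
  then show ?thesis using M I_set_v by blast
qed

lemma child_labels_eq: "child_labels u = (\<lambda>i. swap_pos v i p) ` I_set v p"
  using nondominant I_set_v_ne by (auto simp: child_labels_def Phi_rec)

lemma child_apply:
  assumes "i \<in> I_set v p"
  shows "swap_pos v i p x = (if x = i then u q else if x = p then u i else if x = q then u p else u x)"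
  using assms pq by (auto simp: I_set_v swap_pos_apply)

lemma child_less: "i \<in> I_set v p \<Longrightarrow> 1 \<le> i \<and> i < p \<and> u i < u q"
  using pq by (auto simp: I_set_v cov_def swap_pos_apply split: if_splits)

lemma child_permutes:
  assumes "x \<in> child_labels u"
  shows "x permutes {1..n}"
proof -
  obtain i where "x = swap_pos v i p" "i \<in> {1..n}"
    using assms pq unfolding child_labels_eq I_set_v by auto
  then show ?thesis using swap_pos_permutes[OF v_permutes] pq by simp
qed

lemma finite_child_labels: "finite (child_labels u)"
  unfolding child_labels_eq by (rule finite_imageI) (simp add: I_set_v)

text \<open>Distinct covers give distinct labels, so the sum over covers in the transition formula
  becomes a sum over the set \<open>child_labels u\<close>.\<close>

lemma inj_on_child: "inj_on (\<lambda>i. swap_pos v i p) (I_set v p)"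
proof
  fix i j assume ij: "i \<in> I_set v p" "j \<in> I_set v p" "swap_pos v i p = swap_pos v j p"
  have "swap_pos v i p i = swap_pos v j p i" using ij(3) by (rule fun_cong)
  then have "u q = (if i = j then u q else if i = p then u j else if i = q then u p else u i)"
    unfolding child_apply[OF ij(1)] child_apply[OF ij(2)] by simp
  then show "i = j" using child_less[OF ij(1)] pq by (auto split: if_splits)
qed

lemma stanley_children: "stanley n u m = (\<Sum>x\<in>child_labels u. stanley n x m)"
proof -
  obtain i where i: "1 \<le> i" "i < p" "u i < u q" using q_pattern by blast
  have "v i = u i" using i pq by (intro v_apply(3)) auto
  then have "v i < v p" "v p < v q" using i pq unfolding v_apply by simp_all
  from stanley_transition[OF v_permutes i(1,2) this(1) pq(2,3) this(2), of m]
  have "(\<Sum>j | j \<in> {1..n} \<and> j = q. stanley n (swap_pos v p j) m) =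
      (\<Sum>i | i \<in> {1..n} \<and> cov v i p. stanley n (swap_pos v i p) m)"
    by (simp only: cov_v_right)
  moreover have "{j. j \<in> {1..n} \<and> j = q} = {q}" using pq by auto
  moreover have "{i. i \<in> {1..n} \<and> cov v i p} = I_set v p" using pq by (auto simp: I_set_v cov_def)
  ultimately show ?thesis
    by (simp add: child_labels_eq sum.reindex[OF inj_on_child])
qed

end

text \<open>The cardinality of this finite set is the termination measure. At a child, the first
  changed position is some \<open>i < p\<close>, where \<open>u i\<close> is replaced by the larger
  \<open>u q\<close>.\<close>

definition lex_above :: "nat \<Rightarrow> (nat \<Rightarrow> nat) \<Rightarrow> (nat \<Rightarrow> nat) set" where
  "lex_above n u = {x. x permutes {1..n} \<and> (\<exists>i. (\<forall>l<i. x l = u l) \<and> u i < x i)}"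

lemma lex_above_child:
  assumes "u permutes {1..n}" "x \<in> child_labels u"
  shows "card (lex_above n x) < card (lex_above n u)"
proof -
  have "\<not> dominant u" using assms(2) by (auto simp: child_labels_def)
  then interpret nondominant_perm n u using assms(1) by unfold_locales
  obtain i where i: "i \<in> I_set v p" "x = swap_pos v i p" using assms(2) child_labels_eq by auto
  have x: "\<forall>l<i. x l = u l" "u i < x i"
    using child_less[OF i(1)] pq unfolding i(2) child_apply[OF i(1)] by auto
  have "finite (lex_above n u)"
    by (rule finite_subset[OF _ finite_permutations[of "{1..n}"]]) (auto simp: lex_above_def)
  moreover have "lex_above n x \<subseteq> lex_above n u"
  proof
    fix y assume "y \<in> lex_above n x"
    then obtain j where y: "y permutes {1..n}" "\<forall>l<j. y l = x l" "x j < y j" by (auto simp: lex_above_def)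
    have "(\<forall>l<min i j. y l = u l) \<and> u (min i j) < y (min i j)"
      using x y by (cases i j rule: linorder_cases) (auto simp: min_def)
    then show "y \<in> lex_above n u" using y(1) unfolding lex_above_def by blast
  qed
  moreover have "x \<in> lex_above n u" using x child_permutes assms(2) unfolding lex_above_def by blast
  moreover have "x \<notin> lex_above n x" by (simp add: lex_above_def)
  ultimately show ?thesis by (intro psubset_card_mono) auto
qed

text \<open>Induction from the leaves upwards; a dominant label has no children, so the base case is
  contained in the step.\<close>

lemma tree_induct [consumes 1, case_names step]:
  assumes "u permutes {1..n}"
    and "\<And>u. u permutes {1..n} \<Longrightarrow> (\<And>x. x \<in> child_labels u \<Longrightarrow> P x) \<Longrightarrow> P u"
  shows "P u"
  using assms(1)
proof (induction "card (lex_above n u)" arbitrary: u rule: less_induct)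
  case less
  show ?case
  proof (rule assms(2)[OF less.prems])
    fix x assume x: "x \<in> child_labels u"
    then have "\<not> dominant u" by (auto simp: child_labels_def)
    then interpret nondominant_perm n u using less.prems by unfold_locales
    show "P x" using less.hyps[OF lex_above_child[OF less.prems x] child_permutes[OF x]] .
  qed
qed

lemma child_labels_empty_iff:
  assumes "u permutes {1..n}"
  shows "child_labels u = {} \<longleftrightarrow> dominant u"
proof (cases "dominant u")
  case False
  then interpret nondominant_perm n u using assms by unfold_locales
  show ?thesis using False I_set_v_ne by (simp add: child_labels_eq)
qed (simp add: child_labels_def)

section \<open>Nodes and leaves of the tree\<close>

lemma mLS_nodes_ne: "\<pi> \<in> mLS_nodes w \<Longrightarrow> \<pi> \<noteq> []"
  by (induction rule: mLS_nodes.induct) auto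

lemma mLS_nodes_snoc:
  assumes "\<pi> \<noteq> []"
  shows "\<pi> @ [v] \<in> mLS_nodes w \<longleftrightarrow> \<pi> \<in> mLS_nodes w \<and> v \<in> child_labels (last \<pi>)"
  using assms by (auto elim: mLS_nodes.cases intro: mLS_nodes.child)

text \<open>The inductive definition extends paths at their end, whereas the induction over the tree
  splits off the root.\<close>

lemma mLS_nodes_rec:
  "mLS_nodes w = insert [w] (\<Union>v\<in>child_labels w. (#) w ` mLS_nodes v)"
proof (intro equalityI subsetI)
  fix \<pi> assume "\<pi> \<in> mLS_nodes w"
  then show "\<pi> \<in> insert [w] (\<Union>v\<in>child_labels w. (#) w ` mLS_nodes v)"
  proof induction
    case (child \<pi> v)
    from child.IH show ?case
    proof
      assume "\<pi> = [w]"
      then show ?thesis using child.hyps by (auto intro: mLS_nodes.root)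
    next
      assume "\<pi> \<in> (\<Union>v\<in>child_labels w. (#) w ` mLS_nodes v)"
      then obtain x \<rho> where x: "x \<in> child_labels w" "\<rho> \<in> mLS_nodes x" "\<pi> = w # \<rho>" by auto
      then have "\<rho> @ [v] \<in> mLS_nodes x"
        using child.hyps mLS_nodes_ne[OF x(2)] by (auto intro: mLS_nodes.child)
      then show ?thesis using x by auto
    qed
  qed simp
next
  fix \<pi> assume "\<pi> \<in> insert [w] (\<Union>v\<in>child_labels w. (#) w ` mLS_nodes v)"
  then show "\<pi> \<in> mLS_nodes w"
  proof
    assume "\<pi> \<in> (\<Union>v\<in>child_labels w. (#) w ` mLS_nodes v)"
    then obtain x \<rho> where x: "x \<in> child_labels w" "\<rho> \<in> mLS_nodes x" and \<pi>: "\<pi> = w # \<rho>" by auto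
    from x(2) have "w # \<rho> \<in> mLS_nodes w"
    proof induction
      case root
      show ?case using mLS_nodes.child[OF mLS_nodes.root, of x w] x(1) by simp
    next
      case (child \<rho> v)
      then show ?case using mLS_nodes.child[OF child.IH, of v] mLS_nodes_ne[OF child.hyps(1)] by simp
    qed
    then show ?thesis using \<pi> by simp
  qed (simp add: mLS_nodes.root)
qed

lemma mLS_leaves_eq: "mLS_leaves w = {\<pi> \<in> mLS_nodes w. child_labels (last \<pi>) = {}}"
  using mLS_nodes_snoc mLS_nodes_ne unfolding mLS_leaves_def by blast

lemma mLS_leaves_rec:
  "mLS_leaves w = (if child_labels w = {} then {[w]} else (\<Union>v\<in>child_labels w. (#) w ` mLS_leaves v))"
proof -
  have "last (w # \<rho>) = last \<rho>" if "\<rho> \<in> mLS_nodes x" for \<rho> x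
    using mLS_nodes_ne[OF that] by simp
  then show ?thesis
    unfolding mLS_leaves_eq by (subst mLS_nodes_rec) auto
qed

lemma stanley_leaves:
  assumes "u permutes {1..n}"
  shows "finite (mLS_leaves u) \<and> (\<forall>\<pi>\<in>mLS_leaves u. dominant (last \<pi>) \<and> last \<pi> permutes {1..n}) \<and>
    (\<forall>m. stanley n u m = (\<Sum>\<pi>\<in>mLS_leaves u. stanley n (last \<pi>) m))"
  using assms
proof (induction rule: tree_induct)
  case (step u)
  show ?case
  proof (cases "dominant u")
    case True
    then show ?thesis using step.hyps by (subst (1 2 3) mLS_leaves_rec) (simp add: child_labels_empty_iff[OF step.hyps])
  next
    case False
    then interpret nondominant_perm n u using step.hyps by unfold_locales
    have ne: "child_labels u \<noteq> {}" using False child_labels_empty_iff[OF step.hyps] by simp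
    have rec: "mLS_leaves u = (\<Union>v\<in>child_labels u. (#) u ` mLS_leaves v)"
      using ne by (subst mLS_leaves_rec) simp
    have ls: "last (u # \<pi>) = last \<pi>" if "\<pi> \<in> mLS_leaves v" for \<pi> v
      using that mLS_nodes_ne by (auto simp: mLS_leaves_eq)
    \<comment> \<open>Paths in the subtree of \<open>v\<close> start with \<open>v\<close>; this
      separates the subtrees of different children even if their leaves carry equal labels.\<close>
    have hd: "hd \<pi> = v" if "\<pi> \<in> mLS_nodes v" for \<pi> v
      using that by (subst (asm) mLS_nodes_rec) auto
    have fin: "finite (mLS_leaves u)"
      unfolding rec using step.IH finite_child_labels by auto
    moreover have "\<forall>\<pi>\<in>mLS_leaves u. dominant (last \<pi>) \<and> last \<pi> permutes {1..n}"
      unfolding rec using step.IH ls by fastforce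
    moreover have "stanley n u m = (\<Sum>\<pi>\<in>mLS_leaves u. stanley n (last \<pi>) m)" for m
    proof -
      have "(\<Sum>\<pi>\<in>mLS_leaves u. stanley n (last \<pi>) m) =
          (\<Sum>v\<in>child_labels u. \<Sum>\<pi>\<in>(#) u ` mLS_leaves v. stanley n (last \<pi>) m)"
        unfolding rec
      proof (rule sum.UNION_disjoint)
        show "\<forall>i\<in>child_labels u. \<forall>j\<in>child_labels u. i \<noteq> j \<longrightarrow> (#) u ` mLS_leaves i \<inter> (#) u ` mLS_leaves j = {}"
        proof (intro ballI impI)
          fix i j :: "nat \<Rightarrow> nat" assume "i \<noteq> j"
          have "\<pi> \<notin> mLS_leaves j" if "\<pi> \<in> mLS_leaves i" for \<pi>
            using hd[of \<pi> i] hd[of \<pi> j] that \<open>i \<noteq> j\<close> by (auto simp: mLS_leaves_eq)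
          then show "(#) u ` mLS_leaves i \<inter> (#) u ` mLS_leaves j = {}" by blast
        qed
      qed (use step.IH finite_child_labels in auto)
      also have "\<dots> = (\<Sum>v\<in>child_labels u. stanley n v m)"
      proof (rule sum.cong[OF refl])
        fix v assume "v \<in> child_labels u"
        have "(\<Sum>\<pi>\<in>(#) u ` mLS_leaves v. stanley n (last \<pi>) m) = (\<Sum>\<pi>\<in>mLS_leaves v. stanley n (last (u # \<pi>)) m)"
          by (rule sum.reindex_cong[where l = "(#) u"]) (simp_all add: inj_on_def)
        also have "\<dots> = (\<Sum>\<pi>\<in>mLS_leaves v. stanley n (last \<pi>) m)"
          using ls by (intro sum.cong) auto
        also have "\<dots> = stanley n v m" using step.IH[OF \<open>v \<in> child_labels u\<close>] by simp
        finally show "(\<Sum>\<pi>\<in>(#) u ` mLS_leaves v. stanley n (last \<pi>) m) = stanley n v m" .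
      qed
      finally show ?thesis using stanley_children by simp
    qed
    ultimately show ?thesis by blast
  qed
qed

section \<open>2143-avoiding permutations and Lehmer codes\<close>

definition code :: "nat \<Rightarrow> (nat \<Rightarrow> nat) \<Rightarrow> nat \<Rightarrow> nat" where
  "code n u i = card {j. i < j \<and> j \<le> n \<and> u j < u i}"

lemma lehmer_code_eq: "lehmer_code n u = map (code n u) [1..<n + 1]"
  by (simp add: lehmer_code_def code_def)

definition vexillary :: "(nat \<Rightarrow> nat) \<Rightarrow> bool" where
  "vexillary u \<longleftrightarrow> \<not> (\<exists>a b c d. 1 \<le> a \<and> a < b \<and> b < c \<and> c < d \<and> u b < u a \<and> u a < u d \<and> u d < u c)"

lemma vexillaryD:
  "vexillary u \<Longrightarrow> 1 \<le> a \<Longrightarrow> a < b \<Longrightarrow> b < c \<Longrightarrow> c < d \<Longrightarrow> u b < u a \<Longrightarrow> u a < u d \<Longrightarrow> u d < u c \<Longrightarrow> False"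
  unfolding vexillary_def by blast

locale nondominant_vexillary = nondominant_perm +
  assumes vex: "vexillary u"
begin

definition r :: nat where "r = Max {l. 1 \<le> l \<and> l < p \<and> u l < u q}"

lemma r: "1 \<le> r" "r < p" "u r < u q"
proof -
  have "r \<in> {l. 1 \<le> l \<and> l < p \<and> u l < u q}"
    unfolding r_def by (rule Max_in) (use q_pattern in auto)
  then show "1 \<le> r" "r < p" "u r < u q" by simp_all
qed

text \<open>\<open>r\<close> is the rightmost admissible position and also carries the largest
  admissible entry: a larger entry at \<open>l < r\<close> would make \<open>l\<close>,
  \<open>r\<close>, \<open>p\<close>, \<open>q\<close> a pattern 2143. So \<open>r\<close> obstructs
  every other cover from the left.\<close>

lemma r_max:
  assumes "1 \<le> l" "l < p" "u l < u q"
  shows "l \<le> r \<and> u l \<le> u r"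
proof
  show lr: "l \<le> r" unfolding r_def by (rule Max_ge) (use assms in auto)
  show "u l \<le> u r"
  proof (rule ccontr)
    assume "\<not> u l \<le> u r"
    then have "u r < u l" "l < r" using lr by (auto simp: le_less)
    then show False using vexillaryD[OF vex assms(1), of r p q] r pq assms(3) by simp
  qed
qed

lemma v_before: "l < p \<Longrightarrow> v l = u l"
  using pq(2) by (intro v_apply(3)) auto

lemma I_set_singleton: "I_set v p = {r}"
proof -
  have "i = r" if i: "1 \<le> i" "i < p" "cov v i p" for i
  proof (rule ccontr)
    assume "i \<noteq> r"
    have iq: "u i < u q" using i(2,3) v_before[of i] v_apply(1) by (simp add: cov_def)
    with r_max[OF i(1,2)] have "i < r" "u i \<le> u r" using \<open>i \<noteq> r\<close> by auto
    moreover have "u i \<noteq> u r" using inj_u \<open>i \<noteq> r\<close> by simp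
    ultimately have "v i < v r" "v r < v p" using v_before[of i] v_before[of r] i(2) r v_apply(1) by auto
    then show False using i(3) \<open>i < r\<close> r(2) unfolding cov_def by blast
  qed
  then show ?thesis using I_set_v_ne unfolding I_set_v by blast
qed

definition x :: "nat \<Rightarrow> nat" where "x = swap_pos v r p"

lemma child_labels_singleton: "child_labels u = {x}"
  by (simp add: child_labels_eq I_set_singleton x_def)

lemma x_apply: "x l = (if l = r then u q else if l = p then u r else if l = q then u p else u l)"
  unfolding x_def using I_set_singleton by (intro child_apply) simp

lemma x_simps: "x r = u q" "x p = u r" "x q = u p" "l \<noteq> r \<Longrightarrow> l \<noteq> p \<Longrightarrow> l \<noteq> q \<Longrightarrow> x l = u l"
  using r pq by (simp_all add: x_apply)

lemma r_max': "1 \<le> l \<Longrightarrow> l < p \<Longrightarrow> u l < u q \<Longrightarrow> r < l \<Longrightarrow> False"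
  using r_max[of l] by simp

text \<open>A pattern 132 of \<open>x\<close> with its top beyond \<open>p\<close> contradicts the
  maximality of \<open>p\<close> or of \<open>q\<close> in \<open>u\<close>. It will be applied to
  the last three entries of a pattern 2143.\<close>

lemma x_pattern_le:
  assumes "1 \<le> b" "b < c" "c < d" "x b < x d" "x d < x c"
  shows "c \<le> p"
proof (rule ccontr)
  assume "\<not> c \<le> p"
  then have pc: "p < c" by simp
  have d: "d \<noteq> r" "d \<noteq> p" "c \<noteq> r" "c \<noteq> p" using pc assms r pq by auto
  show False
  proof (cases "d = q")
    case True
    then have "x c = u c" using d assms by (intro x_simps(4)) auto
    then show False using between_p_q[OF pc] assms True pq x_simps(3) by simp
  next
    case False
    then have xd: "x d = u d" using d by (intro x_simps(4))
    show False
    proof (cases "c = q")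
      case True
      then have dp: "u d < u p" "q < d" using assms xd x_simps(3) by auto
      have less: "u d < u l" if "1 \<le> l" "l < p" for l using after_q[OF dp(2,1) that] .
      have "u d < u r" using less r by simp
      consider "b = r" | "b = p" | "b < p" "b \<noteq> r" | "p < b" "b < q" using assms True by linarith
      then show False
      proof cases
        case 4
        then have "x b = u b" using r by (intro x_simps(4)) auto
        then show False
          using p_max[of b q d] 4 dp \<open>u d < u r\<close> r assms xd pq by simp
      next
        case 3
        then have "x b = u b" using pq by (intro x_simps(4)) auto
        then show False using less[of b] assms 3 xd by simp
      qed (use \<open>u d < u r\<close> r assms xd x_simps in auto)
    next
      case False
      then have xc: "x c = u c" using d by (intro x_simps(4))
      have no: "\<not> u l < u d" if "1 \<le> l" "l < c" for l
        using p_max[of l c d] that assms xd xc pc by auto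
      have "\<not> u r < u d" "\<not> u p < u d" using no r pc pq by auto
      then show False
        using no[of b] assms xd r pq x_apply[of b] by (auto split: if_splits)
    qed
  qed
qed

text \<open>Passing to \<open>x\<close> moves only the entries at \<open>r\<close>,
  \<open>p\<close>, \<open>q\<close>. In each case a pattern 2143 of \<open>x\<close> becomes one of
  \<open>u\<close> after exchanging some of these positions, or it has an entry between
  \<open>r\<close> and \<open>p\<close> that contradicts the choice of \<open>r\<close>.\<close>

lemma vexillary_x: "vexillary x"
proof (rule ccontr)
  assume "\<not> vexillary x"
  then obtain a b c d where abcd: "1 \<le> a" "a < b" "b < c" "c < d" and
    vals: "x b < x a" "x a < x d" "x d < x c"
    unfolding vexillary_def by blast
  note no = vexillaryD[OF vex abcd(1)]
  have "c \<le> p" using x_pattern_le[of b c d] abcd vals by auto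
  have apq: "a \<noteq> p" "b \<noteq> p" "a \<noteq> q" "b \<noteq> q" "c \<noteq> q" using \<open>c \<le> p\<close> abcd pq by auto
  show False
  proof (cases "c = p")
    case True
    then have xd: "x d < u r" using vals x_simps by simp
    have "a \<noteq> r" "b \<noteq> r" using vals xd r x_simps by auto
    then have ab: "x a = u a" "x b = u b" using apq by (auto intro: x_simps(4))
    have "d \<noteq> q" using xd x_simps r pq by auto
    then have "x d = u d" using True abcd r by (intro x_simps(4)) auto
    then show False using no[of b p d] abcd True vals ab xd r pq by simp
  next
    case False
    then have cp: "c < p" using \<open>c \<le> p\<close> by simp
    show False
    proof (cases "c = r")
      case True
      then have ab: "x a = u a" "x b = u b" using apq abcd by (auto intro!: x_simps(4))
      have xd: "x d < u q" using vals True x_simps by simp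
      then have "d \<noteq> q" using x_simps pq by auto
      show False
      proof (cases "d = p")
        case True
        then show False using no[of b p q] abcd vals ab xd r pq x_simps by simp
      next
        case False
        then have xd': "x d = u d" using \<open>d \<noteq> q\<close> True abcd by (intro x_simps(4)) auto
        have "p < d"
          using r_max'[of d] xd xd' True abcd False r by (cases "d < p") auto
        then show False using no[of b p d] abcd vals ab xd xd' cp pq by simp
      qed
    next
      case False
      then have xc: "x c = u c" using cp pq by (intro x_simps(4)) auto
      consider "a = r" | "b = r" | "a \<noteq> r" "b \<noteq> r" by blast
      then show False
      proof cases
        case 1
        then have "x b = u b" using apq abcd by (auto intro!: x_simps(4))
        then show False using r_max'[of b] 1 vals abcd cp x_simps by simp
      next
        case 2
        then have a: "x a = u a" using apq abcd by (auto intro!: x_simps(4))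
        have xb: "x b = u q" using 2 x_simps by simp
        have "d \<noteq> r" using 2 abcd by simp
        have "d \<noteq> p" using vals a xb r x_simps by auto
        show False
        proof (cases "d = q")
          case True
          then show False using no[of r c p] 2 abcd vals a xb xc cp r x_simps by simp
        next
          case False
          then have "x d = u d" using \<open>d \<noteq> p\<close> \<open>d \<noteq> r\<close> by (intro x_simps(4))
          then show False using no[of r c d] 2 abcd vals a xb xc r by simp
        qed
      next
        case 3
        then have ab: "x a = u a" "x b = u b" using apq by (auto intro: x_simps(4))
        consider "d = r" | "d = p" | "d = q" | "d \<noteq> r" "d \<noteq> p" "d \<noteq> q" by blast
        then show False
        proof cases
          case 1
          then show False using no[of b c q] abcd vals ab xc cp pq x_simps by simp
        next
          case 2
          then have "x d = u r" using x_simps by simp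
          show False
          proof (cases "c < r")
            case True
            then show False using no[of b c r] abcd vals ab xc \<open>x d = u r\<close> by simp
          next
            case F: False
            then have "\<not> u c < u q" using r_max'[of c] abcd cp False by auto
            moreover have "u c \<noteq> u q" using inj_u apq by simp
            ultimately have "u q < u c" by simp
            then show False using no[of b c q] abcd vals ab \<open>x d = u r\<close> cp pq r by simp
          qed
        next
          case 3
          then show False using no[of b c p] abcd vals ab xc cp x_simps by simp
        next
          case 4
          then have "x d = u d" by (intro x_simps(4))
          then show False using no[of b c d] abcd vals ab xc by simp
        qed
      qed
    qed
  qed
qed

text \<open>To the left of \<open>r\<close> the entries further right are only rearranged. Between
  \<open>r\<close> and \<open>p\<close> the entry exceeds \<open>u q\<close>: in \<open>u\<close>
  position \<open>q\<close> always counts and \<open>p\<close> only if \<open>u p < u l\<close>,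
  while in \<open>x\<close> the two exchange these roles.\<close>

lemma code_x_before:
  assumes "1 \<le> l" "l < p" "l \<noteq> r"
  shows "code n x l = code n u l"
proof -
  have xl: "x l = u l" using assms pq by (intro x_simps(4)) auto
  show ?thesis
  proof (cases "l < r")
    case True
    define s where "s = transpose p q \<circ> transpose r p"
    have s: "s permutes {l<..n}"
      unfolding s_def using True r pq by (intro permutes_compose permutes_swap_id) auto
    have xs: "x j = u (s j)" for j
      using r pq by (auto simp: x_apply s_def transpose_def)
    have "{j. l < j \<and> j \<le> n \<and> x j < x l} = {j \<in> {l<..n}. u (s j) < u l}"
      unfolding xl unfolding xs by auto
    moreover have "bij_betw s {j \<in> {l<..n}. u (s j) < u l} {j \<in> {l<..n}. u j < u l}"
      unfolding bij_betw_def
    proof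
      show "s ` {j \<in> {l<..n}. u (s j) < u l} = {j \<in> {l<..n}. u j < u l}"
      proof (intro equalityI subsetI)
        fix j assume "j \<in> {j \<in> {l<..n}. u j < u l}"
        moreover then have "j \<in> s ` {l<..n}" using permutes_image[OF s] by simp
        ultimately show "j \<in> s ` {j \<in> {l<..n}. u (s j) < u l}" by blast
      next
        fix j assume "j \<in> s ` {j \<in> {l<..n}. u (s j) < u l}"
        then show "j \<in> {j \<in> {l<..n}. u j < u l}" using permutes_in_image[OF s] by blast
      qed
    qed (use permutes_inj[OF s] in \<open>auto simp: inj_on_def inj_def\<close>)
    ultimately have "card {j. l < j \<and> j \<le> n \<and> x j < x l} = card {j \<in> {l<..n}. u j < u l}"
      using bij_betw_same_card by simp
    moreover have "{j \<in> {l<..n}. u j < u l} = {j. l < j \<and> j \<le> n \<and> u j < u l}" by auto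
    ultimately show ?thesis by (simp add: code_def)
  next
    case False
    then have lr: "r < l" using assms by simp
    then have "\<not> u l < u q" using r_max'[of l] assms by auto
    moreover have "u l \<noteq> u q" using inj_u assms pq by simp
    ultimately have ql: "u q < u l" by simp
    define X where "X = {j. l < j \<and> j \<le> n \<and> u j < u l \<and> j \<noteq> p \<and> j \<noteq> q}"
    have fin: "finite X" by (simp add: X_def)
    have o: "x j = u j" if "j \<noteq> p" "j \<noteq> q" "l < j" for j
      using that lr by (intro x_simps(4)) auto
    have 1: "{j. l < j \<and> j \<le> n \<and> x j < x l} = insert p (if u p < u l then insert q X else X)"
    proof (rule set_eqI)
      fix j
      show "j \<in> {j. l < j \<and> j \<le> n \<and> x j < x l} \<longleftrightarrow> j \<in> insert p (if u p < u l then insert q X else X)"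
        using xl ql r pq assms x_simps(2,3) o[of j]
        by (cases "j = p"; cases "j = q") (auto simp: X_def)
    qed
    have 2: "{j. l < j \<and> j \<le> n \<and> u j < u l} = insert q (if u p < u l then insert p X else X)"
    proof (rule set_eqI)
      fix j
      show "j \<in> {j. l < j \<and> j \<le> n \<and> u j < u l} \<longleftrightarrow> j \<in> insert q (if u p < u l then insert p X else X)"
        using ql r pq assms
        by (cases "j = p"; cases "j = q") (auto simp: X_def)
    qed
    have "p \<notin> X" "q \<notin> X" "p \<noteq> q" using pq by (auto simp: X_def)
    then show ?thesis unfolding code_def 1 2 using fin by simp
  qed
qed

text \<open>Between \<open>p\<close> and \<open>q\<close> all entries are below \<open>u q\<close>;
  after \<open>q\<close> those below \<open>u p\<close> are even below \<open>u r\<close>.\<close>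

lemma after_p_less: "p < l \<Longrightarrow> l \<noteq> q \<Longrightarrow> u l < u p \<longleftrightarrow> u l < u q"
proof -
  assume l: "p < l" "l \<noteq> q"
  show "u l < u p \<longleftrightarrow> u l < u q"
  proof (cases "l < q")
    case True
    then show ?thesis using between_p_q[OF l(1)] pq by simp
  next
    case False
    then show ?thesis using after_q[of l r] l r pq by auto
  qed
qed

lemma code_x_after:
  assumes "p < l"
  shows "code n x l = code n u l"
proof (cases "l < q")
  case True
  have o: "x j = u j" if "j \<noteq> q" "p < j" for j
    using that r by (intro x_simps(4)) auto
  have "x l = u l" "u l < u q" using True assms o between_p_q by auto
  then have "x j < x l \<longleftrightarrow> u j < u l" if "l < j" for j
    using o[of j] that assms pq x_simps(3) by (cases "j = q") auto
  then show ?thesis by (simp add: code_def cong: conj_cong)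
next
  case False
  have o: "x j = u j" if "q < j" for j
    using that r pq by (intro x_simps(4)) auto
  show ?thesis
  proof (cases "l = q")
    case True
    have "x j < x l \<longleftrightarrow> u j < u l" if "l < j" for j
      using o[of j] after_p_less[of j] that True x_simps(3) pq by auto
    then show ?thesis by (simp add: code_def cong: conj_cong)
  next
    case False
    then have "q < l" using \<open>\<not> l < q\<close> by simp
    then show ?thesis using o by (simp add: code_def cong: conj_cong)
  qed
qed

text \<open>By the choice of \<open>r\<close> nothing between \<open>r\<close> and \<open>p\<close>
  is below \<open>u q\<close>. Beyond that, position \<open>p\<close> counts in \<open>x\<close> in
  place of \<open>q\<close> in \<open>u\<close>, and the other entries agree by
  \<open>after_p_less\<close>.\<close>

lemma code_x_r: "code n x r = code n u p"
proof -
  define X where "X = {j. p < j \<and> j \<le> n \<and> j \<noteq> q \<and> u j < u q}"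
  have fin: "finite X" by (simp add: X_def)
  have 1: "{j. r < j \<and> j \<le> n \<and> x j < x r} = insert p X"
  proof (rule set_eqI)
    fix j
    consider "j = p" | "j = q" | "j = r" | "j < p" "j \<noteq> r" | "p < j" "j \<noteq> q" by linarith
    then show "j \<in> {j. r < j \<and> j \<le> n \<and> x j < x r} \<longleftrightarrow> j \<in> insert p X"
    proof cases
      case 4
      then have "x j = u j" using pq by (intro x_simps(4)) auto
      then show ?thesis using r_max'[of j] 4 x_simps(1) r by (auto simp: X_def)
    next
      case 5
      then have "x j = u j" using r by (intro x_simps(4)) auto
      then show ?thesis using 5 x_simps(1) r by (auto simp: X_def)
    qed (use r pq x_simps in \<open>auto simp: X_def\<close>)
  qed
  have 2: "{j. p < j \<and> j \<le> n \<and> u j < u p} = insert q X"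
  proof (rule set_eqI)
    fix j
    show "j \<in> {j. p < j \<and> j \<le> n \<and> u j < u p} \<longleftrightarrow> j \<in> insert q X"
      using after_p_less[of j] pq by (cases "j = q") (auto simp: X_def)
  qed
  show ?thesis unfolding code_def 1 2 using fin by (simp add: X_def)
qed

text \<open>Entries between \<open>r\<close> and \<open>p\<close> exceed \<open>u q\<close> and
  hence \<open>u r\<close>, and neither \<open>u p\<close> nor \<open>u q\<close> lies below
  \<open>u r\<close>.\<close>

lemma code_x_p: "code n x p = code n u r"
proof -
  have "(p < j \<and> x j < x p) \<longleftrightarrow> (r < j \<and> u j < u r)" for j
  proof -
    consider "j = p" | "j = q" | "j = r" | "j < p" "j \<noteq> r" | "p < j" "j \<noteq> q" by linarith
    then show ?thesis
    proof cases
      case 4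
      then show ?thesis using r_max'[of j] r by auto
    next
      case 5
      then have "x j = u j" using r by (intro x_simps(4)) auto
      then show ?thesis using 5 x_simps(2) r by auto
    qed (use r pq x_simps in auto)
  qed
  then have "{j. p < j \<and> j \<le> n \<and> x j < x p} = {j. r < j \<and> j \<le> n \<and> u j < u r}" by blast
  then show ?thesis by (simp add: code_def)
qed

lemma mset_lehmer_code_x: "mset (lehmer_code n x) = mset (lehmer_code n u)"
proof -
  have t: "transpose r p permutes {1..n}" using r pq by (intro permutes_swap_id) auto
  have "code n x l = code n u (transpose r p l)" if "l \<in> {1..n}" for l
  proof -
    consider "l = r" | "l = p" | "l < p" "l \<noteq> r" | "p < l" by linarith
    then show ?thesis
      using code_x_before[of l] code_x_after[of l] code_x_r code_x_p that r
      by cases (auto simp: transpose_def)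
  qed
  then have "image_mset (code n u) (mset_set {1..n}) = image_mset (code n x) (mset_set {1..n})"
    by (intro permutes_implies_image_mset_eq[OF t]) auto
  moreover have "mset [1..<n + 1] = mset_set {1..n}"
    by (metis Suc_eq_plus1 atLeastLessThanSuc_atLeastAtMost mset_upt)
  ultimately show ?thesis by (simp only: lehmer_code_eq mset_map)
qed

end

lemma vexillary_path:
  assumes "u permutes {1..n}" "vexillary u"
  shows "\<exists>x. x permutes {1..n} \<and> dominant x \<and> mset (lehmer_code n x) = mset (lehmer_code n u) \<and>
    stanley n x = stanley n u"
  using assms
proof (induction rule: tree_induct)
  case (step u)
  show ?case
  proof (cases "dominant u")
    case True
    then show ?thesis using step by blast
  next
    case False
    then interpret nondominant_vexillary n u using step by unfold_locales
    have x: "x \<in> child_labels u" by (simp add: child_labels_singleton)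
    have "stanley n u = stanley n x"
      by (rule ext) (simp add: stanley_children child_labels_singleton)
    then show ?thesis using step.IH[OF x vexillary_x] mset_lehmer_code_x by simp
  qed
qed

text \<open>A position counted for \<open>i + 1\<close> but not for \<open>i\<close> would complete
  a pattern 132 with \<open>i\<close> and \<open>i + 1\<close>.\<close>

lemma dominant_code_antimono:
  assumes "u permutes {1..n}" "dominant u"
  shows "sorted_wrt (\<ge>) (lehmer_code n u)"
proof -
  have step: "code n u (Suc i) \<le> code n u i" if "1 \<le> i" for i
  proof -
    have "j \<in> {j. i < j \<and> j \<le> n \<and> u j < u i}" if "j \<in> {j. Suc i < j \<and> j \<le> n \<and> u j < u (Suc i)}" for j
    proof (rule ccontr)
      assume "j \<notin> {j. i < j \<and> j \<le> n \<and> u j < u i}"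
      then have "\<not> u j < u i" using that by auto
      moreover have "u j \<noteq> u i" using inj_eq[OF permutes_inj[OF assms(1)], of j i] that by simp
      ultimately have "u i < u j" "u j < u (Suc i)" "Suc i < j" using that by auto
      then show False using assms(2) \<open>1 \<le> i\<close> lessI[of i] unfolding dominant_def by blast
    qed
    then show ?thesis unfolding code_def by (intro card_mono) auto
  qed
  have "code n u j \<le> code n u i" if "1 \<le> i" "i \<le> j" for i j
    using that(2)
  proof (induction rule: dec_induct)
    case (step j)
    then show ?case using \<open>\<And>i. 1 \<le> i \<Longrightarrow> code n u (Suc i) \<le> code n u i\<close>[of j] that by simp
  qed simp
  then show ?thesis
    by (simp add: lehmer_code_eq sorted_wrt_map sorted_wrt_iff_nth_less del: upt_Suc)
qed

lemma lehmer_code_inj: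
  assumes u: "u permutes {1..n}" and w: "w permutes {1..n}" and eq: "lehmer_code n u = lehmer_code n w"
  shows "u = w"
proof
  fix i
  show "u i = w i"
  proof (induction i rule: less_induct)
    case (less i)
    show ?case
    proof (cases "i \<in> {1..n}")
      case False
      then show ?thesis using permutes_not_in[OF u False] permutes_not_in[OF w False] by simp
    next
      case True
      have ceq: "code n u i = code n w i"
        using eq True by (simp add: lehmer_code_eq del: upt_Suc)
      have c: "code n f i = card ({y. y < f i} - f ` {..<i})" if f: "f permutes {1..n}" for f
      proof -
        have "f ` {j. i < j \<and> j \<le> n \<and> f j < f i} = {y. y < f i} - f ` {..<i}"
        proof (intro equalityI subsetI)
          fix y assume "y \<in> f ` {j. i < j \<and> j \<le> n \<and> f j < f i}"
          then show "y \<in> {y. y < f i} - f ` {..<i}"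
            using inj_eq[OF permutes_inj[OF f]] by auto
        next
          fix y assume y: "y \<in> {y. y < f i} - f ` {..<i}"
          obtain j where j: "y = f j" using permutes_surj[OF f] by (auto simp: surj_def)
          have "\<not> j < i" "j \<noteq> i" using y j by auto
          then have "i < j" by simp
          moreover have "j \<le> n"
            using subsetD[OF inversions_finite[OF f], of "(i, j)"] True y j \<open>i < j\<close> by simp
          ultimately show "y \<in> f ` {j. i < j \<and> j \<le> n \<and> f j < f i}" using y j by auto
        qed
        moreover have "card (f ` {j. i < j \<and> j \<le> n \<and> f j < f i}) = code n f i"
          unfolding code_def by (rule card_image) (rule inj_on_subset[OF permutes_inj[OF f]], simp)
        ultimately show ?thesis by simp
      qed
      have img: "u ` {..<i} = w ` {..<i}" using less.IH by auto
      have strict: "card ({y. y < a} - A) < card ({y. y < b} - A)" if "a < b" "a \<notin> A" for a b :: nat and A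
        using that by (intro psubset_card_mono) auto
      have "u i \<notin> u ` {..<i}" "w i \<notin> w ` {..<i}"
        using inj_eq[OF permutes_inj[OF u]] inj_eq[OF permutes_inj[OF w]] by auto
      then show ?thesis
        using strict[of "u i" "w i" "u ` {..<i}"] strict[of "w i" "u i" "u ` {..<i}"] c[OF u] c[OF w] ceq img
        by (cases "u i" "w i" rule: linorder_cases) auto
    qed
  qed
qed

section \<open>Inverse Grassmannian permutations\<close>

text \<open>Semistandard tableaux on an arbitrary set of cells, so that a single box can be removed
  without rewriting a partition.\<close>

definition tableaux :: "(nat \<times> nat) set \<Rightarrow> (nat \<times> nat \<Rightarrow> nat) set" where
  "tableaux D = {T \<in> D \<rightarrow>\<^sub>E {1..}.
     (\<forall>r c c'. c < c' \<and> (r, c) \<in> D \<and> (r, c') \<in> D \<longrightarrow> T (r, c) \<le> T (r, c')) \<and>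
     (\<forall>r r' c. r < r' \<and> (r, c) \<in> D \<and> (r', c) \<in> D \<longrightarrow> T (r, c) < T (r', c))}"

lemma ssyt_eq: "ssyt \<mu> = tableaux (cells \<mu>)"
  by (simp add: ssyt_def tableaux_def)

text \<open>In one-line notation \<open>w\<close> is a shuffle of the increasing sequences
  \<open>1, ..., k\<close> and \<open>k + 1, ..., n\<close>; equivalently, \<open>inv w\<close> has
  no descent except possibly at \<open>k\<close>.\<close>

definition inv_grassmannian :: "nat \<Rightarrow> nat \<Rightarrow> (nat \<Rightarrow> nat) \<Rightarrow> bool" where
  "inv_grassmannian n k w \<longleftrightarrow> w permutes {1..n} \<and> k \<le> n \<and>
     (\<forall>x y. 1 \<le> x \<longrightarrow> x < y \<longrightarrow> y \<le> k \<longrightarrow> inv w x < inv w y) \<and>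
     (\<forall>x y. k < x \<longrightarrow> x < y \<longrightarrow> inv w x < inv w y)"

text \<open>
  The box in row \<open>r\<close> and column \<open>c\<close> stands for the inversion between the values \<open>k + 1 + r\<close> and
  \<open>k - c\<close>.
\<close>

definition shape :: "nat \<Rightarrow> (nat \<Rightarrow> nat) \<Rightarrow> (nat \<times> nat) set" where
  "shape k w = {(r, c). c < k \<and> inv w (k + 1 + r) < inv w (k - c)}"

locale inv_grassmannian_perm =
  fixes n k :: nat and w :: "nat \<Rightarrow> nat"
  assumes inv_grassmannian: "inv_grassmannian n k w"
begin

lemma perm: "w permutes {1..n}" and k_le: "k \<le> n"
  using inv_grassmannian by (auto simp: inv_grassmannian_def)

abbreviation "pos \<equiv> inv w"

lemma small: "0 < x \<Longrightarrow> x < y \<Longrightarrow> y \<le> k \<Longrightarrow> pos x < pos y"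
  and big: "k < x \<Longrightarrow> x < y \<Longrightarrow> pos x < pos y"
  using inv_grassmannian by (auto simp: inv_grassmannian_def)

lemma pos_w [simp]: "pos (w x) = x" and w_pos [simp]: "w (pos x) = x"
  using permutes_inverses[OF perm] by auto

lemma pos_inj [simp]: "pos x = pos y \<longleftrightarrow> x = y"
  by (metis w_pos)

lemma w_inj [simp]: "w x = w y \<longleftrightarrow> x = y"
  by (metis pos_w)

lemma pos_perm: "pos permutes {1..n}"
  using permutes_inv[OF perm] .

lemma inversion_values:
  assumes "1 \<le> i" "i < j" "w j < w i"
  shows "w j \<le> k" "k < w i" "1 \<le> w j" "w i \<le> n" "j \<le> n"
proof -
  have "(i, j) \<in> {1..n} \<times> {1..n}" using inversions_finite[OF perm] assms by blast
  then have ij: "i \<in> {1..n}" "j \<in> {1..n}" by auto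
  then show "1 \<le> w j" "w i \<le> n" "j \<le> n"
    using permutes_in_image[OF perm, of i] permutes_in_image[OF perm, of j] by auto
  have "\<not> w i \<le> k" using small[of "w j" "w i"] assms \<open>1 \<le> w j\<close> by auto
  then show "k < w i" by simp
  show "w j \<le> k" using big[of "w j" "w i"] assms by (cases "w j \<le> k") auto
qed

text \<open>Every inversion pairs a value above \<open>k\<close> with one not above
  \<open>k\<close>. The two inversions of a pattern 2143 would give
  \<open>w d \<le> k < w a\<close>.\<close>

lemma vexillary: "vexillary w"
proof (rule ccontr)
  assume "\<not> vexillary w"
  then obtain a b c d where "1 \<le> a" "a < b" "b < c" "c < d" "w b < w a" "w a < w d" "w d < w c"
    unfolding vexillary_def by blast
  then show False using inversion_values[of a b] inversion_values[of c d] by simp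
qed

lemma shape_mono:
  assumes "(r, c) \<in> shape k w" "r' \<le> r" "c' \<le> c"
  shows "(r', c') \<in> shape k w"
proof -
  have "pos (k + 1 + r') \<le> pos (k + 1 + r)"
    using big[of "k + 1 + r'" "k + 1 + r"] assms(2) by (cases "r' = r") auto
  moreover have "c < k" "pos (k + 1 + r) < pos (k - c)" using assms(1) by (auto simp: shape_def)
  moreover have "pos (k - c) \<le> pos (k - c')"
  proof (cases "c' = c")
    case False
    then have "k - c < k - c'" using assms(3) \<open>c < k\<close> by linarith
    then show ?thesis using small[of "k - c" "k - c'"] \<open>c < k\<close> by simp
  qed simp
  ultimately show ?thesis using assms(3) by (simp add: shape_def)
qed

lemma shape_bounds: "shape k w \<subseteq> {..n} \<times> {..k}"
proof clarify
  fix r c assume rc: "(r, c) \<in> shape k w"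
  have "k + 1 + r \<le> n"
  proof (rule ccontr)
    assume "\<not> k + 1 + r \<le> n"
    then have "pos (k + 1 + r) = k + 1 + r" using permutes_not_in[OF pos_perm] by simp
    moreover have "pos (k - c) \<le> n"
      using rc permutes_in_image[OF pos_perm, of "k - c"] k_le by (auto simp: shape_def)
    ultimately show False using rc \<open>\<not> k + 1 + r \<le> n\<close> by (auto simp: shape_def)
  qed
  then show "r \<in> {..n} \<and> c \<in> {..k}" using rc by (auto simp: shape_def)
qed

lemma finite_shape: "finite (shape k w)"
  using finite_subset[OF shape_bounds] by simp

lemma shape_col_less: "(r, c) \<in> shape k w \<Longrightarrow> c < k"
  by (simp add: shape_def)

text \<open>A position strictly between the two would carry a small value below
  \<open>k - c\<close>, putting the box to the right into the shape, or a value above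
  \<open>k + 1 + r\<close>, doing so for the box below.\<close>

lemma corner_descent:
  assumes "(r, c) \<in> shape k w" "(r + 1, c) \<notin> shape k w" "(r, c + 1) \<notin> shape k w"
  shows "pos (k - c) = Suc (pos (k + 1 + r))"
proof (rule ccontr)
  assume ne: "pos (k - c) \<noteq> Suc (pos (k + 1 + r))"
  have c: "c < k" and lt: "pos (k + 1 + r) < pos (k - c)" using assms(1) by (auto simp: shape_def)
  define i where "i = Suc (pos (k + 1 + r))"
  have i: "pos (k + 1 + r) < i" "i < pos (k - c)" using ne lt by (auto simp: i_def)
  have pw: "pos (w i) = i" by simp
  show False
  proof (cases "w i \<le> k")
    case True
    have "pos (k - c) \<le> n"
      using permutes_in_image[OF pos_perm, of "k - c"] c k_le by auto
    then have "i \<in> {1..n}" using i by auto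
    then have "1 \<le> w i" using permutes_in_image[OF perm, of i] by simp
    then have "\<not> k - c \<le> w i"
      using small[of "k - c" "w i"] i c True pw by (cases "k - c = w i") auto
    then have c1: "c + 1 < k" "w i \<le> k - (c + 1)" using \<open>1 \<le> w i\<close> by auto
    have "i \<le> pos (k - (c + 1))"
      using small[of "w i" "k - (c + 1)"] c1 \<open>1 \<le> w i\<close> pw by (cases "w i = k - (c + 1)") auto
    then have "(r, c + 1) \<in> shape k w" using i c1 by (simp add: shape_def)
    then show False using assms by simp
  next
    case False
    have "\<not> w i \<le> k + 1 + r"
      using big[of "w i" "k + 1 + r"] i False pw by (cases "w i = k + 1 + r") auto
    then have "pos (k + 1 + (r + 1)) \<le> i"
      using big[of "k + 1 + (r + 1)" "w i"] pw by (cases "w i = k + 1 + (r + 1)") auto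
    then have "(r + 1, c) \<in> shape k w" using i c by (simp add: shape_def)
    then show False using assms by simp
  qed
qed

text \<open>The positions up to that of \<open>k + 1 + r\<close> carry exactly the values below
  \<open>k - c\<close> and the values from \<open>k + 1\<close> to \<open>k + 1 + r\<close>; there
  are \<open>k + r - c\<close> of them. So the letter depends only on the diagonal of the
  box.\<close>

lemma letter:
  assumes c: "c < k" and adj: "pos (k - c) = Suc (pos (k + 1 + r))"
  shows "pos (k + 1 + r) = k + r - c"
proof -
  let ?a = "pos (k + 1 + r)"
  have a0: "1 \<le> ?a"
  proof (rule ccontr)
    assume "\<not> 1 \<le> ?a"
    then have "pos (k + 1 + r) = 0" by simp
    moreover have "pos 0 = 0" using permutes_not_in[OF pos_perm, of 0] by simp
    ultimately show False using pos_inj[of "k + 1 + r" 0] by simp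
  qed
  have "{1..?a} = pos ` ({1..<k - c} \<union> {k + 1..k + 1 + r})"
  proof (intro equalityI subsetI)
    fix i assume i: "i \<in> {1..?a}"
    have pw: "pos (w i) = i" by simp
    have wi: "1 \<le> w i"
    proof (rule ccontr)
      assume "\<not> 1 \<le> w i"
      then have "w i = w 0" using permutes_not_in[OF perm, of 0] by simp
      then show False using i by simp
    qed
    have "w i < k - c" if "w i \<le> k"
    proof (rule ccontr)
      assume "\<not> w i < k - c"
      then have "pos (k - c) \<le> i"
        using small[of "k - c" "w i"] c that pw by (cases "w i = k - c") auto
      then show False using adj i by simp
    qed
    moreover have "w i \<le> k + 1 + r" if "k < w i"
    proof (rule ccontr)
      assume "\<not> w i \<le> k + 1 + r"
      then have "?a < i" using big[of "k + 1 + r" "w i"] pw by auto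
      then show False using i by simp
    qed
    ultimately have "w i \<in> {1..<k - c} \<union> {k + 1..k + 1 + r}" using wi by (cases "w i \<le> k") auto
    then show "i \<in> pos ` ({1..<k - c} \<union> {k + 1..k + 1 + r})" using pw by (metis imageI)
  next
    fix i assume "i \<in> pos ` ({1..<k - c} \<union> {k + 1..k + 1 + r})"
    then obtain x where x: "i = pos x" "x \<in> {1..<k - c} \<union> {k + 1..k + 1 + r}" by blast
    have "pos x \<noteq> 0"
    proof
      assume "pos x = 0"
      then have "pos x = pos 0" using permutes_not_in[OF pos_perm, of 0] by simp
      then show False using x by auto
    qed
    moreover have "pos x \<le> ?a"
    proof (cases "x < k - c")
      case True
      then have "pos x < Suc ?a" using small[of x "k - c"] x c adj by auto
      then show ?thesis by simp
    next
      case False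
      then show ?thesis using big[of x "k + 1 + r"] x by (cases "x = k + 1 + r") auto
    qed
    ultimately show "i \<in> {1..?a}" using x by simp
  qed
  then have "card {1..?a} = card ({1..<k - c} \<union> {k + 1..k + 1 + r})"
    by (simp add: card_image inj_on_def)
  also have "\<dots> = card {1..<k - c} + card {k + 1..k + 1 + r}"
    by (rule card_Un_disjoint) auto
  finally show ?thesis using c by simp
qed

end

section \<open>Deleting the last letter removes a corner box\<close>

locale inv_grassmannian_descent = inv_grassmannian_perm +
  fixes a :: nat
  assumes a: "1 \<le> a" "a < n" and desc: "w (Suc a) < w a"
begin

definition row where "row = w a - (k + 1)"
definition col where "col = k - w (Suc a)"
definition w' where "w' = swap_pos w a (Suc a)"

lemma desc_values: "w (Suc a) \<le> k" "k < w a" "1 \<le> w (Suc a)"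
  using inversion_values[of a "Suc a"] a desc by auto

lemma row: "k + 1 + row = w a" and col: "k - col = w (Suc a)" and col_less: "col < k"
  using desc_values by (auto simp: row_def col_def)

lemma letter_a: "k + row - col = a"
  using letter[of col row] col_less unfolding row col by simp

lemma inv_w': "inv w' x = transpose a (Suc a) (pos x)"
proof -
  have "inv w' = transpose a (Suc a) \<circ> pos"
    unfolding w'_def swap_pos_def using permutes_bij[OF perm] by (subst o_inv_distrib) auto
  then show ?thesis by simp
qed

lemma inv_w'_less:
  "\<not> (x = w a \<and> y = w (Suc a)) \<Longrightarrow> \<not> (x = w (Suc a) \<and> y = w a) \<Longrightarrow>
    inv w' x < inv w' y \<longleftrightarrow> pos x < pos y"
proof -
  assume "\<not> (x = w a \<and> y = w (Suc a))" "\<not> (x = w (Suc a) \<and> y = w a)"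
  then have "\<not> (pos x = a \<and> pos y = Suc a)" "\<not> (pos x = Suc a \<and> pos y = a)"
    by (metis w_pos)+
  moreover have "x = y \<or> pos x \<noteq> pos y" by simp
  ultimately show ?thesis unfolding inv_w' by (auto simp: transpose_def simp del: pos_inj)
qed

lemma inv_grassmannian_w': "inv_grassmannian n k w'"
proof -
  have "w' permutes {1..n}" unfolding w'_def using a by (intro swap_pos_permutes[OF perm]) auto
  moreover have "inv w' x < inv w' y" if "1 \<le> x" "x < y" "y \<le> k" for x y
    using small[of x y] inv_w'_less[of x y] that desc_values by auto
  moreover have "inv w' x < inv w' y" if "k < x" "x < y" for x y
    using big[OF that] inv_w'_less[of x y] that desc_values by auto
  ultimately show ?thesis using k_le by (auto simp: inv_grassmannian_def)
qed

lemma box_in_shape: "(row, col) \<in> shape k w"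
  unfolding shape_def using col_less row col by simp

lemma shape_w': "shape k w' = shape k w - {(row, col)}"
proof (rule set_eqI)
  fix z :: "nat \<times> nat"
  obtain r c where z: "z = (r, c)" by (cases z)
  show "z \<in> shape k w' \<longleftrightarrow> z \<in> shape k w - {(row, col)}"
  proof (cases "c < k \<and> k + 1 + r = w a \<and> k - c = w (Suc a)")
    case True
    then have "r = row" "c = col" using row col col_less by auto
    moreover have "\<not> inv w' (w a) < inv w' (w (Suc a))" by (simp add: inv_w')
    ultimately show ?thesis unfolding z shape_def using True by auto
  next
    case False
    then have "(r, c) \<noteq> (row, col) \<or> \<not> c < k" using row col by auto
    moreover have "inv w' (k + 1 + r) < inv w' (k - c) \<longleftrightarrow> pos (k + 1 + r) < pos (k - c)" if "c < k"
    proof (rule inv_w'_less)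
      show "\<not> (k + 1 + r = w (Suc a) \<and> k - c = w a)" using desc_values by auto
    qed (use False that in auto)
    ultimately show ?thesis unfolding z shape_def by auto
  qed
qed

end


section \<open>The common recursion for compatible words and tableaux\<close>

lemma compatible_snoc:
  "compatible (as @ [a]) (bs @ [b]) \<longleftrightarrow>
     1 \<le> b \<and> (\<forall>c\<in>set bs. c \<le> b) \<and> compatible as bs \<and> (as \<noteq> [] \<longrightarrow> last as < a \<longrightarrow> last bs < b)"
proof (cases "length bs = length as")
  case len: True
  have "(\<forall>i. Suc i < length (as @ [a]) \<longrightarrow> (as @ [a]) ! i < (as @ [a]) ! Suc i \<longrightarrow> (bs @ [b]) ! i < (bs @ [b]) ! Suc i) \<longleftrightarrow>
    (as \<noteq> [] \<longrightarrow> last as < a \<longrightarrow> last bs < b) \<and>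
    (\<forall>i. Suc i < length as \<longrightarrow> as ! i < as ! Suc i \<longrightarrow> bs ! i < bs ! Suc i)"
    (is "(\<forall>i. ?P i) \<longleftrightarrow> ?L \<and> (\<forall>i. ?Q i)")
  proof (cases "as = []")
    case True
    then show ?thesis using len by simp
  next
    case False
    then obtain m where m: "length as = Suc m" by (cases as) auto
    have "bs \<noteq> []" using len m by auto
    then have l: "last as = as ! m" "last bs = bs ! m"
      using False m len by (simp_all add: last_conv_nth)
    have "?P i \<longleftrightarrow> ?Q i" if "i \<noteq> m" for i
      using that m len by (auto simp: nth_append)
    moreover have "?P m \<longleftrightarrow> ?L" using m len l False by (auto simp: nth_append)
    moreover have "?Q m" using m by simp
    ultimately show ?thesis by metis
  qed
  then show ?thesis using len unfolding compatible_def by (auto simp: sorted_append)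
qed (auto simp: compatible_def)

text \<open>
  The bound \<open>M\<close> restricts only the letters and boxes that carry the entry \<open>b\<close>. For an upper bound
  \<open>b\<close> of \<open>bs\<close> it is vacuous unless \<open>bs\<close> ends in \<open>b\<close>, so that both sets obey the same recursion.
\<close>

definition word_set :: "nat \<Rightarrow> (nat \<Rightarrow> nat) \<Rightarrow> nat list \<Rightarrow> nat \<Rightarrow> nat \<Rightarrow> nat list set" where
  "word_set n w bs b M =
     {as \<in> reduced_words n w. compatible as bs \<and> (as \<noteq> [] \<longrightarrow> last bs = b \<longrightarrow> M \<le> last as)}"

definition tableau_set :: "nat \<Rightarrow> (nat \<times> nat) set \<Rightarrow> nat list \<Rightarrow> nat \<Rightarrow> nat \<Rightarrow> (nat \<times> nat \<Rightarrow> nat) set" where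
  "tableau_set k D bs b M = {T \<in> tableaux D. image_mset T (mset_set D) = mset bs \<and>
     (\<forall>r c. (r, c) \<in> D \<longrightarrow> T (r, c) = b \<longrightarrow> M \<le> k + r - c)}"

definition descents_from :: "nat \<Rightarrow> (nat \<Rightarrow> nat) \<Rightarrow> nat \<Rightarrow> nat set" where
  "descents_from n w M = {a. 1 \<le> a \<and> a < n \<and> w (Suc a) < w a \<and> M \<le> a}"

text \<open>Under a repeated entry the letters may not increase, so the letter before
  \<open>a\<close> is at least \<open>a\<close>; being reduced makes it at least
  \<open>Suc a\<close>.\<close>

lemma word_set_snoc:
  assumes w: "w permutes {1..n}" and b: "1 \<le> b" "\<forall>x\<in>set bs. x \<le> b"
  shows "word_set n w (bs @ [b]) b M =
    (\<Union>a\<in>descents_from n w M. (\<lambda>as. as @ [a]) ` word_set n (swap_pos w a (Suc a)) bs b (Suc a))"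
proof -
  have key: "cs @ [a] \<in> word_set n w (bs @ [b]) b M \<longleftrightarrow>
      a \<in> descents_from n w M \<and> cs \<in> word_set n (swap_pos w a (Suc a)) bs b (Suc a)" for cs a
  proof (cases "1 \<le> a \<and> a < n \<and> w (Suc a) < w a \<and> cs \<in> reduced_words n (swap_pos w a (Suc a)) \<and> compatible cs bs")
    case False
    then show ?thesis
      by (auto simp: word_set_def descents_from_def reduced_words_snoc[OF w] compatible_snoc)
  next
    case True
    have "(last cs < a \<longrightarrow> last bs < b) \<longleftrightarrow> (last bs = b \<longrightarrow> Suc a \<le> last cs)" if "cs \<noteq> []"
    proof -
      have "bs \<noteq> []" using True that by (auto simp: compatible_def)
      then have "last bs \<le> b" using b(2) by simp
      have v: "swap_pos w a (Suc a) permutes {1..n}" using True by (intro swap_pos_permutes[OF w]) auto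
      have "cs = butlast cs @ [last cs]" using that by simp
      then have "swap_pos w a (Suc a) (Suc (last cs)) < swap_pos w a (Suc a) (last cs)"
        using True reduced_words_snoc[OF v, of "butlast cs" "last cs"] by simp
      then have "last cs \<noteq> a" using True by (auto simp: swap_pos_apply)
      then show ?thesis using \<open>last bs \<le> b\<close> by auto
    qed
    then show ?thesis using True b
      by (auto simp: word_set_def descents_from_def reduced_words_snoc[OF w] compatible_snoc)
  qed
  have "[] \<notin> word_set n w (bs @ [b]) b M" by (simp add: word_set_def compatible_def)
  then have "as \<in> word_set n w (bs @ [b]) b M \<longleftrightarrow> as \<in> (\<Union>a\<in>descents_from n w M.
      (\<lambda>as. as @ [a]) ` word_set n (swap_pos w a (Suc a)) bs b (Suc a))" for as
    using key by (cases as rule: rev_cases) auto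
  then show ?thesis by blast
qed

lemma tableau_set_values:
  assumes "T \<in> tableau_set k D bs b M" "finite D" "x \<in> D"
  shows "T x \<in> set bs"
proof -
  have "T x \<in># image_mset T (mset_set D)" using assms(2,3) by simp
  moreover have "image_mset T (mset_set D) = mset bs" using assms(1) by (simp add: tableau_set_def)
  ultimately show ?thesis by (simp only: set_mset_mset)
qed

context inv_grassmannian_descent
begin

lemma inv_grassmannian_perm_w': "inv_grassmannian_perm n k w'"
  using inv_grassmannian_w' by unfold_locales

lemma finite_shape_w': "finite (shape k w')"
  using finite_shape by (simp add: shape_w')

text \<open>The new bound \<open>Suc a\<close> supplies column strictness: an entry \<open>b\<close>
  above the new box would have a letter smaller than \<open>a\<close>.\<close>

lemma extend_tableau:
  assumes T: "T \<in> tableau_set k (shape k w') bs b (Suc a)" and b: "1 \<le> b" "\<forall>x\<in>set bs. x \<le> b" and M: "M \<le> a"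
  shows "T((row, col) := b) \<in> tableau_set k (shape k w) (bs @ [b]) b M"
proof -
  let ?S = "T((row, col) := b)"
  have D: "shape k w = insert (row, col) (shape k w')" and nin: "(row, col) \<notin> shape k w'"
    using box_in_shape by (auto simp: shape_w')
  have Tt: "T \<in> tableaux (shape k w')" using T by (simp add: tableau_set_def)
  have le: "T x \<le> b" if "x \<in> shape k w'" for x
    using tableau_set_values[OF T finite_shape_w' that] b by blast
  have noright: "(row, c) \<notin> shape k w'" if "col < c" for c
    using inv_grassmannian_perm.shape_mono[OF inv_grassmannian_perm_w', of row c row col] nin that by auto
  have nobelow: "(r, col) \<notin> shape k w'" if "row < r" for r
    using inv_grassmannian_perm.shape_mono[OF inv_grassmannian_perm_w', of r col row col] nin that by auto
  have above: "T (r, col) < b" if "(r, col) \<in> shape k w'" "r < row" for r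
  proof -
    have "T (r, col) \<noteq> b"
    proof
      assume "T (r, col) = b"
      then have "Suc a \<le> k + r - col" using T that by (auto simp: tableau_set_def)
      then show False using that letter_a by simp
    qed
    then show ?thesis using le[OF that(1)] by simp
  qed
  have Trow: "T (r, c) \<le> T (r, c')" if "c < c'" "(r, c) \<in> shape k w'" "(r, c') \<in> shape k w'" for r c c'
    using Tt that by (simp add: tableaux_def)
  have Tcol: "T (r, c) < T (r', c)" if "r < r'" "(r, c) \<in> shape k w'" "(r', c) \<in> shape k w'" for r r' c
    using Tt that by (simp add: tableaux_def)
  have "?S \<in> tableaux (shape k w)"
    unfolding tableaux_def
  proof (intro CollectI conjI allI impI)
    show "?S \<in> shape k w \<rightarrow>\<^sub>E {1..}"
      unfolding D using Tt b(1) by (intro PiE_fun_upd) (auto simp: tableaux_def)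
  next
    fix r c c' assume h: "c < c' \<and> (r, c) \<in> shape k w \<and> (r, c') \<in> shape k w"
    then have "(r, c) \<noteq> (row, col)" using noright[of c'] by (auto simp: D)
    then show "?S (r, c) \<le> ?S (r, c')" using h Trow[of c c' r] le[of "(r, c)"] by (auto simp: D)
  next
    fix r r' c assume h: "r < r' \<and> (r, c) \<in> shape k w \<and> (r', c) \<in> shape k w"
    then have "(r, c) \<noteq> (row, col)" using nobelow[of r'] by (auto simp: D)
    then show "?S (r, c) < ?S (r', c)" using h Tcol[of r r' c] above[of r] by (auto simp: D)
  qed
  moreover have "image_mset ?S (mset_set (shape k w)) = mset (bs @ [b])"
  proof -
    have "image_mset ?S (mset_set (shape k w')) = image_mset T (mset_set (shape k w'))"
      by (rule image_mset_cong) (use nin finite_shape_w' in auto)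
    then show ?thesis using T nin finite_shape_w' by (simp add: D tableau_set_def)
  qed
  moreover have "M \<le> k + r - c" if "(r, c) \<in> shape k w" "?S (r, c) = b" for r c
  proof (cases "(r, c) = (row, col)")
    case True
    then show ?thesis using letter_a M by simp
  next
    case False
    then have "(r, c) \<in> shape k w'" "T (r, c) = b" using that by (auto simp: D)
    then have "Suc a \<le> k + r - c" using T by (auto simp: tableau_set_def)
    then show ?thesis using M by simp
  qed
  ultimately show ?thesis by (simp add: tableau_set_def)
qed

text \<open>Entries increase strictly towards the south-east, so no second box with entry
  \<open>b\<close> lies on the diagonal of the removed one; this improves the bound from
  \<open>a\<close> to \<open>Suc a\<close>. The value \<open>undefined\<close> keeps the function
  extensional.\<close>

lemma restrict_tableau:
  assumes T: "T \<in> tableau_set k (shape k w) (bs @ [b]) b M" and box: "T (row, col) = b"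
    and min: "\<And>r c. (r, c) \<in> shape k w \<Longrightarrow> T (r, c) = b \<Longrightarrow> a \<le> k + r - c"
  shows "T((row, col) := undefined) \<in> tableau_set k (shape k w') bs b (Suc a)"
proof -
  let ?S = "T((row, col) := undefined)"
  have D: "shape k w = insert (row, col) (shape k w')" and nin: "(row, col) \<notin> shape k w'"
    using box_in_shape by (auto simp: shape_w')
  have Tt: "T \<in> tableaux (shape k w)" using T by (simp add: tableau_set_def)
  have Trow: "T (r, c) \<le> T (r, c')" if "c < c'" "(r, c) \<in> shape k w" "(r, c') \<in> shape k w" for r c c'
    using Tt that by (simp add: tableaux_def)
  have Tcol: "T (r, c) < T (r', c)" if "r < r'" "(r, c) \<in> shape k w" "(r', c) \<in> shape k w" for r r' c
    using Tt that by (simp add: tableaux_def)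
  have diag: "T (r, c) < T (r', c')" if "r < r'" "c < c'" "(r', c') \<in> shape k w" for r c r' c'
    using Tcol[of r r' c] Trow[of c c' r'] shape_mono[OF that(3), of r c] shape_mono[OF that(3), of r' c] that
    by auto
  have S: "?S x = T x" if "x \<in> shape k w'" for x using that nin by auto
  have TE: "T \<in> shape k w \<rightarrow>\<^sub>E {1..}" using Tt by (simp add: tableaux_def)
  have "?S \<in> shape k w' \<rightarrow>\<^sub>E {1..}"
  proof (rule PiE_I)
    fix x assume "x \<in> shape k w'"
    then show "?S x \<in> {1..}" using S[of x] PiE_mem[OF TE, of x] by (simp add: D)
  next
    fix x assume "x \<notin> shape k w'"
    then show "?S x = undefined" using PiE_arb[OF TE, of x] by (auto simp: D)
  qed
  then have "?S \<in> tableaux (shape k w')"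
    unfolding tableaux_def
  proof (intro CollectI conjI allI impI)
    fix r c c' assume h: "c < c' \<and> (r, c) \<in> shape k w' \<and> (r, c') \<in> shape k w'"
    then show "?S (r, c) \<le> ?S (r, c')"
      using S[of "(r, c)"] S[of "(r, c')"] Trow[of c c' r] unfolding D by simp
  next
    fix r r' c assume h: "r < r' \<and> (r, c) \<in> shape k w' \<and> (r', c) \<in> shape k w'"
    then show "?S (r, c) < ?S (r', c)"
      using S[of "(r, c)"] S[of "(r', c)"] Tcol[of r r' c] unfolding D by simp
  qed
  moreover have "image_mset ?S (mset_set (shape k w')) = mset bs"
  proof -
    have "image_mset ?S (mset_set (shape k w')) = image_mset T (mset_set (shape k w'))"
      by (rule image_mset_cong) (use nin finite_shape_w' in auto)
    moreover have "image_mset T (mset_set (shape k w)) = add_mset b (image_mset T (mset_set (shape k w')))"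
      using nin finite_shape_w' box by (simp add: D)
    ultimately show ?thesis using T by (simp add: tableau_set_def)
  qed
  moreover have "Suc a \<le> k + r - c" if "(r, c) \<in> shape k w'" "?S (r, c) = b" for r c
  proof -
    have rc: "(r, c) \<in> shape k w" "T (r, c) = b" using that S by (auto simp: D)
    have "k + r - c \<noteq> a"
    proof
      assume "k + r - c = a"
      then have eq: "k + r - c = k + row - col" using letter_a by simp
      \<comment> \<open>Neither subtraction is truncated, so equal letters mean equal
        diagonals.\<close>
      have "c < k" "col < k" using shape_col_less[OF rc(1)] col_less by auto
      then consider "r < row \<and> c < col" | "row < r \<and> col < c" | "(r, c) = (row, col)"
        using eq by (cases r row rule: linorder_cases) auto
      then show False
        using diag[of r row c col] diag[of row r col c] rc box box_in_shape that nin by cases auto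
    qed
    then show ?thesis using min[OF rc] by simp
  qed
  ultimately show ?thesis by (simp add: tableau_set_def)
qed

end

context inv_grassmannian_perm
begin

lemma descent_locale:
  assumes "a \<in> descents_from n w M"
  shows "inv_grassmannian_descent n k w a"
proof -
  have "1 \<le> a" "a < n" "w (Suc a) < w a" using assms by (simp_all add: descents_from_def)
  then show ?thesis by unfold_locales
qed

text \<open>The locale constants \<open>row\<close> and \<open>col\<close> belong to one fixed
  descent; this version may vary with \<open>a\<close> inside a union.\<close>

definition box :: "nat \<Rightarrow> nat \<times> nat" where
  "box a = (w a - (k + 1), k - w (Suc a))"

lemma box_eq:
  assumes "a \<in> descents_from n w M"
  shows "box a = (inv_grassmannian_descent.row k w a, inv_grassmannian_descent.col k w a)"
    "swap_pos w a (Suc a) = inv_grassmannian_descent.w' w a"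
  using descent_locale[OF assms]
  by (simp_all add: box_def inv_grassmannian_descent.row_def inv_grassmannian_descent.col_def
      inv_grassmannian_descent.w'_def)

lemma tableau_set_snoc:
  assumes b: "1 \<le> b" "\<forall>x\<in>set bs. x \<le> b"
  shows "tableau_set k (shape k w) (bs @ [b]) b M =
    (\<Union>a\<in>descents_from n w M. (\<lambda>T. T(box a := b)) ` tableau_set k (shape k (swap_pos w a (Suc a))) bs b (Suc a))"
    (is "?L = ?R")
proof (intro equalityI subsetI)
  fix T assume "T \<in> ?R"
  then obtain d S where d: "d \<in> descents_from n w M"
    and S: "S \<in> tableau_set k (shape k (swap_pos w d (Suc d))) bs b (Suc d)" "T = S(box d := b)" by blast
  have "M \<le> d" using d by (simp add: descents_from_def)
  interpret inv_grassmannian_descent n k w d using descent_locale[OF d] .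
  show "T \<in> ?L" using extend_tableau[OF _ b \<open>M \<le> d\<close>] S unfolding box_eq[OF d] by blast
next
  fix T assume T: "T \<in> ?L"
  have Tt: "T \<in> tableaux (shape k w)" using T by (simp add: tableau_set_def)
  define B where "B = {(r, c). (r, c) \<in> shape k w \<and> T (r, c) = b}"
  have "image_mset T (mset_set (shape k w)) = mset (bs @ [b])" using T by (simp add: tableau_set_def)
  then have "b \<in># image_mset T (mset_set (shape k w))" by simp
  then obtain r0 c0 where "(r0, c0) \<in> B" using finite_shape by (auto simp: B_def)
  \<comment> \<open>The box with entry \<open>b\<close> and smallest letter is a corner: the entry
    below would exceed the maximum \<open>b\<close>, and a right neighbour would also contain
    \<open>b\<close>, with a smaller letter.\<close>
  define a where "a = (LEAST a. \<exists>r c. (r, c) \<in> B \<and> a = k + r - c)"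
  have "\<exists>r c. (r, c) \<in> B \<and> a = k + r - c"
    unfolding a_def by (rule LeastI_ex) (use \<open>(r0, c0) \<in> B\<close> in blast)
  then obtain r c where rc: "(r, c) \<in> shape k w" "T (r, c) = b" and arc: "a = k + r - c"
    by (auto simp: B_def)
  have min: "a \<le> k + r' - c'" if "(r', c') \<in> shape k w" "T (r', c') = b" for r' c'
    unfolding a_def by (rule Least_le) (use that in \<open>auto simp: B_def\<close>)
  have le: "T x \<le> b" if "x \<in> shape k w" for x
    using tableau_set_values[OF T finite_shape that] b by auto
  have "(r + 1, c) \<notin> shape k w"
  proof
    assume h: "(r + 1, c) \<in> shape k w"
    then have "T (r, c) < T (r + 1, c)" using Tt rc(1) by (simp add: tableaux_def)
    then show False using le[OF h] rc(2) by simp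
  qed
  moreover have "(r, c + 1) \<notin> shape k w"
  proof
    assume h: "(r, c + 1) \<in> shape k w"
    then have "T (r, c) \<le> T (r, c + 1)" using Tt rc(1) by (simp add: tableaux_def)
    then have "T (r, c + 1) = b" using le[OF h] rc(2) by simp
    then show False using min[OF h] arc shape_col_less[OF rc(1)] by simp
  qed
  ultimately have adj: "pos (k - c) = Suc (pos (k + 1 + r))" using corner_descent[OF rc(1)] by simp
  have c: "c < k" using shape_col_less[OF rc(1)] .
  have pa: "pos (k + 1 + r) = a" using letter[OF c adj] arc by simp
  then have wa: "w a = k + 1 + r" using w_pos[of "k + 1 + r"] by simp
  have wsa: "w (Suc a) = k - c" using w_pos[of "k - c"] adj pa by simp
  have a1: "1 \<le> a" using arc c by simp
  have an: "Suc a \<le> n" using inversion_values(5)[of a "Suc a"] a1 wa wsa by simp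
  have "M \<le> a" using T rc arc by (auto simp: tableau_set_def)
  then have aR: "a \<in> descents_from n w M" using a1 an wa wsa by (simp add: descents_from_def)
  interpret inv_grassmannian_descent n k w a using descent_locale[OF aR] .
  have bx: "(row, col) = (r, c)" using wa wsa c by (simp add: row_def col_def)
  then have "T (row, col) = b" using rc by simp
  from restrict_tableau[OF T this min]
  have res: "T((row, col) := undefined) \<in> tableau_set k (shape k w') bs b (Suc a)" by blast
  have "T \<in> (\<lambda>S. S((row, col) := b)) ` tableau_set k (shape k w') bs b (Suc a)"
  proof (rule image_eqI)
    show "T = (T((row, col) := undefined))((row, col) := b)" using \<open>T (row, col) = b\<close> by auto
  qed (rule res)
  then show "T \<in> ?R" using aR unfolding box_eq[OF aR, symmetric] by blast
qed

end


lemma finite_descents_from: "finite (descents_from n w M)"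
  by (rule finite_subset[of _ "{..n}"]) (auto simp: descents_from_def)

lemma (in inv_grassmannian_perm) shape_empty_iff: "shape k w = {} \<longleftrightarrow> w = id"
proof
  assume empty: "shape k w = {}"
  show "w = id"
  proof (rule ccontr)
    assume "w \<noteq> id"
    then obtain d where "1 \<le> d" "d < n" "w (Suc d) < w d" using descent_exists[OF perm] by blast
    then have "d \<in> descents_from n w 0" by (simp add: descents_from_def)
    then interpret inv_grassmannian_descent n k w d by (rule descent_locale)
    show False using box_in_shape empty by simp
  qed
qed (auto simp: shape_def)

text \<open>Both sets split over the same descents with the same parameters. The bound
  \<open>M\<close> makes the choice of the removed box unique, which yields disjointness on the
  tableau side.\<close>

lemma card_word_set_eq:
  assumes "inv_grassmannian n k w" "sorted bs" "\<forall>x\<in>set bs. 1 \<le> x \<and> x \<le> b"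
  shows "finite (word_set n w bs b M) \<and> finite (tableau_set k (shape k w) bs b M) \<and>
    card (word_set n w bs b M) = card (tableau_set k (shape k w) bs b M)"
  using assms
proof (induction bs arbitrary: w b M rule: rev_induct)
  case Nil
  interpret inv_grassmannian_perm n k w using Nil by unfold_locales
  have "word_set n w [] b M = (if w = id then {[]} else {})"
    using Nil_reduced_words[OF perm] by (auto simp: word_set_def compatible_def)
  moreover have "tableau_set k (shape k w) [] b M = (if shape k w = {} then {\<lambda>x. undefined} else {})"
  proof (cases "shape k w = {}")
    case True
    then show ?thesis unfolding True by (auto simp: tableau_set_def tableaux_def)
  next
    case False
    then have "mset_set (shape k w) \<noteq> {#}" using finite_shape by (simp add: mset_set_empty_iff)
    then show ?thesis using False by (auto simp: tableau_set_def)
  qed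
  ultimately show ?case by (simp add: shape_empty_iff)
next
  case (snoc b0 bs)
  interpret inv_grassmannian_perm n k w using snoc by unfold_locales
  have bs: "sorted bs" "\<forall>x\<in>set bs. 1 \<le> x \<and> x \<le> b0" "\<forall>x\<in>set bs. x \<le> b0" and b0: "1 \<le> b0" "b0 \<le> b"
    using snoc.prems by (auto simp: sorted_append)
  have eq: "finite (word_set n w (bs @ [b0]) b0 M) \<and> finite (tableau_set k (shape k w) (bs @ [b0]) b0 M) \<and>
      card (word_set n w (bs @ [b0]) b0 M) = card (tableau_set k (shape k w) (bs @ [b0]) b0 M)" for M
  proof -
    let ?W = "\<lambda>d. word_set n (swap_pos w d (Suc d)) bs b0 (Suc d)"
    let ?T = "\<lambda>d. tableau_set k (shape k (swap_pos w d (Suc d))) bs b0 (Suc d)"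
    have IH: "finite (?W d) \<and> finite (?T d) \<and> card (?W d) = card (?T d)" if d: "d \<in> descents_from n w M" for d
    proof -
      interpret d: inv_grassmannian_descent n k w d using descent_locale[OF d] .
      show ?thesis using snoc.IH[OF _ bs(1,2)] d.inv_grassmannian_w' by (simp add: d.w'_def)
    qed
    have shape': "shape k (swap_pos w d (Suc d)) = shape k w - {box d}" "box d \<in> shape k w"
      "k + fst (box d) - snd (box d) = d"
      if d: "d \<in> descents_from n w M" for d
    proof -
      interpret d: inv_grassmannian_descent n k w d using descent_locale[OF d] .
      show "shape k (swap_pos w d (Suc d)) = shape k w - {box d}" "box d \<in> shape k w"
        "k + fst (box d) - snd (box d) = d"
        using d.shape_w' d.box_in_shape d.letter_a by (simp_all add: box_eq[OF d])
    qed
    have inj: "inj_on (\<lambda>T. T(box d := b0)) (?T d)" if d: "d \<in> descents_from n w M" for d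
    proof
      fix S T assume ST: "S \<in> ?T d" "T \<in> ?T d" "S(box d := b0) = T(box d := b0)"
      then have "S \<in> shape k w - {box d} \<rightarrow>\<^sub>E {1..}" "T \<in> shape k w - {box d} \<rightarrow>\<^sub>E {1..}"
        by (simp_all add: tableau_set_def tableaux_def shape'(1)[OF d])
      then have "S (box d) = undefined" "T (box d) = undefined" by (auto intro: PiE_arb)
      then show "S = T" using ST(3) by (metis fun_upd_triv fun_upd_upd)
    qed
    \<comment> \<open>If \<open>e\<close> were peeled first although the box of the smaller letter
      \<open>d\<close> also contains \<open>b0\<close>, the bound \<open>Suc e\<close> would be
      violated.\<close>
    have disj: "(\<lambda>T. T(box d := b0)) ` ?T d \<inter> (\<lambda>T. T(box e := b0)) ` ?T e = {}"
      if d: "d \<in> descents_from n w M" and e: "e \<in> descents_from n w M" and "d < e" for d e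
    proof -
      have False if S: "S \<in> ?T d" and T: "T \<in> ?T e" and eq: "S(box d := b0) = T(box e := b0)" for S T
      proof -
        have ne: "box d \<noteq> box e" using shape'(3)[OF d] shape'(3)[OF e] \<open>d < e\<close> by auto
        then have "box d \<in> shape k (swap_pos w e (Suc e))"
          using shape'(1)[OF e] shape'(2)[OF d] by simp
        moreover have "T (box d) = b0" using fun_cong[OF eq, of "box d"] ne by simp
        ultimately have "Suc e \<le> k + fst (box d) - snd (box d)"
          using T unfolding tableau_set_def by (cases "box d") auto
        then show False using shape'(3)[OF d] \<open>d < e\<close> by simp
      qed
      then show ?thesis by blast
    qed
    have disj': "(\<lambda>T. T(box d := b0)) ` ?T d \<inter> (\<lambda>T. T(box e := b0)) ` ?T e = {}"
      if "d \<in> descents_from n w M" "e \<in> descents_from n w M" "d \<noteq> e" for d e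
      using disj[OF that(1,2)] disj[OF that(2,1)] that(3) by (cases d e rule: linorder_cases) blast+
    have W: "word_set n w (bs @ [b0]) b0 M = (\<Union>d\<in>descents_from n w M. (\<lambda>as. as @ [d]) ` ?W d)"
      by (rule word_set_snoc[OF perm b0(1) bs(3)])
    have T: "tableau_set k (shape k w) (bs @ [b0]) b0 M = (\<Union>d\<in>descents_from n w M. (\<lambda>T. T(box d := b0)) ` ?T d)"
      by (rule tableau_set_snoc[OF b0(1) bs(3)])
    have "card (word_set n w (bs @ [b0]) b0 M) = (\<Sum>d\<in>descents_from n w M. card ((\<lambda>as. as @ [d]) ` ?W d))"
      unfolding W using finite_descents_from IH by (intro card_UN_disjoint) auto
    also have "\<dots> = (\<Sum>d\<in>descents_from n w M. card ((\<lambda>T. T(box d := b0)) ` ?T d))"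
      using IH inj by (intro sum.cong) (auto simp: card_image inj_on_def)
    also have "\<dots> = card (tableau_set k (shape k w) (bs @ [b0]) b0 M)"
      unfolding T using finite_descents_from IH disj' by (intro card_UN_disjoint[symmetric]) auto
    finally show ?thesis using IH finite_descents_from unfolding W T by auto
  qed
  show ?case
  proof (cases "b = b0")
    case True
    then show ?thesis using eq by simp
  next
    case False
    then have "b0 < b" using b0 by simp
    \<comment> \<open>No entry equals \<open>b\<close>, so the bound is vacuous, as is the bound 0
      for \<open>b0\<close>.\<close>
    have "word_set n w (bs @ [b0]) b M = word_set n w (bs @ [b0]) b0 0"
      using False by (auto simp: word_set_def)
    moreover have "tableau_set k (shape k w) (bs @ [b0]) b M = tableau_set k (shape k w) (bs @ [b0]) b0 0"
    proof -
      have "T x \<noteq> b" if "T \<in> tableau_set k (shape k w) (bs @ [b0]) b0 0" "x \<in> shape k w" for T x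
        using tableau_set_values[OF that(1) finite_shape that(2)] bs(3) \<open>b0 < b\<close> by auto
      then show ?thesis by (fastforce simp: tableau_set_def)
    qed
    ultimately show ?thesis using eq by simp
  qed
qed

lemma stanley_inv_grassmannian:
  assumes "inv_grassmannian n k w"
  shows "stanley n w m =
    int (card {T \<in> tableaux (shape k w). image_mset T (mset_set (shape k w)) = m})"
proof -
  interpret inv_grassmannian_perm n k w using assms by unfold_locales
  define bs where "bs = sorted_list_of_multiset m"
  have m: "mset bs = m" and "sorted bs" by (simp_all add: bs_def)
  \<comment> \<open>Any number above all entries would do; it makes the bound on letters
    vacuous.\<close>
  define b where "b = sum_list bs + 1"
  have le: "x < b" if "x \<in> set bs" for x using member_le_sum_list[OF that] by (simp add: b_def)
  have W: "{as \<in> reduced_words n w. compatible as bs} = word_set n w bs b 0"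
    by (auto simp: word_set_def)
  have T: "{T \<in> tableaux (shape k w). image_mset T (mset_set (shape k w)) = m} = tableau_set k (shape k w) bs b 0"
    by (auto simp: tableau_set_def m)
  have "card (word_set n w bs b 0) = card (tableau_set k (shape k w) bs b 0)"
  proof (cases "\<forall>x\<in>set bs. 1 \<le> x")
    case True
    then show ?thesis using card_word_set_eq[OF assms \<open>sorted bs\<close>, of b 0] le by (simp add: less_imp_le)
  next
    case False
    then have "0 \<in> set bs" by (metis less_one not_le)
    have "word_set n w bs b 0 = {}"
      using \<open>0 \<in> set bs\<close> by (auto simp: word_set_def compatible_def)
    moreover have "tableau_set k (shape k w) bs b 0 = {}"
    proof (rule equals0I)
      fix T assume T: "T \<in> tableau_set k (shape k w) bs b 0"
      then have "image_mset T (mset_set (shape k w)) = mset bs" by (simp add: tableau_set_def)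
      then have "0 \<in># image_mset T (mset_set (shape k w))" using \<open>0 \<in> set bs\<close> by simp
      then obtain x where "x \<in> shape k w" "T x = 0" using finite_shape by auto
      moreover have "T \<in> shape k w \<rightarrow>\<^sub>E {1..}" using T by (simp add: tableau_set_def tableaux_def)
      ultimately show False using PiE_mem[of T "shape k w" "\<lambda>_. {1..}" x] by simp
    qed
    ultimately show ?thesis by simp
  qed
  then show ?thesis unfolding T stanley_eq_card bs_def[symmetric] W by simp
qed


section \<open>The inverse Grassmannian permutation of a given shape\<close>

definition column_length :: "nat list \<Rightarrow> nat \<Rightarrow> nat" where
  "column_length \<mu> c = card {r. r < length \<mu> \<and> c < \<mu> ! r}"

text \<open>\<open>column_length \<mu>\<close> is the conjugate partition. As the rows decrease
  weakly, those longer than \<open>c\<close> form an initial segment.\<close>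

lemma column_length_gt:
  assumes "sorted_wrt (\<ge>) \<mu>" "r < length \<mu>"
  shows "r < column_length \<mu> c \<longleftrightarrow> c < \<mu> ! r"
proof
  have fin: "finite {r. r < length \<mu> \<and> c < \<mu> ! r}" by simp
  have le: "\<mu> ! s \<le> \<mu> ! t" if "t \<le> s" "s < length \<mu>" for s t
    using that assms(1) by (cases "t = s") (auto simp: sorted_wrt_iff_nth_less)
  {
    assume "c < \<mu> ! r"
    then have "{..r} \<subseteq> {r. r < length \<mu> \<and> c < \<mu> ! r}"
      using le[of _ r] assms(2) by (auto intro: less_le_trans)
    then have "card {..r} \<le> column_length \<mu> c" unfolding column_length_def by (rule card_mono[OF fin])
    then show "r < column_length \<mu> c" by simp
  next
    assume r: "r < column_length \<mu> c"
    show "c < \<mu> ! r"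
    proof (rule ccontr)
      assume "\<not> c < \<mu> ! r"
      have "s < r" if "s < length \<mu>" "c < \<mu> ! s" for s
        using le[of r s] that \<open>\<not> c < \<mu> ! r\<close> by (cases "s < r") auto
      then have "{s. s < length \<mu> \<and> c < \<mu> ! s} \<subseteq> {..<r}" by auto
      then have "column_length \<mu> c \<le> card {..<r}" unfolding column_length_def by (intro card_mono) auto
      then show False using r by simp
    qed
  }
qed

lemma column_length_le: "column_length \<mu> c \<le> length \<mu>"
  unfolding column_length_def by (rule order_trans[OF card_mono[of "{..<length \<mu>}"]]) auto

lemma column_length_antimono: "c \<le> c' \<Longrightarrow> column_length \<mu> c' \<le> column_length \<mu> c"
  unfolding column_length_def by (intro card_mono) auto

text \<open>
  The inverse of the inverse Grassmannian permutation of shape \<open>\<mu>\<close>: the value \<open>k - c\<close> is moved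
  past the rows that meet column \<open>c\<close>.
\<close>

definition grassmannian :: "nat \<Rightarrow> nat list \<Rightarrow> nat \<Rightarrow> nat" where
  "grassmannian k \<mu> x =
     (if 1 \<le> x \<and> x \<le> k then x + column_length \<mu> (k - x)
      else if k < x \<and> x \<le> k + length \<mu> then x - \<mu> ! (x - k - 1) else x)"

context
  fixes k :: nat and \<mu> :: "nat list"
  assumes sorted: "sorted_wrt (\<ge>) \<mu>" and bound: "\<forall>x\<in>set \<mu>. x \<le> k"
begin

lemma grassmannian_small: "c < k \<Longrightarrow> grassmannian k \<mu> (k - c) = k - c + column_length \<mu> c"
  by (simp add: grassmannian_def)

lemma grassmannian_big: "r < length \<mu> \<Longrightarrow> grassmannian k \<mu> (k + 1 + r) = k + 1 + r - \<mu> ! r"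
  by (simp add: grassmannian_def)

lemma nth_le: "r < length \<mu> \<Longrightarrow> \<mu> ! r \<le> k"
  using bound by simp

lemma grassmannian_mono_small:
  assumes "1 \<le> x" "x < y" "y \<le> k"
  shows "grassmannian k \<mu> x < grassmannian k \<mu> y"
proof -
  have "column_length \<mu> (k - x) \<le> column_length \<mu> (k - y)"
    using assms by (intro column_length_antimono) auto
  then show ?thesis using assms by (simp add: grassmannian_def)
qed

lemma grassmannian_mono_big:
  assumes "k < x" "x < y"
  shows "grassmannian k \<mu> x < grassmannian k \<mu> y"
proof (cases "y \<le> k + length \<mu>")
  case True
  have "\<mu> ! (y - k - 1) \<le> \<mu> ! (x - k - 1)"
    using sorted_wrt_nth_less[OF sorted, of "x - k - 1" "y - k - 1"] assms True by simp
  moreover have "\<mu> ! (x - k - 1) \<le> k" using nth_le[of "x - k - 1"] assms True by simp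
  ultimately show ?thesis using assms True by (simp add: grassmannian_def)
next
  case False
  then show ?thesis using assms by (auto simp: grassmannian_def)
qed

text \<open>The entries compared are \<open>k + 1 + r - \<mu> ! r\<close> and
  \<open>k - c + column_length \<mu> c\<close>; either \<open>c < \<mu> ! r\<close> and
  \<open>r < column_length \<mu> c\<close> both hold or both fail, and each alternative gives a
  strict inequality.\<close>

lemma grassmannian_cross:
  assumes "c < k" "r < length \<mu>"
  shows "grassmannian k \<mu> (k + 1 + r) < grassmannian k \<mu> (k - c) \<longleftrightarrow> c < \<mu> ! r"
    and "grassmannian k \<mu> (k + 1 + r) \<noteq> grassmannian k \<mu> (k - c)"
  unfolding grassmannian_small[OF assms(1)] grassmannian_big[OF assms(2)]
  using column_length_gt[OF sorted assms(2), of c] assms nth_le[OF assms(2)] by (cases "c < \<mu> ! r"; simp)+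

lemma grassmannian_permutes: "grassmannian k \<mu> permutes {1..k + length \<mu>}"
proof (rule inj_imp_permutes)
  have ne: "grassmannian k \<mu> x \<noteq> grassmannian k \<mu> y" if "x \<in> {1..k + length \<mu>}" "y \<in> {1..k + length \<mu>}" "x < y" for x y
  proof -
    consider "y \<le> k" | "k < x" | "x \<le> k" "k < y" by linarith
    then show ?thesis
    proof cases
      case 1
      then show ?thesis using grassmannian_mono_small[of x y] that by auto
    next
      case 2
      then show ?thesis using grassmannian_mono_big[of x y] that by auto
    next
      case 3
      then have "k - x < k" "y - k - 1 < length \<mu>" "k - (k - x) = x" "k + 1 + (y - k - 1) = y"
        using that by auto
      then show ?thesis using grassmannian_cross(2)[of "k - x" "y - k - 1"] by simp
    qed
  qed
  show "inj_on (grassmannian k \<mu>) {1..k + length \<mu>}"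
  proof
    fix x y assume "x \<in> {1..k + length \<mu>}" "y \<in> {1..k + length \<mu>}" "grassmannian k \<mu> x = grassmannian k \<mu> y"
    then show "x = y" using ne[of x y] ne[of y x] by (cases x y rule: linorder_cases) auto
  qed
next
  fix x assume x: "x \<in> {1..k + length \<mu>}"
  show "grassmannian k \<mu> x \<in> {1..k + length \<mu>}"
  proof (cases "x \<le> k")
    case True
    then show ?thesis using x column_length_le[of \<mu> "k - x"] by (simp add: grassmannian_def)
  next
    case False
    then have "x - k - 1 < length \<mu>" using x by auto
    then show ?thesis using False x nth_le[of "x - k - 1"] by (auto simp: grassmannian_def)
  qed
qed (auto simp: grassmannian_def)

lemma inv_inv_grassmannian: "inv (inv (grassmannian k \<mu>)) = grassmannian k \<mu>"
  by (rule inv_inv_eq[OF permutes_bij[OF grassmannian_permutes]])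

lemma inv_grassmannian_inv: "inv_grassmannian (k + length \<mu>) k (inv (grassmannian k \<mu>))"
  unfolding inv_grassmannian_def inv_inv_grassmannian
  using permutes_inv[OF grassmannian_permutes] grassmannian_mono_small grassmannian_mono_big by simp

lemma shape_inv_grassmannian: "shape k (inv (grassmannian k \<mu>)) = cells \<mu>"
proof (rule set_eqI)
  fix z :: "nat \<times> nat"
  obtain r c where z: "z = (r, c)" by (cases z)
  show "z \<in> shape k (inv (grassmannian k \<mu>)) \<longleftrightarrow> z \<in> cells \<mu>"
  proof (cases "r < length \<mu>")
    case True
    then show ?thesis
      using grassmannian_cross(1)[of c r] nth_le[of r]
      by (auto simp: z shape_def inv_inv_grassmannian cells_def)
  next
    case False
    have "grassmannian k \<mu> (k + 1 + r) = k + 1 + r" using False by (simp add: grassmannian_def)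
    moreover have "grassmannian k \<mu> (k - c) \<le> k + length \<mu>" if "c < k"
      using column_length_le[of \<mu> c] that by (simp add: grassmannian_small)
    ultimately show ?thesis using False by (auto simp: z shape_def inv_inv_grassmannian cells_def)
  qed
qed

text \<open>The small values to the right of the value \<open>k + 1 + r\<close> are
  \<open>k - c\<close> with \<open>c < \<mu> ! r\<close>, that is, the boxes of row
  \<open>r\<close>; a small value has no inversion to its right.\<close>

lemma code_inv_grassmannian:
  fixes i
  defines "w \<equiv> inv (grassmannian k \<mu>)"
  assumes i: "i \<in> {1..k + length \<mu>}"
  shows "code (k + length \<mu>) w i = (if k < w i then \<mu> ! (w i - k - 1) else 0)"
proof -
  let ?n = "k + length \<mu>" and ?g = "grassmannian k \<mu>"
  interpret inv_grassmannian_perm ?n k w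
    unfolding w_def using inv_grassmannian_inv by unfold_locales
  have g: "inv w = ?g" unfolding w_def by (rule inv_inv_grassmannian)
  show ?thesis
  proof (cases "k < w i")
    case False
    then have "{j. i < j \<and> j \<le> ?n \<and> w j < w i} = {}" using inversion_values(2)[of i] i by auto
    then show ?thesis using False by (simp add: code_def)
  next
    case True
    define r where "r = w i - k - 1"
    have wi: "w i = k + 1 + r" using True by (simp add: r_def)
    have r: "r < length \<mu>" using permutes_in_image[OF perm, of i] i wi by simp
    have gi: "?g (k + 1 + r) = i" using pos_w[of i] wi g by simp
    have "{j. i < j \<and> j \<le> ?n \<and> w j < w i} = (\<lambda>c. ?g (k - c)) ` {..<\<mu> ! r}"
    proof (intro equalityI subsetI)
      fix j assume "j \<in> {j. i < j \<and> j \<le> ?n \<and> w j < w i}"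
      then have j: "i < j" "w j < w i" by auto
      then have wj: "w j \<le> k" "1 \<le> w j" using inversion_values[of i j] i by auto
      define c where "c = k - w j"
      have c: "c < k" "k - c = w j" using wj by (auto simp: c_def)
      have gj: "?g (k - c) = j" using pos_w[of j] c g by simp
      then have "c < \<mu> ! r" using grassmannian_cross(1)[OF c(1) r] gi j by simp
      then show "j \<in> (\<lambda>c. ?g (k - c)) ` {..<\<mu> ! r}" using gj by blast
    next
      fix j assume "j \<in> (\<lambda>c. ?g (k - c)) ` {..<\<mu> ! r}"
      then obtain c where c: "c < \<mu> ! r" "j = ?g (k - c)" by blast
      then have ck: "c < k" using nth_le[OF r] by simp
      have "i < j" using grassmannian_cross(1)[OF ck r] c gi by simp
      moreover have "w j = k - c" using w_pos[of "k - c"] c(2) g by simp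
      moreover have "k - c \<in> {1..?n}" using ck by auto
      then have "j \<le> ?n" using permutes_in_image[OF grassmannian_permutes, of "k - c"] c(2) by auto
      ultimately show "j \<in> {j. i < j \<and> j \<le> ?n \<and> w j < w i}" using wi by simp
    qed
    moreover have "inj_on (\<lambda>c. ?g (k - c)) {..<\<mu> ! r}"
    proof
      fix c d assume "c \<in> {..<\<mu> ! r}" "d \<in> {..<\<mu> ! r}" "?g (k - c) = ?g (k - d)"
      then have "k - c = k - d" "c < k" "d < k"
        using nth_le[OF r] inj_eq[OF permutes_inj[OF grassmannian_permutes]] by auto
      then show "c = d" by simp
    qed
    ultimately show ?thesis using True by (simp add: code_def card_image r_def)
  qed
qed

lemma mset_lehmer_code_inv_grassmannian:
  "mset (lehmer_code (k + length \<mu>) (inv (grassmannian k \<mu>))) = mset (\<mu> @ replicate k 0)"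
proof -
  let ?n = "k + length \<mu>" and ?w = "inv (grassmannian k \<mu>)"
  define f where "f = (\<lambda>x. if k < x then \<mu> ! (x - k - 1) else 0)"
  have "mset [1..<?n + 1] = mset_set {1..?n}"
    by (metis Suc_eq_plus1 atLeastLessThanSuc_atLeastAtMost mset_upt)
  then have "mset (lehmer_code ?n ?w) = image_mset (code ?n ?w) (mset_set {1..?n})"
    by (simp only: lehmer_code_eq mset_map)
  also have "\<dots> = image_mset f (mset_set {1..?n})"
    by (rule permutes_implies_image_mset_eq[OF permutes_inv[OF grassmannian_permutes], symmetric])
      (simp add: code_inv_grassmannian f_def)
  also have "\<dots> = mset (map f [1..<?n + 1])"
    using \<open>mset [1..<?n + 1] = mset_set {1..?n}\<close> by (simp only: mset_map)
  also have "map f [1..<?n + 1] = replicate k 0 @ \<mu>"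
  proof -
    have "[1..<?n + 1] = [1..<k + 1] @ [k + 1..<k + 1 + length \<mu>]"
      using upt_add_eq_append[of 1 "k + 1" "length \<mu>"] by (simp add: ac_simps)
    moreover have "map f [1..<k + 1] = replicate k 0"
      by (rule nth_equalityI) (auto simp: f_def simp del: upt_Suc)
    moreover have "map f [k + 1..<k + 1 + length \<mu>] = \<mu>"
      by (rule nth_equalityI) (auto simp: f_def simp del: upt_Suc)
    ultimately show ?thesis by (simp only: map_append)
  qed
  finally show ?thesis by simp
qed

text \<open>The path of single children preserves the code as a multiset. At its dominant end the
  code is sorted, hence equal to the sorted list \<open>\<mu>\<close> padded with zeros.\<close>

lemma exists_dominant_schur:
  "\<exists>x. x permutes {1..k + length \<mu>} \<and> dominant x \<and>
    lehmer_code (k + length \<mu>) x = \<mu> @ replicate k 0 \<and> stanley (k + length \<mu>) x = schur \<mu>"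
proof -
  let ?n = "k + length \<mu>" and ?w = "inv (grassmannian k \<mu>)"
  interpret inv_grassmannian_perm ?n k ?w
    using inv_grassmannian_inv by unfold_locales
  obtain x where x: "x permutes {1..?n}" "dominant x"
    "mset (lehmer_code ?n x) = mset (lehmer_code ?n ?w)" "stanley ?n x = stanley ?n ?w"
    using vexillary_path[OF perm vexillary] by blast
  have "sorted_wrt (\<ge>) (replicate k (0::nat))" by (simp add: sorted_wrt_iff_nth_less)
  then have sorted': "sorted_wrt (\<ge>) (\<mu> @ replicate k 0)" using sorted by (auto simp: sorted_wrt_append)
  have "sorted (rev (lehmer_code ?n x))" "sorted (rev (\<mu> @ replicate k 0))"
    using dominant_code_antimono[OF x(1,2)] sorted' by (simp_all add: sorted_wrt_rev del: rev_append)
  moreover have "mset (rev (lehmer_code ?n x)) = mset (rev (\<mu> @ replicate k 0))"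
    unfolding mset_rev x(3) mset_lehmer_code_inv_grassmannian ..
  ultimately have "rev (lehmer_code ?n x) = rev (\<mu> @ replicate k 0)"
    by (metis properties_for_sort)
  then have "lehmer_code ?n x = \<mu> @ replicate k 0" by (simp only: rev_is_rev_conv)
  moreover have "stanley ?n ?w m = schur \<mu> m" for m
    by (simp add: stanley_inv_grassmannian[OF inv_grassmannian_inv] shape_inv_grassmannian schur_def ssyt_eq)
  ultimately show ?thesis using x by (auto simp: fun_eq_iff)
qed

end

section \<open>Linear independence of Schur functions\<close>

lemma code_mono:
  assumes "w permutes {1..n}" "n \<le> N" "1 \<le> i"
  shows "code N w i = code n w i"
proof -
  have "j \<le> n \<and> j \<le> N" if "i < j" "w j < w i" for j
    using subsetD[OF inversions_finite[OF assms(1)], of "(i, j)"] that assms(2,3) by simp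
  then have "{j. i < j \<and> j \<le> N \<and> w j < w i} = {j. i < j \<and> j \<le> n \<and> w j < w i}"
    by blast
  then show ?thesis by (simp add: code_def)
qed

lemma lehmer_code_mono:
  assumes "w permutes {1..n}" "n \<le> N"
  shows "lehmer_code N w = lehmer_code n w @ replicate (N - n) 0"
proof -
  have "[1..<N + 1] = [1..<n + 1] @ [n + 1..<N + 1]"
    using upt_add_eq_append[of 1 "n + 1" "N - n"] assms(2) by simp
  moreover have "map (code N w) [1..<n + 1] = lehmer_code n w"
    unfolding lehmer_code_eq using code_mono[OF assms] by (intro map_cong) auto
  moreover have "map (code N w) [n + 1..<N + 1] = replicate (N - n) 0"
  proof (rule nth_equalityI)
    fix i assume "i < length (map (code N w) [n + 1..<N + 1])"
    then have i: "i < N - n" by (simp del: upt_Suc)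
    have "{j. n + 1 + i < j \<and> j \<le> n \<and> w j < w (n + 1 + i)} = {}" by auto
    then have "code n w (n + 1 + i) = 0" unfolding code_def by (simp only: card.empty)
    then have "code N w (n + 1 + i) = 0" using code_mono[OF assms, of "n + 1 + i"] by simp
    then show "map (code N w) [n + 1..<N + 1] ! i = replicate (N - n) 0 ! i"
      using i by (simp del: upt_Suc)
  qed (simp del: upt_Suc)
  ultimately show ?thesis by (simp only: lehmer_code_eq map_append)
qed

lemma length_lehmer_code [simp]: "length (lehmer_code n w) = n"
  by (simp add: lehmer_code_def)

lemma strip_zeros:
  fixes xs :: "nat list"
  obtains d where "xs = strip_while (\<lambda>x. x = 0) xs @ replicate d 0"
proof -
  obtain zs where zs: "xs = strip_while (\<lambda>x. x = 0) xs @ zs" "\<forall>z\<in>set zs. z = 0"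
    by (rule split_strip_while_append[of "\<lambda>x. x = 0" xs]) (use that in blast)
  have "zs = replicate (length zs) 0" using zs(2) by (intro replicate_eqI) auto
  then show thesis using zs(1) that[of "length zs"] by simp
qed

text \<open>As the code decreases weakly, the last entry that remains after stripping is positive
  and bounds all others from below.\<close>

lemma dominant_partition:
  assumes "w permutes {1..n}" "dominant w"
  shows "is_partition (strip_while (\<lambda>x. x = 0) (lehmer_code n w))"
proof -
  define \<mu> where "\<mu> = strip_while (\<lambda>x. x = 0) (lehmer_code n w)"
  obtain d where d: "lehmer_code n w = \<mu> @ replicate d 0"
    using strip_zeros[of "lehmer_code n w"] unfolding \<mu>_def by blast
  have sorted: "sorted_wrt (\<ge>) \<mu>"
    using dominant_code_antimono[OF assms] unfolding d by (simp add: sorted_wrt_append)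
  have "1 \<le> x" if "x \<in> set \<mu>" for x
  proof -
    have ne: "\<mu> \<noteq> []" using that by auto
    have "no_trailing (\<lambda>x. x = 0) \<mu>" unfolding \<mu>_def by (rule no_trailing_strip_while)
    then have last: "last \<mu> \<noteq> 0" using ne by (simp add: no_trailing_unfold)
    have "\<mu> = butlast \<mu> @ [last \<mu>]" using ne by simp
    then have "sorted_wrt (\<ge>) (butlast \<mu> @ [last \<mu>])" using sorted by simp
    moreover have "x \<in> set (butlast \<mu>) \<or> x = last \<mu>"
      using that \<open>\<mu> = butlast \<mu> @ [last \<mu>]\<close> by (metis Un_iff empty_iff insert_iff list.set(1,2) set_append)
    ultimately have "last \<mu> \<le> x" by (auto simp: sorted_wrt_append)
    then show ?thesis using last by simp
  qed
  then show ?thesis using sorted unfolding \<mu>_def[symmetric] by (simp add: is_partition_def)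
qed

lemma stanley_dominant:
  assumes w: "w permutes {1..n}" and dom: "dominant w"
  shows "stanley n w = schur (strip_while (\<lambda>x. x = 0) (lehmer_code n w))"
proof -
  define \<mu> where "\<mu> = strip_while (\<lambda>x. x = 0) (lehmer_code n w)"
  obtain d where d: "lehmer_code n w = \<mu> @ replicate d 0"
    using strip_zeros[of "lehmer_code n w"] unfolding \<mu>_def by blast
  have sorted: "sorted_wrt (\<ge>) \<mu>"
    using dominant_partition[OF w dom] by (simp add: is_partition_def \<mu>_def)
  \<comment> \<open>The summand \<open>n\<close> makes the larger group contain \<open>w\<close>;
    the sum bounds every part of \<open>\<mu>\<close>, as the construction of the inverse
    Grassmannian permutation requires.\<close>
  define k where "k = n + sum_list \<mu>"
  have "\<forall>x\<in>set \<mu>. x \<le> k" using member_le_sum_list[of _ \<mu>] by (auto simp: k_def intro: trans_le_add2)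
  from exists_dominant_schur[OF sorted this] obtain x where x: "x permutes {1..k + length \<mu>}"
    "lehmer_code (k + length \<mu>) x = \<mu> @ replicate k 0" "stanley (k + length \<mu>) x = schur \<mu>" by blast
  let ?N = "k + length \<mu>"
  have nN: "n \<le> ?N" by (simp add: k_def)
  have "lehmer_code ?N w = \<mu> @ replicate (d + (?N - n)) 0"
    unfolding lehmer_code_mono[OF w nN] d by (simp add: replicate_add)
  moreover have "n = length \<mu> + d" using arg_cong[OF d, of length] by simp
  ultimately have "lehmer_code ?N w = \<mu> @ replicate k 0" using nN by simp
  \<comment> \<open>The dominant end of the path is identified with \<open>w\<close> through its
    code in the larger group.\<close>
  then have "x = w" using lehmer_code_inj[OF x(1) permutes_mono[OF w nN]] x(2) by simp
  then show ?thesis using x(3) stanley_mono[OF w nN] unfolding \<mu>_def by simp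
qed

section \<open>Dominance order and leading monomials of Schur functions\<close>

lemma cells_eq: "cells \<mu> = Sigma {..<length \<mu>} (\<lambda>r. {..<\<mu> ! r})"
  by (auto simp: cells_def)

lemma finite_cells [simp]: "finite (cells \<mu>)"
  by (simp add: cells_eq)

lemma cells_up:
  assumes "is_partition \<mu>" "(r, c) \<in> cells \<mu>" "r' \<le> r"
  shows "(r', c) \<in> cells \<mu>"
proof -
  have "\<mu> ! r \<le> \<mu> ! r'"
    using assms by (cases "r' = r") (auto simp: is_partition_def cells_def sorted_wrt_iff_nth_less)
  then show ?thesis using assms by (auto simp: cells_def)
qed

text \<open>The partial sums that define the dominance order, counted as cells so that they compare
  directly with the cells holding entries at most \<open>j\<close>.\<close>

definition row_sum :: "nat list \<Rightarrow> nat \<Rightarrow> nat" where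
  "row_sum \<mu> j = card {x \<in> cells \<mu>. fst x < j}"

text \<open>The monomial whose exponents are the parts of \<open>\<mu>\<close>, given as the content
  of the tableau that is constant along rows.\<close>

definition row_content :: "nat list \<Rightarrow> nat multiset" where
  "row_content \<mu> = image_mset (\<lambda>x. Suc (fst x)) (mset_set (cells \<mu>))"

lemma row_sum_Suc: "row_sum \<mu> (Suc j) = row_sum \<mu> j + (if j < length \<mu> then \<mu> ! j else 0)"
proof -
  have "{x \<in> cells \<mu>. fst x < Suc j} = {x \<in> cells \<mu>. fst x < j} \<union> {x \<in> cells \<mu>. fst x = j}" by auto
  then have "row_sum \<mu> (Suc j) = row_sum \<mu> j + card {x \<in> cells \<mu>. fst x = j}"
    unfolding row_sum_def by (simp add: card_Un_disjoint disjoint_iff)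
  moreover have "{x \<in> cells \<mu>. fst x = j} = (if j < length \<mu> then Pair j ` {..<\<mu> ! j} else {})"
    by (auto simp: cells_def)
  then have "card {x \<in> cells \<mu>. fst x = j} = (if j < length \<mu> then \<mu> ! j else 0)"
    by (simp add: card_image inj_on_def)
  ultimately show ?thesis by simp
qed

lemma row_sum_inject:
  assumes "is_partition \<mu>" "is_partition \<nu>" "\<And>j. row_sum \<mu> j = row_sum \<nu> j"
  shows "\<mu> = \<nu>"
proof -
  have eq: "(if j < length \<mu> then \<mu> ! j else 0) = (if j < length \<nu> then \<nu> ! j else 0)" for j
    using assms(3)[of "Suc j"] assms(3)[of j] by (simp add: row_sum_Suc)
  have pos: "0 < \<mu> ! j" if "j < length \<mu>" for j
    using assms(1) nth_mem[OF that] unfolding is_partition_def by (simp add: Suc_le_eq)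
  have pos': "0 < \<nu> ! j" if "j < length \<nu>" for j
    using assms(2) nth_mem[OF that] unfolding is_partition_def by (simp add: Suc_le_eq)
  have "length \<mu> = length \<nu>"
    using eq[of "length \<mu>"] eq[of "length \<nu>"] pos[of "length \<nu>"] pos'[of "length \<mu>"]
    by (cases "length \<mu>" "length \<nu>" rule: linorder_cases) auto
  then show ?thesis using eq by (intro nth_equalityI) (metis+)
qed

lemma row_sum_ge_length: "length \<mu> \<le> j \<Longrightarrow> row_sum \<mu> j = row_sum \<mu> (length \<mu>)"
proof -
  assume "length \<mu> \<le> j"
  then have "{x \<in> cells \<mu>. fst x < j} = {x \<in> cells \<mu>. fst x < length \<mu>}" by (auto simp: cells_def)
  then show ?thesis by (simp add: row_sum_def)
qed

lemma card_filter_image_mset: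
  assumes "finite D"
  shows "size (filter_mset P (image_mset f (mset_set D))) = card {x \<in> D. P (f x)}"
  using assms by (simp add: filter_mset_image_mset filter_mset_mset_set)

lemma ssyt_ge_row:
  assumes "is_partition \<mu>" "T \<in> ssyt \<mu>" "(r, c) \<in> cells \<mu>"
  shows "Suc r \<le> T (r, c)"
  using assms(3)
proof (induction r)
  case 0
  then have "T (0, c) \<in> {1..}" using assms(2) by (auto simp: ssyt_def dest: PiE_mem)
  then show ?case by simp
next
  case (Suc r)
  have "(r, c) \<in> cells \<mu>" using cells_up[OF assms(1) Suc.prems, of r] by simp
  moreover have "T (r, c) < T (Suc r, c)"
    using assms(2) Suc.prems \<open>(r, c) \<in> cells \<mu>\<close> unfolding ssyt_def by blast
  ultimately show ?case using Suc.IH by simp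
qed

text \<open>Column strictness confines entries at most \<open>j\<close> to the first
  \<open>j\<close> rows. This is the triangularity of Kostka numbers: a nonzero coefficient forces
  \<open>\<nu>\<close> to dominate \<open>\<mu>\<close>.\<close>

lemma ssyt_row_content:
  assumes "is_partition \<nu>" "T \<in> ssyt \<nu>" "image_mset T (mset_set (cells \<nu>)) = row_content \<mu>"
  shows "{x \<in> cells \<nu>. T x \<le> j} \<subseteq> {x \<in> cells \<nu>. fst x < j}" "card {x \<in> cells \<nu>. T x \<le> j} = row_sum \<mu> j"
    "row_sum \<mu> j \<le> row_sum \<nu> j"
proof -
  show sub: "{x \<in> cells \<nu>. T x \<le> j} \<subseteq> {x \<in> cells \<nu>. fst x < j}"
  proof
    fix x assume x: "x \<in> {x \<in> cells \<nu>. T x \<le> j}"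
    obtain r c where "x = (r, c)" by (cases x)
    then show "x \<in> {x \<in> cells \<nu>. fst x < j}" using ssyt_ge_row[OF assms(1,2), of r c] x by simp
  qed
  have "size (filter_mset (\<lambda>y. y \<le> j) (image_mset T (mset_set (cells \<nu>)))) =
      size (filter_mset (\<lambda>y. y \<le> j) (row_content \<mu>))"
    using assms(3) by simp
  then have "card {x \<in> cells \<nu>. T x \<le> j} = card {x \<in> cells \<mu>. Suc (fst x) \<le> j}"
    unfolding row_content_def by (simp only: card_filter_image_mset[OF finite_cells])
  then show card: "card {x \<in> cells \<nu>. T x \<le> j} = row_sum \<mu> j" by (simp add: row_sum_def Suc_le_eq)
  have "card {x \<in> cells \<nu>. T x \<le> j} \<le> card {x \<in> cells \<nu>. fst x < j}"
    by (rule card_mono[OF _ sub]) simp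
  then show "row_sum \<mu> j \<le> row_sum \<nu> j" unfolding card by (simp add: row_sum_def)
qed

text \<open>Here the inclusion of cells becomes an equality by counting, so row \<open>r\<close>
  holds only entries at most \<open>r + 1\<close>, which is also the least entry possible
  there.\<close>

lemma schur_row_content_self:
  assumes "is_partition \<mu>"
  shows "schur \<mu> (row_content \<mu>) = 1"
proof -
  define T0 where "T0 = restrict (\<lambda>x. Suc (fst x)) (cells \<mu>)"
  have "T0 \<in> ssyt \<mu>" by (auto simp: ssyt_def T0_def)
  moreover have "image_mset T0 (mset_set (cells \<mu>)) = row_content \<mu>"
    unfolding row_content_def by (rule image_mset_cong) (simp add: T0_def)
  moreover have "T = T0" if T: "T \<in> ssyt \<mu>" "image_mset T (mset_set (cells \<mu>)) = row_content \<mu>" for T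
  proof
    fix x
    show "T x = T0 x"
    proof (cases "x \<in> cells \<mu>")
      case True
      obtain r c where x: "x = (r, c)" by (cases x)
      note facts = ssyt_row_content[OF assms T, of "Suc r"]
      have "{x \<in> cells \<mu>. T x \<le> Suc r} = {x \<in> cells \<mu>. fst x < Suc r}"
        by (rule card_subset_eq[OF _ facts(1)]) (use facts(2) in \<open>simp_all add: row_sum_def\<close>)
      moreover have "x \<in> {x \<in> cells \<mu>. fst x < Suc r}" using True x by simp
      ultimately have "T x \<le> Suc r" by blast
      then show ?thesis using ssyt_ge_row[OF assms T(1), of r c] True x by (simp add: T0_def)
    next
      case False
      have "T \<in> cells \<mu> \<rightarrow>\<^sub>E {1..}" using T(1) by (simp add: ssyt_def)
      then show ?thesis using False PiE_arb[of T "cells \<mu>" _ x] by (simp add: T0_def)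
    qed
  qed
  ultimately have "{T \<in> ssyt \<mu>. image_mset T (mset_set (cells \<mu>)) = row_content \<mu>} = {T0}" by blast
  then show ?thesis by (simp add: schur_def)
qed

lemma schur_row_content_nonzero:
  assumes "is_partition \<nu>" "schur \<nu> (row_content \<mu>) \<noteq> 0"
  shows "row_sum \<mu> j \<le> row_sum \<nu> j"
proof -
  have "{T \<in> ssyt \<nu>. image_mset T (mset_set (cells \<nu>)) = row_content \<mu>} \<noteq> {}"
    using assms(2) unfolding schur_def by (metis card.empty of_nat_0)
  then show ?thesis using ssyt_row_content(3)[OF assms(1)] by blast
qed

text \<open>For a maximal \<open>\<kappa>\<close> in the support, its leading monomial occurs only
  in Schur functions that dominate \<open>\<kappa>\<close>, hence in no other one of the
  support.\<close>

lemma schur_independent: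
  assumes fin: "finite S" and part: "\<And>\<mu>. \<mu> \<in> S \<Longrightarrow> is_partition \<mu>"
    and zero: "\<And>m. (\<Sum>\<mu>\<in>S. d \<mu> * schur \<mu> m) = 0" and "\<mu> \<in> S"
  shows "d \<mu> = 0"
proof (rule ccontr)
  assume "d \<mu> \<noteq> 0"
  define S' where "S' = {\<mu> \<in> S. d \<mu> \<noteq> 0}"
  have S': "finite S'" "S' \<noteq> {}" using fin \<open>\<mu> \<in> S\<close> \<open>d \<mu> \<noteq> 0\<close> by (auto simp: S'_def)
  define J where "J = Max (length ` S')"
  have J: "length \<nu> \<le> J" if "\<nu> \<in> S'" for \<nu> using that S' by (simp add: J_def)
  \<comment> \<open>A numerical linear extension of dominance on the support: partial sums are
    constant beyond \<open>J\<close>, so strict dominance shows up in this finite sum.\<close>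
  define h where "h = (\<lambda>\<nu>. \<Sum>j\<le>J. row_sum \<nu> j)"
  have "Max (h ` S') \<in> h ` S'" using S' by (intro Max_in) auto
  then obtain \<kappa> where \<kappa>: "\<kappa> \<in> S'" "h \<kappa> = Max (h ` S')" by auto
  have max: "h \<nu> \<le> h \<kappa>" if "\<nu> \<in> S'" for \<nu> using that S' \<kappa>(2) by simp
  have zero': "schur \<nu> (row_content \<kappa>) = 0" if \<nu>: "\<nu> \<in> S'" "\<nu> \<noteq> \<kappa>" for \<nu>
  proof (rule ccontr)
    assume nz: "schur \<nu> (row_content \<kappa>) \<noteq> 0"
    have pn: "is_partition \<nu>" "is_partition \<kappa>" using part \<nu> \<kappa> by (auto simp: S'_def)
    have le: "row_sum \<kappa> j \<le> row_sum \<nu> j" for j using schur_row_content_nonzero[OF pn(1) nz] .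
    have eqJ: "row_sum \<kappa> j = row_sum \<nu> j" if "j \<le> J" for j
    proof (rule ccontr)
      assume "row_sum \<kappa> j \<noteq> row_sum \<nu> j"
      then have "row_sum \<kappa> j < row_sum \<nu> j" using le[of j] by simp
      then have "h \<kappa> < h \<nu>" unfolding h_def using le that
        by (intro sum_strict_mono_ex1) auto
      then show False using max[OF \<nu>(1)] by simp
    qed
    have "row_sum \<kappa> j = row_sum \<nu> j" for j
    proof (cases "j \<le> J")
      case False
      then have "row_sum \<kappa> j = row_sum \<kappa> J" "row_sum \<nu> j = row_sum \<nu> J"
        using J[OF \<kappa>(1)] J[OF \<nu>(1)] row_sum_ge_length[of \<kappa> j] row_sum_ge_length[of \<kappa> J]
          row_sum_ge_length[of \<nu> j] row_sum_ge_length[of \<nu> J] by linarith+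
      then show ?thesis using eqJ[of J] by simp
    qed (rule eqJ)
    then show False using row_sum_inject[OF pn(2,1)] \<nu>(2) by simp
  qed
  have "(\<Sum>\<nu>\<in>S. d \<nu> * schur \<nu> (row_content \<kappa>)) = (\<Sum>\<nu>\<in>{\<kappa>}. d \<nu> * schur \<nu> (row_content \<kappa>))"
    using fin \<kappa> zero' by (intro sum.mono_neutral_right) (auto simp: S'_def)
  then have "d \<kappa> * schur \<kappa> (row_content \<kappa>) = 0" using zero by simp
  then show False using schur_row_content_self[OF part] \<kappa> by (simp add: S'_def)
qed

lemma schur_expansion_unique:
  assumes c: "schur_expansion f c" and c': "schur_expansion f c'"
  shows "c = c'"
proof
  fix \<mu>
  define S where "S = {\<mu>. c \<mu> \<noteq> 0} \<union> {\<mu>. c' \<mu> \<noteq> 0}"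
  have fin: "finite S" using c c' by (simp add: S_def schur_expansion_def)
  have part: "is_partition \<mu>" if "\<mu> \<in> S" for \<mu>
    using that c c' by (auto simp: S_def schur_expansion_def)
  have "f m = (\<Sum>\<mu>\<in>S. c \<mu> * schur \<mu> m)" for m
  proof -
    have "f m = (\<Sum>\<mu> | c \<mu> \<noteq> 0. c \<mu> * schur \<mu> m)" using c by (simp add: schur_expansion_def)
    also have "\<dots> = (\<Sum>\<mu>\<in>S. c \<mu> * schur \<mu> m)"
      using fin by (intro sum.mono_neutral_left) (auto simp: S_def)
    finally show ?thesis .
  qed
  moreover have "f m = (\<Sum>\<mu>\<in>S. c' \<mu> * schur \<mu> m)" for m
  proof -
    have "f m = (\<Sum>\<mu> | c' \<mu> \<noteq> 0. c' \<mu> * schur \<mu> m)" using c' by (simp add: schur_expansion_def)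
    also have "\<dots> = (\<Sum>\<mu>\<in>S. c' \<mu> * schur \<mu> m)"
      using fin by (intro sum.mono_neutral_left) (auto simp: S_def)
    finally show ?thesis .
  qed
  ultimately have "(\<Sum>\<mu>\<in>S. (c \<mu> - c' \<mu>) * schur \<mu> m) = 0" for m
    by (simp add: left_diff_distrib sum_subtractf)
  then have "c \<mu> - c' \<mu> = 0" if "\<mu> \<in> S"
    using schur_independent[OF fin part, of "\<lambda>\<mu>. c \<mu> - c' \<mu>" \<mu>] that by simp
  then show "c \<mu> = c' \<mu>" by (cases "\<mu> \<in> S") (auto simp: S_def)
qed

section \<open>The Schur expansion obtained by grouping leaves with equal code\<close>

lemma schur_expansion_stanley:
  assumes w: "w permutes {1..n}"
  shows "schur_expansion (stanley n w)
    (\<lambda>\<mu>. int (card {\<pi> \<in> mLS_leaves w. strip_while (\<lambda>x. x = 0) (lehmer_code n (last \<pi>)) = \<mu>}))"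
proof -
  define g where "g = (\<lambda>\<pi>. strip_while (\<lambda>x. x = 0) (lehmer_code n (last \<pi>)))"
  define c where "c = (\<lambda>\<mu>. int (card {\<pi> \<in> mLS_leaves w. g \<pi> = \<mu>}))"
  have fin: "finite (mLS_leaves w)"
    and dom: "\<And>\<pi>. \<pi> \<in> mLS_leaves w \<Longrightarrow> last \<pi> permutes {1..n} \<and> dominant (last \<pi>)"
    and sum: "\<And>m. stanley n w m = (\<Sum>\<pi>\<in>mLS_leaves w. stanley n (last \<pi>) m)"
    using stanley_leaves[OF w] by blast+
  have supp: "{\<mu>. c \<mu> \<noteq> 0} = g ` mLS_leaves w"
    using fin by (auto simp: c_def)
  have "is_partition \<mu>" if "c \<mu> \<noteq> 0" for \<mu>
  proof -
    have "\<mu> \<in> g ` mLS_leaves w" using that unfolding supp[symmetric] by simp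
    then obtain \<pi> where "\<pi> \<in> mLS_leaves w" "\<mu> = g \<pi>" by (elim imageE)
    then show ?thesis using dominant_partition[of "last \<pi>" n] dom[of \<pi>] by (simp add: g_def)
  qed
  moreover have "stanley n w m = (\<Sum>\<mu> | c \<mu> \<noteq> 0. c \<mu> * schur \<mu> m)" for m
  proof -
    have "stanley n w m = (\<Sum>\<pi>\<in>mLS_leaves w. stanley n (last \<pi>) m)" by (rule sum)
    also have "\<dots> = (\<Sum>\<pi>\<in>mLS_leaves w. schur (g \<pi>) m)"
      by (rule sum.cong[OF refl]) (simp only: g_def stanley_dominant dom)
    also have "\<dots> = (\<Sum>\<mu>\<in>g ` mLS_leaves w. \<Sum>\<pi> | \<pi> \<in> mLS_leaves w \<and> g \<pi> = \<mu>. schur (g \<pi>) m)"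
      by (rule sum.image_gen[OF fin])
    also have "\<dots> = (\<Sum>\<mu>\<in>g ` mLS_leaves w. c \<mu> * schur \<mu> m)"
      by (rule sum.cong) (simp_all add: c_def)
    finally show ?thesis unfolding supp .
  qed
  moreover have "finite (g ` mLS_leaves w)" using fin by simp
  ultimately have "schur_expansion (stanley n w) c"
    using fin unfolding schur_expansion_def supp by blast
  then show ?thesis by (simp add: c_def g_def)
qed

theorem theorem4p4:
  fixes n :: nat and w :: "nat \<Rightarrow> nat" and \<mu> :: "nat list"
  assumes "w permutes {1..n}" and "is_partition \<mu>"
  defines "L \<equiv> {\<pi> \<in> mLS_leaves w.
      dominant (last \<pi>) \<and> strip_while (\<lambda>x. x = 0) (lehmer_code n (last \<pi>)) = \<mu>}"
  shows "finite L \<and> EG_coeff n w \<mu> = int (card L)"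
proof
  show "finite L" using stanley_leaves[OF assms(1)] by (simp add: L_def)
  have L: "L = {\<pi> \<in> mLS_leaves w. strip_while (\<lambda>x. x = 0) (lehmer_code n (last \<pi>)) = \<mu>}"
    using stanley_leaves[OF assms(1)] unfolding L_def by blast
  have "EG_coeff n w =
      (\<lambda>\<mu>. int (card {\<pi> \<in> mLS_leaves w. strip_while (\<lambda>x. x = 0) (lehmer_code n (last \<pi>)) = \<mu>}))"
    unfolding EG_coeff_def
  proof (rule the_equality)
    show "schur_expansion (stanley n w)
      (\<lambda>\<mu>. int (card {\<pi> \<in> mLS_leaves w. strip_while (\<lambda>x. x = 0) (lehmer_code n (last \<pi>)) = \<mu>}))"
      by (rule schur_expansion_stanley[OF assms(1)])
  qed (rule schur_expansion_unique[OF _ schur_expansion_stanley[OF assms(1)]])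
  then show "EG_coeff n w \<mu> = int (card L)" by (simp add: L)
qed

end
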